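(* Let $\mathcal{M}$ be the family of $3$-graphs defined in the context. There exists $\epsilon_0>0$ such that for every $0<\epsilon<\epsilon_0$ there exists $n_0$ such that for all $n\ge n_0$ the following holds: every $\mathcal{M}$-free $3$-graph $\mathcal{H}$ with $n$ vertices and at least $2n^3/27-\epsilon n^3$ edges contains a set $W\subseteq V(\mathcal{H})$ with $|W|>n-3\epsilon^{1/2}n$ such that $\delta(\mathcal{H}[W])\ge 2n^2/9-20\epsilon^{1/2}n^2$ and $\mathcal{H}[W]$ is either semibipartite or $\mathcal{G}^2_6$-colorable.
   Context: An $r$-graph is an $r$-uniform hypergraph; $\mathcal{F}$-free means containing no member of $\mathcal{F}$ as a subgraph; "contained in" means isomorphic to a subgraph of. $\delta(\mathcal{H})$ is the minimum degree, the degree of a vertex being the number of edges containing it; $\mathcal{H}[W]$ is the induced subgraph on $W$. Transversal number $\tau(\mathcal{H})$: minimum size of a vertex set meeting every edge ($0$ if no edges). For $\ell\ge3$, $\mathcal{K}^3_{\ell+1}$: all $3$-graphs $F$ on at most $(\ell+1)+\binom{\ell+1}{2}$ vertices having an $(\ell+1)$-set $S$ (a core) every pair of which lies in an edge of $F$. Blowup of a $3$-graph $\mathcal{T}$ on $[s]$: replace vertex $i$ by a set of size $t_i\ge1$ (pairwise disjoint), each edge by the complete $3$-partite $3$-graph on the corresponding sets. $\mathcal{G}^1_n$: disjoint $A,B$, $|A|=\lfloor n/3\rfloor$, $|B|=\lceil 2n/3\rceil$, edges $\{a,b,b'\}$ with $a\in A$, $\{b,b'\}\subseteq B$. $\mathcal{G}^2_6$: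 all triples of $[6]$ except $\{1,2,3\},\{1,2,6\},\{3,4,5\},\{4,5,6\}$; for $n>6$, $\mathcal{G}^2_n$ is a blowup of $\mathcal{G}^2_6$ on $n$ vertices with maximum number of edges. $\mathcal{M}=M_1\cup M_2\cup M_3$ with $M_1=\{K_5^{3-}\}$ (complete $3$-graph on $5$ vertices minus an edge), $M_2$ = all $F\in\mathcal{K}^3_7$ with a core $S$ such that $\tau(F[S])\ge2$, $M_3$ = all $F\in\mathcal{K}^3_6$ not contained in $\mathcal{G}^1_n$ for any $n\ge1$ and not contained in $\mathcal{G}^2_n$ for any $n\ge6$. A $3$-graph is semibipartite if its vertex set has a partition $A\cup B$ with $|E\cap A|=1$, $|E\cap B|=2$ for every edge $E$; it is $\mathcal{G}^2_6$-colorable if it is a subgraph of a blowup of $\mathcal{G}^2_6$. *)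

theory Defs
  imports Complex_Main
begin

type_synonym 'a hgraph = "'a set \<times> 'a set set"

definition three_graph :: "'a hgraph \<Rightarrow> bool" where
  "three_graph H \<longleftrightarrow> finite (fst H) \<and> (\<forall>e\<in>snd H. e \<subseteq> fst H \<and> card e = 3)"

definition contained_in :: "'b hgraph \<Rightarrow> 'a hgraph \<Rightarrow> bool" where
  "contained_in F H \<longleftrightarrow> (\<exists>f. inj_on f (fst F) \<and> f ` fst F \<subseteq> fst H \<and>
                              (\<forall>e\<in>snd F. f ` e \<in> snd H))"

definition induced :: "'a hgraph \<Rightarrow> 'a set \<Rightarrow> 'a hgraph" where
  "induced H W = (W, {e\<in>snd H. e \<subseteq> W})"

definition degree :: "'a hgraph \<Rightarrow> 'a \<Rightarrow> nat" where
  "degree H v = card {e\<in>snd H. v \<in> e}"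

definition tau :: "'a hgraph \<Rightarrow> nat" where
  "tau H = (LEAST k. \<exists>T. T \<subseteq> fst H \<and> card T = k \<and> (\<forall>e\<in>snd H. e \<inter> T \<noteq> {}))"

definition is_core :: "nat hgraph \<Rightarrow> nat \<Rightarrow> nat set \<Rightarrow> bool" where
  "is_core F k S \<longleftrightarrow> S \<subseteq> fst F \<and> card S = k \<and>
     (\<forall>x\<in>S. \<forall>y\<in>S. x \<noteq> y \<longrightarrow> (\<exists>e\<in>snd F. x \<in> e \<and> y \<in> e))"

definition in_K :: "nat \<Rightarrow> nat hgraph \<Rightarrow> bool" where
  "in_K k F \<longleftrightarrow> three_graph F \<and> card (fst F) \<le> k + (k choose 2) \<and> (\<exists>S. is_core F k S)"

definition G1 :: "nat \<Rightarrow> nat hgraph" where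
  "G1 n = ({0..<n}, {e. \<exists>a b b'. a < n div 3 \<and> n div 3 \<le> b \<and> b < n \<and> n div 3 \<le> b' \<and> b' < n
                         \<and> b \<noteq> b' \<and> e = {a, b, b'}})"

definition G26 :: "nat hgraph" where
  "G26 = ({1..6}, {e. e \<subseteq> {1..6} \<and> card e = 3} - {{1,2,3},{1,2,6},{3,4,5},{4,5,6}})"

text \<open>Blowup of a 3-graph T on vertex set {1..s}: vertex set {0..<n}, phi maps {0..<n} onto
  {1..s} (parts phi^-1(i) of size t_i \<ge> 1), edges are the triples mapped bijectively onto an edge of T.\<close>
definition blowup_map :: "nat hgraph \<Rightarrow> nat \<Rightarrow> (nat \<Rightarrow> nat) \<Rightarrow> bool" where
  "blowup_map T n phi \<longleftrightarrow> phi ` {0..<n} = fst T"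

definition blowup :: "nat hgraph \<Rightarrow> nat \<Rightarrow> (nat \<Rightarrow> nat) \<Rightarrow> nat hgraph" where
  "blowup T n phi = ({0..<n}, {e. e \<subseteq> {0..<n} \<and> card e = 3 \<and> inj_on phi e \<and> phi ` e \<in> snd T})"

text \<open>G^2_n (n \<ge> 6): blowup of G^2_6 on n vertices with maximum number of edges
  (for n = 6 this is G^2_6 itself, up to relabelling).\<close>
definition is_G2 :: "nat \<Rightarrow> nat hgraph \<Rightarrow> bool" where
  "is_G2 n G \<longleftrightarrow> (\<exists>phi. blowup_map G26 n phi \<and> G = blowup G26 n phi \<and>
      (\<forall>psi. blowup_map G26 n psi \<longrightarrow> card (snd (blowup G26 n psi)) \<le> card (snd G)))"

definition K5minus :: "nat hgraph" where
  "K5minus = ({0..<5}, {e. e \<subseteq> {0..<5} \<and> card e = 3} - {{0,1,2}})"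

definition M1 :: "nat hgraph \<Rightarrow> bool" where
  "M1 F \<longleftrightarrow> F = K5minus"

definition M2 :: "nat hgraph \<Rightarrow> bool" where
  "M2 F \<longleftrightarrow> in_K 7 F \<and> (\<exists>S. is_core F 7 S \<and> tau (induced F S) \<ge> 2)"

definition M3 :: "nat hgraph \<Rightarrow> bool" where
  "M3 F \<longleftrightarrow> in_K 6 F \<and> (\<forall>n\<ge>1. \<not> contained_in F (G1 n)) \<and>
            (\<forall>n\<ge>6. \<forall>G. is_G2 n G \<longrightarrow> \<not> contained_in F G)"

definition M_family :: "nat hgraph \<Rightarrow> bool" where
  "M_family F \<longleftrightarrow> M1 F \<or> M2 F \<or> M3 F"

definition M_free :: "'a hgraph \<Rightarrow> bool" where
  "M_free H \<longleftrightarrow> (\<forall>F. M_family F \<longrightarrow> \<not> contained_in F H)"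

definition semibipartite :: "'a hgraph \<Rightarrow> bool" where
  "semibipartite H \<longleftrightarrow> (\<exists>A B. A \<inter> B = {} \<and> A \<union> B = fst H \<and>
      (\<forall>e\<in>snd H. card (e \<inter> A) = 1 \<and> card (e \<inter> B) = 2))"

definition G26_colorable :: "'a hgraph \<Rightarrow> bool" where
  "G26_colorable H \<longleftrightarrow> (\<exists>n phi. blowup_map G26 n phi \<and> contained_in H (blowup G26 n phi))"

end

theory Submission
  imports Defs
begin

text \<open>
  Forget \<open>\<M>\<close> and keep three local consequences of being \<open>\<M>\<close>-free (\<open>good\<close> below): no \<open>K\<^sub>5\<^sup>3\<^sup>-\<close>; the edges inside
  seven pairwise covered vertices share a vertex; six pairwise covered vertices induce a semibipartite or a
  \<open>\<G>\<^sup>2\<^sub>6\<close>-coloured system. These survive replacing a vertex by a copy of a vertex not covered together with it.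

  If any two vertices of a good system are covered or twins, the system is a blowup of a system in which all
  pairs are covered, and the three properties make it semibipartite or \<open>\<G>\<^sup>2\<^sub>6\<close>-colourable (\<open>tame\<close>), so it has at
  most \<open>2n\<^sup>3/27\<close> edges. By symmetrization every good system has at most that many edges; hence in a
  nearly extremal one all but \<open>3\<epsilon>\<^sup>1\<^sup>/\<^sup>2n\<close> vertices have degree at least \<open>2n\<^sup>2/9 - 2\<epsilon>\<^sup>1\<^sup>/\<^sup>2n\<^sup>2\<close>.

  That these vertices induce a tame system is shown by following the symmetrization backwards: a single step
  changes one vertex, and the few vertices that enter the high-degree set are put back one at a time. Putting
  back one vertex \<open>x\<close> is possible because a tame system of large minimum degree is almost a complete
  balanced blowup: any other position of \<open>x\<close> yields seven or six pairwise covered vertices violating goodness.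
\<close>

section \<open>Good triple systems\<close>

text \<open>The number of symmetrization steps is not bounded in terms of \<open>eps\<close>, so an
  error that grew with every step would be fatal. The induction therefore carries an exact
  statement, \<open>tame\<close> on the set of all vertices of high degree, and this set is computed
  afresh for each system. Edge counts never drop along the way, so \<open>good_card\<close> leaves
  fewer than \<open>3 * r * n\<close> vertices outside each of these sets, where \<open>r\<close> is
  the square root of \<open>eps\<close>. Two consecutive systems differ at one vertex only, so their
  high-degree sets share all but at most \<open>7 * r * n\<close> vertices, however many steps there
  are. Putting a vertex back into a coloured system is delicate because a pair in its link may be
  atypical, with many expected edges missing. It takes two rounds: typical pairs first show that the
  link agrees almost everywhere with the intended colour; then the new vertex is itself typical and
  helps to treat the remaining pairs. The constants are chained as \<open>eps < 10^-68\<close>,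
  \<open>r <= 10^-34\<close>, and \<open>9 * r <= 10^-33\<close> for the relative degree loss when
  vertices are put back.\<close>

definition covered :: "'a set set \<Rightarrow> 'a \<Rightarrow> 'a \<Rightarrow> bool" where
  "covered E u v \<longleftrightarrow> (\<exists>e\<in>E. u \<in> e \<and> v \<in> e)"

definition clique :: "'a set set \<Rightarrow> 'a set \<Rightarrow> bool" where
  "clique E S \<longleftrightarrow> (\<forall>x\<in>S. \<forall>y\<in>S. x \<noteq> y \<longrightarrow> covered E x y)"

definition semibip_on :: "'a set set \<Rightarrow> 'a set \<Rightarrow> bool" where
  "semibip_on E W \<longleftrightarrow> (\<exists>A. \<forall>e\<in>E. e \<subseteq> W \<longrightarrow> card (e \<inter> A) = 1)"

definition G26_on :: "'a set set \<Rightarrow> 'a set \<Rightarrow> bool" where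
  "G26_on E W \<longleftrightarrow> (\<exists>c. c ` W \<subseteq> {1..6} \<and> (\<forall>e\<in>E. e \<subseteq> W \<longrightarrow> c ` e \<in> snd G26))"

definition tame :: "'a set set \<Rightarrow> 'a set \<Rightarrow> bool" where
  "tame E W \<longleftrightarrow> semibip_on E W \<or> G26_on E W"

text \<open>The tenth triple \<open>{a,b,c}\<close> may or may not belong to \<open>E\<close>, so
  the complete system on five vertices is excluded as well.\<close>

definition K5m_free :: "'a set set \<Rightarrow> bool" where
  "K5m_free E \<longleftrightarrow> (\<forall>a b c d e. distinct [a,b,c,d,e] \<longrightarrow>
     \<not> {{a,b,d},{a,b,e},{a,c,d},{a,c,e},{a,d,e},{b,c,d},{b,c,e},{b,d,e},{c,d,e}} \<subseteq> E)"

text \<open>For nonempty \<open>S\<close> this is transversal number at most 1 inside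
  \<open>S\<close>; if \<open>S\<close> spans no edge, any of its vertices qualifies.\<close>

definition star_on :: "'a set set \<Rightarrow> 'a set \<Rightarrow> bool" where
  "star_on E S \<longleftrightarrow> (\<exists>v\<in>S. \<forall>e\<in>E. e \<subseteq> S \<longrightarrow> v \<in> e)"

text \<open>On six vertices \<open>c\<close> is a bijection, so the edges embed into
  \<open>G26\<close> itself and not merely into a blowup. The rigidity lemmas
  \<open>no_G26_one_link\<close> and \<open>no_G26_nonedge\<close> rest on this.\<close>

definition G26_inj :: "'a set set \<Rightarrow> 'a set \<Rightarrow> bool" where
  "G26_inj E S \<longleftrightarrow>
     (\<exists>c. inj_on c S \<and> c ` S \<subseteq> {1..6} \<and> (\<forall>e\<in>E. e \<subseteq> S \<longrightarrow> c ` e \<in> snd G26))"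

definition good :: "'a set set \<Rightarrow> bool" where
  "good E \<longleftrightarrow> K5m_free E \<and>
     (\<forall>S. card S = 7 \<longrightarrow> clique E S \<longrightarrow> star_on E S) \<and>
     (\<forall>S. card S = 6 \<longrightarrow> clique E S \<longrightarrow> semibip_on E S \<or> G26_inj E S)"

lemma three_graphD:
  assumes "three_graph (V, E)"
  shows "finite V" "\<And>e. e \<in> E \<Longrightarrow> e \<subseteq> V" "\<And>e. e \<in> E \<Longrightarrow> card e = 3"
    "\<And>e. e \<in> E \<Longrightarrow> finite e" "finite E"
proof -
  show 1: "finite V" and 2: "\<And>e. e \<in> E \<Longrightarrow> e \<subseteq> V" and "\<And>e. e \<in> E \<Longrightarrow> card e = 3"
    using assms by (auto simp: three_graph_def)
  show "\<And>e. e \<in> E \<Longrightarrow> finite e" using 1 2 finite_subset by blast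
  show "finite E" using 1 2 by (meson PowI finite_Pow_iff finite_subset subsetI)
qed

lemma covered_sym: "covered E u v \<longleftrightarrow> covered E v u"
  by (auto simp: covered_def)

lemma coveredI: "e \<in> E \<Longrightarrow> u \<in> e \<Longrightarrow> v \<in> e \<Longrightarrow> covered E u v"
  by (auto simp: covered_def)

lemma clique_mono: "clique E' S \<Longrightarrow> E' \<subseteq> E \<Longrightarrow> clique E S"
  unfolding clique_def covered_def by blast

lemma good_mono:
  assumes "good E" "E' \<subseteq> E" shows "good E'"
proof -
  have "K5m_free E" using assms(1) unfolding good_def by blast
  then have "K5m_free E'"
    unfolding K5m_free_def using assms(2) by (intro allI impI notI, elim allE impE) (assumption, auto)
  moreover have "star_on E' S" if "star_on E S" for S
    using that assms(2) unfolding star_on_def by blast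
  moreover have "semibip_on E' S" if "semibip_on E S" for S
    using that assms(2) unfolding semibip_on_def by blast
  moreover have "G26_inj E' S" if "G26_inj E S" for S
    using that subsetD[OF assms(2)] unfolding G26_inj_def by metis
  ultimately show ?thesis
    using assms clique_mono[OF _ assms(2)] unfolding good_def by blast
qed

lemma tame_subset: "tame E W \<Longrightarrow> W' \<subseteq> W \<Longrightarrow> tame E W'"
  unfolding tame_def semibip_on_def G26_on_def by (meson image_mono order_trans)

lemma tame_cong:
  assumes "\<And>e. e \<subseteq> W \<Longrightarrow> e \<in> E \<longleftrightarrow> e \<in> E'"
  shows "tame E W \<longleftrightarrow> tame E' W"
proof -
  have "(\<forall>e\<in>E. e \<subseteq> W \<longrightarrow> P e) \<longleftrightarrow> (\<forall>e\<in>E'. e \<subseteq> W \<longrightarrow> P e)" for P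
    using assms by blast
  then show ?thesis unfolding tame_def semibip_on_def G26_on_def by simp
qed

section \<open>Translation back to \<open>semibipartite\<close> and
  \<open>G26_colorable\<close>\<close>

lemma semibip_on_imp:
  assumes "three_graph (V, E)" "semibip_on E W"
  shows "semibipartite (induced (V, E) W)"
proof -
  obtain A where A: "\<And>e. e \<in> E \<Longrightarrow> e \<subseteq> W \<Longrightarrow> card (e \<inter> A) = 1"
    using assms(2) unfolding semibip_on_def by blast
  have "card (e \<inter> (W \<inter> A)) = 1 \<and> card (e \<inter> (W - A)) = 2" if "e \<in> E" "e \<subseteq> W" for e
  proof -
    have eq: "e \<inter> (W \<inter> A) = e \<inter> A" "e \<inter> (W - A) = e - (e \<inter> A)" using that by auto
    have "card (e - (e \<inter> A)) = card e - card (e \<inter> A)"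
      by (rule card_Diff_subset) (use three_graphD[OF assms(1)] that in auto)
    then show ?thesis unfolding eq using A[OF that] three_graphD(3)[OF assms(1) that(1)] by simp
  qed
  then show ?thesis unfolding semibipartite_def induced_def
    by (intro exI[of _ "W \<inter> A"] exI[of _ "W - A"]) auto
qed

lemma snd_G26: "e \<in> snd G26 \<Longrightarrow> e \<subseteq> {1..6} \<and> card e = 3 \<and> finite e"
proof -
  assume "e \<in> snd G26"
  then have "e \<subseteq> {1..6}" "card e = 3" unfolding G26_def by simp_all
  then show ?thesis by (simp add: finite_subset[of e "{1..6}"])
qed

lemma G26_on_imp:
  assumes "three_graph (V, E)" "W \<subseteq> V" "G26_on E W"
  shows "G26_colorable (induced (V, E) W)"
proof -
  obtain c where c: "c ` W \<subseteq> {1..6}" "\<And>e. e \<in> E \<Longrightarrow> e \<subseteq> W \<Longrightarrow> c ` e \<in> snd G26"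
    using assms(3) unfolding G26_on_def by metis
  have fW: "finite W" using assms three_graphD(1) finite_subset by blast
  obtain h where h: "bij_betw h W {0..<card W}" using ex_bij_betw_finite_nat[OF fW] by blast
  define m where "m = card W"
  \<comment> \<open>The vertices \<open>m..m+5\<close> are dummies that make every part of the blowup nonempty.\<close>
  define phi where "phi i = (if i < m then c (inv_into W h i) else i - m + 1)" for i :: nat
  have hinv: "inv_into W h (h w) = w" "h w < m" if "w \<in> W" for w
    using h that unfolding bij_betw_def m_def by (auto simp: inv_into_f_f)
  have phic: "phi (h w) = c w" if "w \<in> W" for w
    using hinv[OF that] by (simp add: phi_def)
  have "phi ` {0..<m+6} = {1..6}"
  proof
    show "phi ` {0..<m+6} \<subseteq> {1..6}"
    proof
      fix y assume "y \<in> phi ` {0..<m+6}"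
      then obtain i where i: "i < m + 6" "y = phi i" by auto
      show "y \<in> {1..6}"
      proof (cases "i < m")
        case True
        then have "i \<in> h ` W" using h unfolding bij_betw_def m_def by auto
        then show ?thesis using i phic c(1) by auto
      next
        case False
        then show ?thesis using i by (auto simp: phi_def)
      qed
    qed
    show "{1..6} \<subseteq> phi ` {0..<m+6}"
    proof
      fix y :: nat assume y: "y \<in> {1..6}"
      then have "phi (m + y - 1) = y" by (auto simp: phi_def)
      then show "y \<in> phi ` {0..<m+6}" using y by (intro image_eqI[of _ _ "m + y - 1"]) auto
    qed
  qed
  then have bm: "blowup_map G26 (m + 6) phi" by (simp add: blowup_map_def G26_def)
  have "contained_in (induced (V, E) W) (blowup G26 (m + 6) phi)"
    unfolding contained_in_def
  proof (intro exI[of _ h] conjI ballI)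
    show "inj_on h (fst (induced (V, E) W))" using h by (auto simp: induced_def bij_betw_def)
    show "h ` fst (induced (V, E) W) \<subseteq> fst (blowup G26 (m + 6) phi)"
      using hinv(2) by (fastforce simp: induced_def blowup_def)
    fix e assume "e \<in> snd (induced (V, E) W)"
    then have e: "e \<in> E" "e \<subseteq> W" by (auto simp: induced_def)
    have he: "phi ` h ` e = c ` e" using e phic by (force simp: image_image)
    have ce: "card (c ` e) = 3" using snd_G26 c(2)[OF e] by blast
    have c3: "card e = 3" using three_graphD(3)[OF assms(1) e(1)] .
    have fe: "finite e" using three_graphD(4)[OF assms(1) e(1)] .
    have "inj_on h e" using h e unfolding bij_betw_def by (meson inj_on_subset)
    then have ch: "card (h ` e) = 3" using c3 by (simp add: card_image)
    then have "inj_on phi (h ` e)" by (intro eq_card_imp_inj_on) (use he ce fe in auto)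
    moreover have "h ` e \<subseteq> {0..<m+6}" using e hinv(2) by fastforce
    ultimately show "h ` e \<in> snd (blowup G26 (m + 6) phi)"
      using he ch c(2)[OF e] by (simp add: blowup_def)
  qed
  then show ?thesis unfolding G26_colorable_def using bm by blast
qed

text \<open>One edge is picked for each pair in \<open>S\<close>; it has one vertex besides the
  pair, whence the bound \<open>k + (k choose 2)\<close>. All edges of \<open>E\<close> inside
  \<open>S\<close> are added, so that \<open>F\<close> shows the whole induced structure on its
  core. The map \<open>g\<close> renames vertices to naturals because the forbidden family lives on
  \<open>nat\<close>.\<close>

lemma clique_core:
  assumes tg: "three_graph (V, E)" and S: "clique E S" "card S = k" "2 \<le> k"
  obtains F :: "nat hgraph" and g where
    "in_K k F" "is_core F k (g ` S)" "inj_on g S" "contained_in F (V, E)"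
    "\<And>e. e \<in> E \<Longrightarrow> e \<subseteq> S \<Longrightarrow> g ` e \<in> snd F"
proof -
  note tgD = three_graphD[OF tg]
  have finS: "finite S" using S by (intro card_ge_0_finite) auto
  define Prs where "Prs = {p. p \<subseteq> S \<and> card p = 2}"
  have finP: "finite Prs" unfolding Prs_def using finS by simp
  have cardP: "card Prs = k choose 2" unfolding Prs_def using n_subsets[OF finS] S by simp
  have "\<exists>e\<in>E. p \<subseteq> e" if "p \<in> Prs" for p
  proof -
    obtain x y where "p = {x,y}" "x \<noteq> y" using \<open>p \<in> Prs\<close> by (auto simp: Prs_def card_2_iff)
    then show ?thesis using S(1) \<open>p \<in> Prs\<close> by (auto simp: Prs_def clique_def covered_def)
  qed
  then obtain q where q: "\<And>p. p \<in> Prs \<Longrightarrow> q p \<in> E \<and> p \<subseteq> q p" by metis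
  define VF where "VF = S \<union> (\<Union>p\<in>Prs. q p - p)"
  define EF where "EF = q ` Prs \<union> {e\<in>E. e \<subseteq> S}"
  have card1: "card (q p - p) = 1" if "p \<in> Prs" for p
  proof -
    have "finite p" using that finS by (auto simp: Prs_def intro: finite_subset)
    then have "card (q p - p) = card (q p) - card p" using q[OF that] by (intro card_Diff_subset) auto
    then show ?thesis using q[OF that] tgD(3) that by (simp add: Prs_def)
  qed
  have SV: "S \<subseteq> V"
  proof
    fix x assume x: "x \<in> S"
    have "card (S - {x}) \<ge> 1" using S x finS by simp
    then obtain y where "y \<in> S - {x}" by (metis card.empty ex_in_conv not_one_le_zero)
    then show "x \<in> V" using S(1) x tgD(2) by (auto simp: clique_def covered_def)
  qed
  have finV: "finite VF" unfolding VF_def using finS finP q tgD(4) by auto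
  have "card (\<Union>p\<in>Prs. q p - p) \<le> (\<Sum>p\<in>Prs. card (q p - p))" by (rule card_UN_le[OF finP])
  also have "\<dots> = k choose 2" using card1 cardP by simp
  finally have cV: "card VF \<le> k + (k choose 2)"
    unfolding VF_def using S(2) card_Un_le[of S "\<Union>p\<in>Prs. q p - p"] by linarith
  have EFV: "e \<subseteq> VF" "e \<in> E" if "e \<in> EF" for e
  proof -
    show "e \<in> E" using that q by (auto simp: EF_def)
    show "e \<subseteq> VF"
    proof (cases "e \<in> q ` Prs")
      case True
      then obtain p where p: "p \<in> Prs" "e = q p" by blast
      then have "p \<subseteq> S" by (simp add: Prs_def)
      then show ?thesis using p by (auto simp: VF_def)
    next
      case False then show ?thesis using that by (auto simp: EF_def VF_def)
    qed
  qed
  have VFV: "VF \<subseteq> V" using SV q tgD(2) by (fastforce simp: VF_def)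
  obtain g where g: "bij_betw g VF {0..<card VF}" using ex_bij_betw_finite_nat[OF finV] by blast
  have injg: "inj_on g VF" using g by (simp add: bij_betw_def)
  have injS: "inj_on g S" using injg by (rule inj_on_subset) (simp add: VF_def)
  define F where "F = (g ` VF, (`) g ` EF)"
  have tF: "three_graph F"
    unfolding three_graph_def F_def
  proof (intro conjI ballI)
    show "finite (fst (g ` VF, (`) g ` EF))" using finV by simp
    fix e assume "e \<in> snd (g ` VF, (`) g ` EF)"
    then obtain e' where e': "e' \<in> EF" "e = g ` e'" by auto
    then show "e \<subseteq> fst (g ` VF, (`) g ` EF)" using EFV by auto
    have "inj_on g e'" using injg EFV(1)[OF e'(1)] by (rule inj_on_subset)
    then show "card e = 3" using e' EFV tgD(3) by (simp add: card_image)
  qed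
  have core: "is_core F k (g ` S)"
    unfolding is_core_def
  proof (intro conjI ballI impI)
    show "g ` S \<subseteq> fst F" by (auto simp: F_def VF_def)
    show "card (g ` S) = k" using injS S by (simp add: card_image)
    fix x y assume "x \<in> g ` S" "y \<in> g ` S" "x \<noteq> y"
    then obtain x' y' where xy: "x' \<in> S" "y' \<in> S" "x = g x'" "y = g y'" "x' \<noteq> y'" by blast
    then have p: "{x',y'} \<in> Prs" by (simp add: Prs_def)
    then have "g ` q {x',y'} \<in> snd F" by (simp add: F_def EF_def)
    moreover have "x \<in> g ` q {x',y'}" "y \<in> g ` q {x',y'}" using q[OF p] xy by auto
    ultimately show "\<exists>e\<in>snd F. x \<in> e \<and> y \<in> e" by blast
  qed
  have inv: "inv_into VF g ` g ` e = e" if "e \<subseteq> VF" for e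
    using injg that by (simp add: inv_into_image_cancel)
  have cont: "contained_in F (V, E)"
    unfolding contained_in_def
  proof (intro exI[of _ "inv_into VF g"] conjI ballI)
    show "inj_on (inv_into VF g) (fst F)" by (simp add: F_def inj_on_inv_into)
    show "inv_into VF g ` fst F \<subseteq> fst (V, E)" using VFV inv[of VF] by (simp add: F_def)
    fix e assume "e \<in> snd F"
    then show "inv_into VF g ` e \<in> snd (V, E)" using inv EFV by (auto simp: F_def)
  qed
  show ?thesis
  proof (rule that[of F g])
    show "in_K k F" unfolding in_K_def using tF core cV card_image_le[OF finV, of g]
      by (auto simp: F_def intro: le_trans)
    fix e assume "e \<in> E" "e \<subseteq> S"
    then show "g ` e \<in> snd F" by (simp add: F_def EF_def)
  qed (use core injS cont in auto)
qed

lemma G1_semibip: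
  assumes "contained_in F (G1 n)"
  shows "\<exists>A. \<forall>e\<in>snd F. e \<subseteq> fst F \<longrightarrow> card (e \<inter> A) = 1"
proof -
  obtain f where f: "inj_on f (fst F)" "\<And>e. e \<in> snd F \<Longrightarrow> f ` e \<in> snd (G1 n)"
    using assms unfolding contained_in_def by blast
  have "card (e \<inter> {x. f x < n div 3}) = 1" if e: "e \<in> snd F" "e \<subseteq> fst F" for e
  proof -
    obtain a b b' where ab: "a < n div 3" "n div 3 \<le> b" "n div 3 \<le> b'" "f ` e = {a,b,b'}"
      using f(2)[OF e(1)] by (auto simp: G1_def)
    have "f ` (e \<inter> {x. f x < n div 3}) = f ` e \<inter> {y. y < n div 3}" by auto
    also have "\<dots> = {a}" using ab by auto
    finally have "card (f ` (e \<inter> {x. f x < n div 3})) = 1" by simp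
    moreover have "inj_on f (e \<inter> {x. f x < n div 3})" using f(1) e(2) by (meson inf_le1 inj_on_subset)
    ultimately show ?thesis by (simp add: card_image)
  qed
  then show ?thesis by blast
qed

lemma M_free_good:
  assumes tg: "three_graph (V, E)" and free: "M_free (V, E)"
  shows "good E"
  unfolding good_def K5m_free_def
proof (intro conjI allI impI)
  note tgD = three_graphD[OF tg]
  fix a b c d e :: 'a assume dist: "distinct [a,b,c,d,e]"
  show "\<not> {{a,b,d},{a,b,e},{a,c,d},{a,c,e},{a,d,e},{b,c,d},{b,c,e},{b,d,e},{c,d,e}} \<subseteq> E"
  proof
    assume E: "{{a,b,d},{a,b,e},{a,c,d},{a,c,e},{a,d,e},{b,c,d},{b,c,e},{b,d,e},{c,d,e}} \<subseteq> E"
    define f :: "nat \<Rightarrow> 'a" where "f i = [a,b,c,d,e] ! i" for i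
    have fs: "f 0 = a" "f 1 = b" "f (Suc 0) = b" "f 2 = c" "f 3 = d" "f 4 = e" by (auto simp: f_def)
    have set5: "{0..<5} = {0,1,2,3,4::nat}" by auto
    have "contained_in K5minus (V, E)"
      unfolding contained_in_def
    proof (intro exI[of _ f] conjI ballI)
      show inj: "inj_on f (fst K5minus)" using dist by (auto simp: K5minus_def set5 inj_on_def fs)
      have "{a,b,d} \<subseteq> V" "{a,c,e} \<subseteq> V" using E tgD(2) by (meson insert_subset)+
      then show "f ` fst K5minus \<subseteq> fst (V, E)" by (auto simp: K5minus_def set5 fs)
      fix s assume s: "s \<in> snd K5minus"
      then have "s \<subseteq> {0..<5}" "card s = 3" "s \<noteq> {0,1,2}" by (auto simp: K5minus_def)
      then obtain x y z where xyz: "s = {x,y,z}" "x < y" "y < z" "z < 5"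
      proof -
        have fs: "finite s" using \<open>card s = 3\<close> by (intro card_ge_0_finite) auto
        define l where "l = sorted_list_of_set s"
        have l: "length l = 3" "set l = s" "sorted_wrt (<) l"
          using fs \<open>card s = 3\<close> by (auto simp: l_def)
        then obtain x y z where "l = [x,y,z]" by (auto simp: numeral_3_eq_3 length_Suc_conv)
        then show thesis using l \<open>s \<subseteq> {0..<5}\<close> by (intro that[of x y z]) auto
      qed
      have "z = 2 \<or> z = 3 \<or> z = 4" "x = 0 \<or> x = 1 \<or> x = 2" "y = 1 \<or> y = 2 \<or> y = 3" using xyz by auto
      then show "f ` s \<in> snd (V, E)" using E xyz \<open>s \<noteq> {0,1,2}\<close>
        by (elim disjE) (auto simp: fs)
    qed
    then show False using free unfolding M_free_def M_family_def M1_def by blast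
  qed
next
  fix S :: "'a set" assume S: "card S = 7" "clique E S"
  show "star_on E S"
  proof (rule ccontr)
    assume no: "\<not> star_on E S"
    obtain F :: "nat hgraph" and g where F: "in_K 7 F" "is_core F 7 (g ` S)" "inj_on g S" "contained_in F (V, E)"
      "\<And>e. e \<in> E \<Longrightarrow> e \<subseteq> S \<Longrightarrow> g ` e \<in> snd F"
      by (rule clique_core[OF tg, of S 7]) (use S in auto)
    have finS: "finite S" using S by (intro card_ge_0_finite) auto
    have tF: "three_graph F" using F(1) by (simp add: in_K_def)
    let ?Q = "\<lambda>k. \<exists>T. T \<subseteq> g ` S \<and> card T = k \<and> (\<forall>e\<in>{e\<in>snd F. e \<subseteq> g ` S}. e \<inter> T \<noteq> {})"
    \<comment> \<open>The whole core is a transversal, so the \<open>LEAST\<close> in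
      \<open>tau\<close> is attained.\<close>
    have "?Q (card (g ` S))"
    proof (intro exI[of _ "g ` S"] conjI ballI)
      fix e assume e: "e \<in> {e\<in>snd F. e \<subseteq> g ` S}"
      then have "card e = 3" using tF by (auto simp: three_graph_def)
      then have "e \<noteq> {}" by auto
      then show "e \<inter> g ` S \<noteq> {}" using e by blast
    qed auto
    then have "?Q (LEAST k. ?Q k)" by (rule LeastI)
    then have "?Q (tau (induced F (g ` S)))" by (simp add: tau_def induced_def)
    then obtain T where T: "T \<subseteq> g ` S" "card T = tau (induced F (g ` S))"
      "\<And>e. e \<in> snd F \<Longrightarrow> e \<subseteq> g ` S \<Longrightarrow> e \<inter> T \<noteq> {}" by (metis (mono_tags, lifting) mem_Collect_eq)
    have finT: "finite T" using T(1) finS finite_subset by blast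
    obtain s where "s \<in> S" using S by fastforce
    have "tau (induced F (g ` S)) \<ge> 2"
    proof (rule ccontr)
      assume "\<not> 2 \<le> tau (induced F (g ` S))"
      then have "card T \<le> 1" using T(2) by linarith
      \<comment> \<open>An empty \<open>T\<close> means that the core spans no edge; then any vertex
        of \<open>S\<close> serves.\<close>
      have "\<exists>v\<in>S. T \<subseteq> {g v}"
      proof (cases "T = {}")
        case False
        then obtain t where t: "t \<in> T" by blast
        then obtain v where "v \<in> S" "t = g v" using T(1) by blast
        moreover have "T \<subseteq> {t}" using \<open>card T \<le> 1\<close> finT t card_le_Suc0_iff_eq[of T] by auto
        ultimately show ?thesis by blast
      qed (use \<open>s \<in> S\<close> in auto)
      then obtain v where v: "v \<in> S" "T \<subseteq> {g v}" by blast
      obtain e where e: "e \<in> E" "e \<subseteq> S" "v \<notin> e" using no v(1) unfolding star_on_def by blast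
      have "g ` e \<inter> T \<noteq> {}" by (rule T(3)[OF F(5)[OF e(1,2)] image_mono[OF e(2)]])
      then have "g v \<in> g ` e" using v(2) by (metis disjoint_iff singletonD subsetD)
      then show False using F(3) e v(1) by (meson inj_on_image_mem_iff)
    qed
    then have "M2 F" unfolding M2_def using F by blast
    then show False using free F(4) unfolding M_free_def M_family_def by blast
  qed
next
  fix S :: "'a set" assume S: "card S = 6" "clique E S"
  obtain F :: "nat hgraph" and g where F: "in_K 6 F" "is_core F 6 (g ` S)" "inj_on g S" "contained_in F (V, E)"
      "\<And>e. e \<in> E \<Longrightarrow> e \<subseteq> S \<Longrightarrow> g ` e \<in> snd F"
      by (rule clique_core[OF tg, of S 6]) (use S in auto)
  have tF: "three_graph F" using F(1) by (simp add: in_K_def)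
  have "\<not> M3 F" using free F(4) unfolding M_free_def M_family_def by blast
  then have "(\<exists>n. contained_in F (G1 n)) \<or> (\<exists>n G. is_G2 n G \<and> contained_in F G)"
    using F(1) unfolding M3_def by blast
  then show "semibip_on E S \<or> G26_inj E S"
  proof (elim disjE exE conjE)
    fix n assume "contained_in F (G1 n)"
    then obtain A where A: "\<And>e. e \<in> snd F \<Longrightarrow> e \<subseteq> fst F \<Longrightarrow> card (e \<inter> A) = 1"
      using G1_semibip by metis
    have "card (e \<inter> {x. g x \<in> A}) = 1" if e: "e \<in> E" "e \<subseteq> S" for e
    proof -
      have "g ` (e \<inter> {x. g x \<in> A}) = g ` e \<inter> A" by auto
      moreover have "card (g ` e \<inter> A) = 1"
        using A[OF F(5)[OF e]] F(5)[OF e] tF by (auto simp: three_graph_def)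
      moreover have "inj_on g (e \<inter> {x. g x \<in> A})" using F(3) e(2) by (meson inf_le1 inj_on_subset)
      ultimately show ?thesis by (metis card_image)
    qed
    then show ?thesis unfolding semibip_on_def by blast
  next
    fix n G assume "is_G2 n G" "contained_in F G"
    then obtain phi f where phi: "blowup_map G26 n phi" and
      f: "inj_on f (fst F)" "f ` fst F \<subseteq> {0..<n}" "\<And>e. e \<in> snd F \<Longrightarrow> f ` e \<in> snd (blowup G26 n phi)"
      unfolding is_G2_def contained_in_def by (auto simp: blowup_def)
    define c where "c x = phi (f (g x))" for x
    have gS: "g ` S \<subseteq> fst F" using F(2) by (simp add: is_core_def)
    \<comment> \<open>Two vertices in the same part of a blowup lie in no common edge, whereas any
      two core vertices do.\<close>
    have "inj_on c S"
    proof (rule inj_onI, rule ccontr)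
      fix x y assume xy: "x \<in> S" "y \<in> S" "c x = c y" "x \<noteq> y"
      then have "g x \<noteq> g y" using F(3) by (meson inj_onD)
      then obtain e where e: "e \<in> snd F" "g x \<in> e" "g y \<in> e" using F(2) xy unfolding is_core_def by (metis imageI)
      then have "f (g x) = f (g y)" using f(3)[OF e(1)] xy(3) by (auto simp: blowup_def c_def dest: inj_onD)
      moreover have "g x \<in> fst F" "g y \<in> fst F" using gS xy by auto
      ultimately show False using f(1) \<open>g x \<noteq> g y\<close> by (meson inj_onD)
    qed
    moreover have "c ` S \<subseteq> {1..6}"
      using phi gS f(2) by (fastforce simp: blowup_map_def G26_def c_def)
    moreover have "c ` e \<in> snd G26" if "e \<in> E" "e \<subseteq> S" for e
      using f(3)[OF F(5)[OF that]] by (simp add: blowup_def c_def image_image)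
    ultimately show ?thesis unfolding G26_inj_def by blast
  qed
qed

section \<open>Symmetrized systems\<close>

definition link :: "'a set set \<Rightarrow> 'a \<Rightarrow> 'a set set" where
  "link E v = {f. v \<notin> f \<and> insert v f \<in> E}"

definition twin :: "'a set set \<Rightarrow> 'a \<Rightarrow> 'a \<Rightarrow> bool" where
  "twin E u v \<longleftrightarrow> link E u = link E v"

definition symmetrized :: "'a set \<Rightarrow> 'a set set \<Rightarrow> bool" where
  "symmetrized V E \<longleftrightarrow> (\<forall>u\<in>V. \<forall>v\<in>V. covered E u v \<or> twin E u v)"

lemma twin_swap:
  assumes "twin E u v" "e \<in> E" "u \<in> e"
  shows "insert v (e - {u}) \<in> E"
proof -
  have "e - {u} \<in> link E u" using assms by (simp add: link_def insert_absorb)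
  then have "e - {u} \<in> link E v" using assms(1) by (simp add: twin_def)
  then show ?thesis by (simp add: link_def)
qed

lemma card_3_obtain:
  assumes "card e = 3"
  obtains a b c where "e = {a,b,c}" "a \<noteq> b" "a \<noteq> c" "b \<noteq> c"
  using assms by (auto simp: card_3_iff)

lemma card_3_distinct: "card {a,b,c} = 3 \<longleftrightarrow> a \<noteq> b \<and> a \<noteq> c \<and> b \<noteq> c"
  by (auto simp: card_insert_if)

lemma G26I:
  assumes "T \<subseteq> {1..6}" "card T = 3" "T \<noteq> {1,2,3}" "T \<noteq> {1,2,6}" "T \<noteq> {3,4,5}" "T \<noteq> {4,5,6}"
  shows "T \<in> snd G26"
  using assms by (simp add: G26_def)

text \<open>At least two triples of \<open>R\<close> are missing, since one missing triple would
  leave \<open>K5minus\<close>. Two distinct triples of a 5-set meet in one or two vertices.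
  \<open>G26\<close> without colour 3 has exactly two nonedges, meeting in one vertex;
  \<open>G26\<close> without colour 2 has exactly two, meeting in two vertices.\<close>

lemma five_clique_G26:
  assumes K5: "K5m_free E" and card5: "card R = 5" and E3: "\<And>e. e \<in> E \<Longrightarrow> card e = 3"
  shows "G26_on E R"
proof -
  have finR: "finite R" using card5 by (intro card_ge_0_finite) auto
  have "\<exists>t1 t2. t1 \<noteq> t2 \<and> t1 \<subseteq> R \<and> t2 \<subseteq> R \<and> card t1 = 3 \<and> card t2 = 3 \<and> t1 \<notin> E \<and> t2 \<notin> E"
  proof (rule ccontr)
    assume no: "\<not> ?thesis"
    obtain t where t: "t \<subseteq> R" "card t = 3" "\<And>s. s \<subseteq> R \<Longrightarrow> card s = 3 \<Longrightarrow> s \<noteq> t \<Longrightarrow> s \<in> E"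
    proof (cases "\<exists>t. t \<subseteq> R \<and> card t = 3 \<and> t \<notin> E")
      case True
      then obtain t where "t \<subseteq> R" "card t = 3" "t \<notin> E" by (elim exE conjE)
      then show ?thesis using no that[of t] by metis
    next
      case False
      obtain t where "t \<subseteq> R" "card t = 3" using obtain_subset_with_card_n[of 3 R] card5 by auto
      then show ?thesis using False that[of t] by metis
    qed
    obtain a b c where abc: "t = {a,b,c}" "a \<noteq> b" "a \<noteq> c" "b \<noteq> c" using card_3_obtain[OF t(2)] .
    have "card (R - t) = 2" using t finR card5 by (subst card_Diff_subset) (auto intro: finite_subset)
    then obtain d e where de: "R - t = {d,e}" "d \<noteq> e" by (auto simp: card_2_iff)
    have R: "R = {a,b,c,d,e}" "d \<notin> t" "e \<notin> t" using de t abc by auto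
    then have dist: "distinct [a,b,c,d,e]" using abc de by auto
    have mem: "{x,y,z} \<in> E" if "x \<in> R" "y \<in> R" "z \<in> {d,e}" "x \<noteq> y" "x \<noteq> z" "y \<noteq> z" for x y z
      by (rule t(3)) (use that R in auto)
    have "{{a,b,d},{a,b,e},{a,c,d},{a,c,e},{a,d,e},{b,c,d},{b,c,e},{b,d,e},{c,d,e}} \<subseteq> E"
      using dist by (auto intro!: mem simp: R)
    then show False using K5 dist unfolding K5m_free_def by metis
  qed
  then obtain t1 t2 where t: "t1 \<noteq> t2" "t1 \<subseteq> R" "t2 \<subseteq> R" "card t1 = 3" "card t2 = 3" "t1 \<notin> E" "t2 \<notin> E"
    by (elim exE conjE)
  have fin: "finite t1" "finite t2" using t finR finite_subset by auto
  have "card (t1 \<union> t2) \<le> 5" using t card5 finR by (metis card_mono le_sup_iff)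
  then have "card (t1 \<inter> t2) \<ge> 1" using card_Un_Int[OF fin] t by linarith
  moreover have "card (t1 \<inter> t2) \<noteq> 3" using t fin by (metis card_subset_eq inf_le1 inf_le2)
  moreover have "card (t1 \<inter> t2) \<le> 3" using t fin by (metis card_mono inf_le1)
  ultimately consider "card (t1 \<inter> t2) = 1" | "card (t1 \<inter> t2) = 2" by linarith
  then obtain c where c: "inj_on c R" "c ` R \<subseteq> {1..6::nat}"
    "\<And>e. e \<subseteq> R \<Longrightarrow> e \<noteq> t1 \<Longrightarrow> e \<noteq> t2 \<Longrightarrow> c ` e \<noteq> {1,2,3} \<and> c ` e \<noteq> {1,2,6} \<and> c ` e \<noteq> {3,4,5} \<and> c ` e \<noteq> {4,5,6}"
  proof cases
    case 1
    then obtain a where a: "t1 \<inter> t2 = {a}" by (auto simp: card_1_singleton_iff)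
    have "card (t1 - {a}) = 2" "card (t2 - {a}) = 2" using t a fin by (auto simp: card_Diff_singleton_if)
    then obtain b d p q where bd: "t1 - {a} = {b,d}" "b \<noteq> d" "t2 - {a} = {p,q}" "p \<noteq> q"
      by (auto simp: card_2_iff)
    have t12: "t1 = {a,b,d}" "t2 = {a,p,q}" using bd a by auto
    have dist: "distinct [a,b,d,p,q]" using a bd t12 by auto
    have "{a,b,d,p,q} = R"
      by (rule card_subset_eq) (use finR t t12 dist card5 in auto)
    then have R: "R = {a,b,d,p,q}" by simp
    define c where "c = (\<lambda>x. 0::nat)(a := 6, b := 1, d := 2, p := 4, q := 5)"
    have cs: "c a = 6" "c b = 1" "c d = 2" "c p = 4" "c q = 5" using dist by (auto simp: c_def)
    have inj: "inj_on c R" unfolding R using dist cs by (auto simp: inj_on_def)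
    have img: "c ` R = {6,1,2,4,5}" unfolding R using cs by simp
    have 3: "c ` t1 = {1,2,6}" "c ` t2 = {4,5,6}" unfolding t12 using cs by auto
    show ?thesis
    proof (rule that[of c])
      fix e assume e: "e \<subseteq> R" "e \<noteq> t1" "e \<noteq> t2"
      have "c ` e \<noteq> {1,2,6}" "c ` e \<noteq> {4,5,6}"
        using inj_on_image_eq_iff[OF inj e(1)] t e 3 by metis+
      moreover have "3 \<notin> c ` e" using img image_mono[OF e(1), of c] by auto
      ultimately show "c ` e \<noteq> {1,2,3} \<and> c ` e \<noteq> {1,2,6} \<and> c ` e \<noteq> {3,4,5} \<and> c ` e \<noteq> {4,5,6}" by auto
    qed (use inj img in auto)
  next
    case 2
    then obtain a b where ab: "t1 \<inter> t2 = {a,b}" "a \<noteq> b" by (auto simp: card_2_iff)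
    have "card (t1 - {a,b}) = 1" "card (t2 - {a,b}) = 1" using t ab fin by (subst card_Diff_subset; auto)+
    then obtain d p where bd: "t1 - {a,b} = {d}" "t2 - {a,b} = {p}"
      by (auto simp: card_1_singleton_iff)
    have t12: "t1 = {a,b,d}" "t2 = {a,b,p}" using bd ab by auto
    have dist4: "distinct [a,b,d,p]" using ab bd t12 t(1) by auto
    have "card (R - {a,b,d,p}) = 1" using t t12 dist4 card5 by (subst card_Diff_subset) auto
    then obtain q where q: "R - {a,b,d,p} = {q}" by (auto simp: card_1_singleton_iff)
    have R: "R = {a,b,d,p,q}" using q t t12 by auto
    have dist: "distinct [a,b,d,p,q]" using dist4 q by auto
    define c where "c = (\<lambda>x. 0::nat)(a := 4, b := 5, d := 3, p := 6, q := 1)"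
    have cs: "c a = 4" "c b = 5" "c d = 3" "c p = 6" "c q = 1" using dist by (auto simp: c_def)
    have inj: "inj_on c R" unfolding R using dist cs by (auto simp: inj_on_def)
    have img: "c ` R = {4,5,3,6,1}" unfolding R using cs by simp
    have 3: "c ` t1 = {3,4,5}" "c ` t2 = {4,5,6}" unfolding t12 using cs by auto
    show ?thesis
    proof (rule that[of c])
      fix e assume e: "e \<subseteq> R" "e \<noteq> t1" "e \<noteq> t2"
      have "c ` e \<noteq> {3,4,5}" "c ` e \<noteq> {4,5,6}"
        using inj_on_image_eq_iff[OF inj e(1)] t e 3 by metis+
      moreover have "2 \<notin> c ` e" using img image_mono[OF e(1), of c] by auto
      ultimately show "c ` e \<noteq> {1,2,3} \<and> c ` e \<noteq> {1,2,6} \<and> c ` e \<noteq> {3,4,5} \<and> c ` e \<noteq> {4,5,6}" by auto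
    qed (use inj img in auto)
  qed
  have "c ` e \<in> snd G26" if e: "e \<in> E" "e \<subseteq> R" for e
  proof (rule G26I)
    show "c ` e \<subseteq> {1..6}" using c(2) e by blast
    show "card (c ` e) = 3" using E3[OF e(1)] inj_on_subset[OF c(1) e(2)] by (simp add: card_image)
    have "e \<noteq> t1" "e \<noteq> t2" using e t by auto
    then show "c ` e \<noteq> {1,2,3}" "c ` e \<noteq> {1,2,6}" "c ` e \<noteq> {3,4,5}" "c ` e \<noteq> {4,5,6}"
      using c(3)[OF e(2)] by auto
  qed
  then show ?thesis unfolding G26_on_def using c(2) by metis
qed

text \<open>A Helly-type argument: edges that together span at most seven vertices share a vertex,
  because these vertices extend to a 7-clique. Two edges span at most six vertices, hence they meet;
  three pairwise meeting edges span at most seven, hence they share a vertex. A vertex common to all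
  edges then serves as the class \<open>A\<close>.\<close>

lemma large_clique_star:
  assumes star7: "\<And>S. card S = 7 \<Longrightarrow> clique E S \<Longrightarrow> star_on E S"
    and R: "clique E R" "finite R" "7 \<le> card R"
    and E3: "\<And>e. e \<in> E \<Longrightarrow> card e = 3"
  shows "semibip_on E R"
proof -
  have common: "\<exists>v. \<forall>e\<in>E. e \<subseteq> X \<longrightarrow> v \<in> e" if X: "X \<subseteq> R" "card X \<le> 7" for X
  proof -
    obtain S where S: "X \<subseteq> S" "S \<subseteq> R" "card S = 7"
      using exists_subset_between[OF X(2) R(3) X(1) R(2)] by metis
    have "clique E S" using R(1) S(2) unfolding clique_def by blast
    from star7[OF S(3) this] show ?thesis unfolding star_on_def using S(1) by (meson order_trans)
  qed
  have two: "e \<inter> f \<noteq> {}" if ef: "e \<in> E" "f \<in> E" "e \<subseteq> R" "f \<subseteq> R" for e f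
  proof -
    have "card (e \<union> f) \<le> 7" using card_Un_le[of e f] E3[OF ef(1)] E3[OF ef(2)] by linarith
    then obtain v where "\<forall>e'\<in>E. e' \<subseteq> e \<union> f \<longrightarrow> v \<in> e'" using common[of "e \<union> f"] ef by auto
    then have "v \<in> e" "v \<in> f" using ef by auto
    then show ?thesis by auto
  qed
  have three: "\<exists>v. v \<in> e \<and> v \<in> f \<and> v \<in> g"
    if efg: "e \<in> E" "f \<in> E" "g \<in> E" "e \<subseteq> R" "f \<subseteq> R" "g \<subseteq> R" for e f g
  proof -
    have fin: "finite e" "finite f" "finite g" using efg finite_subset[OF _ R(2)] by auto
    have "card (e \<inter> f) \<ge> 1" using two[of e f] efg fin by (simp add: Suc_leI card_gt_0_iff)
    then have 1: "card (e \<union> f) \<le> 5" using card_Un_Int[OF fin(1,2)] E3[OF efg(1)] E3[OF efg(2)] by linarith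
    have "g \<inter> (e \<union> f) \<noteq> {}" using two[of g e] efg by blast
    then have "card ((e \<union> f) \<inter> g) \<ge> 1" using fin by (simp add: Suc_leI card_gt_0_iff Int_commute)
    moreover have "finite (e \<union> f)" using fin by simp
    ultimately have "card (e \<union> f \<union> g) \<le> 7"
      using card_Un_Int[of "e \<union> f" g] fin(3) E3[OF efg(3)] 1 by linarith
    then obtain v where "\<forall>e'\<in>E. e' \<subseteq> e \<union> f \<union> g \<longrightarrow> v \<in> e'" using common[of "e \<union> f \<union> g"] efg by auto
    then have "v \<in> e" "v \<in> f" "v \<in> g" using efg by auto
    then show ?thesis by auto
  qed
  \<comment> \<open>Otherwise take edges \<open>f\<close>, \<open>g\<close>, \<open>h\<close> that
    miss the three vertices of \<open>e\<close> in turn. By \<open>three\<close> each contains the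
    other two vertices of \<open>e\<close>, so the four edges span at most six vertices and share a
    vertex after all.\<close>
  have "\<exists>v. \<forall>e\<in>E. e \<subseteq> R \<longrightarrow> v \<in> e"
  proof (rule ccontr)
    assume no: "\<not> ?thesis"
    then obtain e where e: "e \<in> E" "e \<subseteq> R" by auto
    obtain a b c where abc: "e = {a,b,c}" "a \<noteq> b" "a \<noteq> c" "b \<noteq> c" using card_3_obtain[OF E3[OF e(1)]] .
    obtain f where f: "f \<in> E" "f \<subseteq> R" "a \<notin> f" using no by auto
    obtain g where g: "g \<in> E" "g \<subseteq> R" "b \<notin> g" using no by auto
    obtain h where h: "h \<in> E" "h \<subseteq> R" "c \<notin> h" using no by auto
    have 1: "c \<in> f" "c \<in> g" using three[of e f g] e f g abc by auto
    have 2: "b \<in> f" "b \<in> h" using three[of e f h] e f h abc by auto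
    have 3: "a \<in> g" "a \<in> h" using three[of e g h] e g h abc by auto
    have "card (f - {b,c}) = 1" "card (g - {a,c}) = 1" "card (h - {a,b}) = 1"
      using E3 f g h 1 2 3 abc by (subst card_Diff_subset; simp)+
    then obtain x y z where "f - {b,c} = {x}" "g - {a,c} = {y}" "h - {a,b} = {z}"
      by (auto simp: card_1_singleton_iff)
    then have sub: "e \<union> f \<union> g \<union> h \<subseteq> {a,b,c,x,y,z}" using abc by auto
    have "card (e \<union> f \<union> g \<union> h) \<le> card {a,b,c,x,y,z}" by (rule card_mono[OF _ sub]) auto
    also have "\<dots> \<le> 6" by (simp add: card_insert_if)
    finally have "card (e \<union> f \<union> g \<union> h) \<le> 7" by simp
    then obtain v where v: "\<forall>e'\<in>E. e' \<subseteq> e \<union> f \<union> g \<union> h \<longrightarrow> v \<in> e'"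
      using common[of "e \<union> f \<union> g \<union> h"] e f g h by auto
    have "v \<in> e" "v \<in> f" "v \<in> g" "v \<in> h" using v e f g h by auto
    then show False using abc f g h by auto
  qed
  then obtain v where v: "\<And>e. e \<in> E \<Longrightarrow> e \<subseteq> R \<Longrightarrow> v \<in> e" by auto
  have "card (e \<inter> {v}) = 1" if "e \<in> E" "e \<subseteq> R" for e
    using v[OF that] by simp
  then show ?thesis unfolding semibip_on_def by blast
qed

text \<open>Representatives of distinct twin classes are pairwise covered, and exchanging vertices
  for twins one at a time shows that \<open>rep\<close> maps edges to edges, so a structure on
  \<open>R\<close> pulls back to \<open>V\<close>. Up to four representatives fit into
  \<open>{1,2,4,5}\<close>, all of whose triples are edges of \<open>G26\<close>.\<close>

lemma symmetrized_tame:
  assumes tg: "three_graph (V, E)" and g: "good E" and sym: "symmetrized V E"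
  shows "tame E V"
proof -
  note tgD = three_graphD[OF tg]
  define rep where "rep v = (SOME u. u \<in> V \<and> twin E u v)" for v
  have rep: "rep v \<in> V" "twin E (rep v) v" if "v \<in> V" for v
    unfolding rep_def using someI[of "\<lambda>u. u \<in> V \<and> twin E u v" v] that by (auto simp: twin_def)
  have rep_eq: "rep u = rep v" if "twin E u v" for u v
    using that by (simp add: rep_def twin_def)
  define R where "R = rep ` V"
  have RV: "R \<subseteq> V" using rep by (auto simp: R_def)
  have finR: "finite R" using tgD(1) by (simp add: R_def)
  have cl: "clique E R"
    unfolding clique_def
  proof (intro ballI impI)
    fix x y assume xy: "x \<in> R" "y \<in> R" "x \<noteq> y"
    then obtain u v where uv: "u \<in> V" "v \<in> V" "x = rep u" "y = rep v" by (auto simp: R_def)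
    have "\<not> twin E x y"
    proof
      assume "twin E x y"
      then have "twin E u v" using rep(2) uv by (simp add: twin_def)
      then show False using rep_eq uv xy by auto
    qed
    then show "covered E x y" using sym xy RV by (auto simp: symmetrized_def)
  qed
  have rep_edge: "rep ` e \<in> E" if e: "e \<in> E" for e
  proof -
    obtain a b c where abc: "e = {a,b,c}" "a \<noteq> b" "a \<noteq> c" "b \<noteq> c" using card_3_obtain[OF tgD(3)[OF e]] .
    have V: "a \<in> V" "b \<in> V" "c \<in> V" using tgD(2)[OF e] abc by auto
    have tw: "twin E a (rep a)" "twin E b (rep b)" "twin E c (rep c)" using rep(2) V by (auto simp: twin_def)
    have "insert (rep a) ({a,b,c} - {a}) \<in> E" using twin_swap[OF tw(1)] e abc by blast
    then have 1: "{rep a,b,c} \<in> E" using abc by (simp add: insert_Diff_if)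
    \<comment> \<open>An edge has three distinct elements, so the new representative cannot coincide
      with a vertex still to be exchanged.\<close>
    then have d1: "rep a \<noteq> b" "rep a \<noteq> c" using tgD(3)[OF 1] by (auto simp: card_3_distinct)
    have "insert (rep b) ({rep a,b,c} - {b}) \<in> E" using twin_swap[OF tw(2) 1] by blast
    then have 2: "{rep b,rep a,c} \<in> E" using abc d1 by (simp add: insert_Diff_if)
    then have d2: "rep b \<noteq> c" using tgD(3)[OF 2] by (auto simp: card_3_distinct)
    have "insert (rep c) ({rep b,rep a,c} - {c}) \<in> E" using twin_swap[OF tw(3) 2] by blast
    then have "{rep c,rep b,rep a} \<in> E" using abc d1 d2 by (simp add: insert_Diff_if)
    moreover have "rep ` e = {rep c,rep b,rep a}" using abc by auto
    ultimately show ?thesis by simp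
  qed
  have "tame E R"
  proof -
    have gs: "K5m_free E" "\<And>S. card S = 7 \<Longrightarrow> clique E S \<Longrightarrow> star_on E S"
      "\<And>S. card S = 6 \<Longrightarrow> clique E S \<Longrightarrow> semibip_on E S \<or> G26_inj E S"
      using g unfolding good_def by auto
    consider "card R \<le> 4" | "card R = 5" | "card R = 6" | "card R \<ge> 7" by linarith
    then show ?thesis
    proof cases
      case 1
      then obtain c where c: "c ` R \<subseteq> {1,2,4,5::nat}" "inj_on c R"
        using card_le_inj[of R "{1,2,4,5::nat}"] finR by auto
      have "c ` e \<in> snd G26" if e: "e \<in> E" "e \<subseteq> R" for e
      proof (rule G26I)
        have s: "c ` e \<subseteq> {1,2,4,5}" using c(1) e(2) by blast
        then show "c ` e \<subseteq> {1..6}" by auto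
        show "card (c ` e) = 3" using tgD(3)[OF e(1)] inj_on_subset[OF c(2) e(2)] by (simp add: card_image)
        have "3 \<notin> c ` e" "6 \<notin> c ` e" using s by auto
        then show "c ` e \<noteq> {1,2,3}" "c ` e \<noteq> {1,2,6}" "c ` e \<noteq> {3,4,5}" "c ` e \<noteq> {4,5,6}" by auto
      qed
      moreover have "c ` R \<subseteq> {1..6}" using c(1) by auto
      ultimately show ?thesis unfolding tame_def G26_on_def by metis
    next
      case 2
      then show ?thesis unfolding tame_def using five_clique_G26[OF gs(1)] tgD(3) by blast
    next
      case 3
      then show ?thesis using gs(3)[OF 3 cl] unfolding tame_def G26_inj_def G26_on_def by metis
    next
      case 4
      then show ?thesis unfolding tame_def using large_clique_star[OF gs(2) cl finR _ tgD(3)] by blast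
    qed
  qed
  moreover have "rep ` e \<subseteq> R" if "e \<in> E" for e using tgD(2)[OF that] by (auto simp: R_def)
  moreover have "card (e \<inter> {v. rep v \<in> A}) = card (rep ` e \<inter> A)" if "e \<in> E" for e A
  proof -
    have "inj_on rep e"
      by (rule eq_card_imp_inj_on) (use tgD(3,4) rep_edge that in auto)
    then have "inj_on rep (e \<inter> {v. rep v \<in> A})" by (meson inf_le1 inj_on_subset)
    moreover have "rep ` (e \<inter> {v. rep v \<in> A}) = rep ` e \<inter> A" by auto
    ultimately show ?thesis by (metis card_image)
  qed
  ultimately consider A where "\<And>e. e \<in> E \<Longrightarrow> card (e \<inter> {v. rep v \<in> A}) = 1"
    | c where "c ` R \<subseteq> {1..6}" "\<And>e. e \<in> E \<Longrightarrow> c ` rep ` e \<in> snd G26"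
    using rep_edge unfolding tame_def semibip_on_def G26_on_def by metis
  then show ?thesis
  proof cases
    case 1
    then show ?thesis unfolding tame_def semibip_on_def by blast
  next
    case 2
    have "(c \<circ> rep) ` V \<subseteq> {1..6}" using 2(1) by (auto simp: R_def)
    moreover have "\<forall>e\<in>E. (c \<circ> rep) ` e \<in> snd G26" using 2(2) by (simp add: image_comp)
    ultimately show ?thesis unfolding tame_def G26_on_def by metis
  qed
qed

section \<open>Zykov symmetrization\<close>

definition clone :: "'a set set \<Rightarrow> 'a \<Rightarrow> 'a \<Rightarrow> 'a set set" where
  "clone E u v = {e\<in>E. v \<notin> e} \<union> insert v ` link E u"

lemma link_uncovered:
  assumes "\<not> covered E u v" "f \<in> link E u"
  shows "u \<notin> f" "v \<notin> f" "insert u f \<in> E"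
  using assms by (auto simp: link_def covered_def)

lemma clone_cases:
  assumes "\<not> covered E u v" "e \<in> clone E u v"
  obtains "e \<in> E" "v \<notin> e" | f where "e = insert v f" "f \<in> link E u" "u \<notin> f" "v \<notin> f" "insert u f \<in> E"
  using assms(2) link_uncovered[OF assms(1)] unfolding clone_def by blast

lemma clone_away: "v \<notin> e \<Longrightarrow> e \<in> clone E u v \<longleftrightarrow> e \<in> E"
  by (auto simp: clone_def)

lemma clone_three_graph:
  assumes tg: "three_graph (V, E)" and V: "v \<in> V" and nc: "\<not> covered E u v"
  shows "three_graph (V, clone E u v)"
  unfolding three_graph_def
proof (intro conjI ballI)
  note tgD = three_graphD[OF tg]
  show "finite (fst (V, clone E u v))" using tgD(1) by simp
  fix e assume "e \<in> snd (V, clone E u v)"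
  then have e: "e \<in> clone E u v" by simp
  from nc e show "e \<subseteq> fst (V, clone E u v)"
    by (cases rule: clone_cases) (use tgD(2) V in auto)
  from nc e show "card e = 3"
  proof (cases rule: clone_cases)
    case (2 f)
    have "finite f" using tgD(4)[OF 2(5)] by simp
    then show ?thesis using 2 tgD(3)[OF 2(5)] by simp
  qed (use tgD in auto)
qed

text \<open>The map \<open>r\<close> that sends \<open>v\<close> to \<open>u\<close> takes edges of
  the clone to edges of \<open>E\<close>. Since \<open>u\<close> and \<open>v\<close> stay uncovered
  in the clone, \<open>r\<close> is injective on cliques. All three properties concern cliques, the
  vertices of \<open>K5minus\<close> included, and so they pull back along \<open>r\<close>.\<close>

lemma clone_good:
  assumes tg: "three_graph (V, E)" and g: "good E" and nc: "\<not> covered E u v" and uv: "u \<noteq> v"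
  shows "good (clone E u v)"
proof -
  let ?C = "clone E u v"
  define r where "r x = (if x = v then u else x)" for x
  have rE: "r ` e \<in> E" if "e \<in> ?C" for e
    using nc that
  proof (cases rule: clone_cases)
    case 1
    then have "r ` e = e" by (auto simp: r_def)
    then show ?thesis using 1 by simp
  next
    case (2 f)
    then have "r ` f = f" by (force simp: r_def)
    then have "r ` e = insert u f" using 2 by (simp add: r_def)
    then show ?thesis using 2 by simp
  qed
  have nuv: "\<not> covered ?C u v"
  proof
    assume "covered ?C u v"
    then obtain e where e: "e \<in> ?C" "u \<in> e" "v \<in> e" by (auto simp: covered_def)
    from nc e(1) show False by (cases rule: clone_cases) (use e uv in auto)
  qed
  have inj: "inj_on r S" if "clique ?C S" for S
  proof (rule inj_onI, rule ccontr)
    fix x y assume xy: "x \<in> S" "y \<in> S" "r x = r y" "x \<noteq> y"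
    then have "x = u \<and> y = v \<or> x = v \<and> y = u" by (auto simp: r_def split: if_splits)
    then show False using xy that nuv covered_sym[of ?C] by (auto simp: clique_def)
  qed
  have cl: "clique E (r ` S)" if cS: "clique ?C S" for S
    unfolding clique_def
  proof (intro ballI impI)
    fix x y assume "x \<in> r ` S" "y \<in> r ` S" "x \<noteq> y"
    then obtain x' y' where xy: "x' \<in> S" "y' \<in> S" "x = r x'" "y = r y'" "x' \<noteq> y'" by auto
    then obtain e where "e \<in> ?C" "x' \<in> e" "y' \<in> e" using cS unfolding clique_def covered_def by metis
    then have "r ` e \<in> E" "x \<in> r ` e" "y \<in> r ` e" using rE xy by auto
    then show "covered E x y" by (rule coveredI)
  qed
  have gs: "K5m_free E" "\<And>S. card S = 7 \<Longrightarrow> clique E S \<Longrightarrow> star_on E S"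
      "\<And>S. card S = 6 \<Longrightarrow> clique E S \<Longrightarrow> semibip_on E S \<or> G26_inj E S"
      using g unfolding good_def by auto
  show ?thesis unfolding good_def
  proof (intro conjI allI impI)
    show "K5m_free ?C" unfolding K5m_free_def
    proof (intro allI impI notI)
      fix a b c d e assume dist: "distinct [a,b,c,d,e]"
        and sub: "{{a,b,d},{a,b,e},{a,c,d},{a,c,e},{a,d,e},{b,c,d},{b,c,e},{b,d,e},{c,d,e}} \<subseteq> ?C"
      have "clique {{a,b,d},{a,b,e},{a,c,d},{a,c,e},{a,d,e},{b,c,d},{b,c,e},{b,d,e},{c,d,e}} {a,b,c,d,e}"
        by (simp add: clique_def covered_def)
      then have "clique ?C {a,b,c,d,e}" using sub by (rule clique_mono)
      then have "inj_on r {a,b,c,d,e}" by (rule inj)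
      then have "distinct [r a, r b, r c, r d, r e]" using dist by (auto simp: inj_on_def)
      moreover have "r ` {x,y,z} = {r x, r y, r z}" for x y z by simp
      then have "{{r a,r b,r d},{r a,r b,r e},{r a,r c,r d},{r a,r c,r e},{r a,r d,r e},{r b,r c,r d},{r b,r c,r e},{r b,r d,r e},{r c,r d,r e}} \<subseteq> E"
        using sub rE by (metis empty_subsetI insert_subset)
      ultimately show False using gs(1) unfolding K5m_free_def by metis
    qed
  next
    fix S assume S: "card S = 7" "clique ?C S"
    have "card (r ` S) = 7" using inj[OF S(2)] S(1) by (simp add: card_image)
    then have "star_on E (r ` S)" using gs(2) cl[OF S(2)] by auto
    then obtain w where w: "w \<in> S" "\<And>e. e \<in> E \<Longrightarrow> e \<subseteq> r ` S \<Longrightarrow> r w \<in> e" unfolding star_on_def by auto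
    have "w \<in> e" if "e \<in> ?C" "e \<subseteq> S" for e
      using w(2)[OF rE[OF that(1)] image_mono[OF that(2)]] inj_on_image_mem_iff[OF inj[OF S(2)] w(1) that(2)]
      by simp
    then show "star_on ?C S" unfolding star_on_def using w(1) by metis
  next
    fix S assume S: "card S = 6" "clique ?C S"
    have "card (r ` S) = 6" using inj[OF S(2)] S(1) by (simp add: card_image)
    then have "semibip_on E (r ` S) \<or> G26_inj E (r ` S)" using gs(3) cl[OF S(2)] by auto
    then show "semibip_on ?C S \<or> G26_inj ?C S"
    proof
      assume "semibip_on E (r ` S)"
      then obtain A where A: "\<And>e. e \<in> E \<Longrightarrow> e \<subseteq> r ` S \<Longrightarrow> card (e \<inter> A) = 1"
        unfolding semibip_on_def by metis
      have "card (e \<inter> {x. r x \<in> A}) = 1" if "e \<in> ?C" "e \<subseteq> S" for e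
      proof -
        have "inj_on r (e \<inter> {x. r x \<in> A})" using inj[OF S(2)] that by (meson inf.coboundedI1 inj_on_subset)
        moreover have "r ` (e \<inter> {x. r x \<in> A}) = r ` e \<inter> A" by auto
        ultimately show ?thesis using A[OF rE[OF that(1)] image_mono[OF that(2)]] by (metis card_image)
      qed
      then show ?thesis unfolding semibip_on_def by metis
    next
      assume "G26_inj E (r ` S)"
      then obtain c where c: "inj_on c (r ` S)" "c ` r ` S \<subseteq> {1..6}"
        "\<And>e. e \<in> E \<Longrightarrow> e \<subseteq> r ` S \<Longrightarrow> c ` e \<in> snd G26"
        unfolding G26_inj_def by metis
      have "inj_on (c \<circ> r) S" using inj[OF S(2)] c(1) by (rule comp_inj_on)
      moreover have "(c \<circ> r) ` S \<subseteq> {1..6}" using c(2) by (simp add: image_comp)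
      moreover have "(c \<circ> r) ` e \<in> snd G26" if "e \<in> ?C" "e \<subseteq> S" for e
        using c(3)[OF rE[OF that(1)] image_mono[OF that(2)]] by (simp add: image_comp)
      ultimately show ?thesis unfolding G26_inj_def by metis
    qed
  qed
qed

lemma card_link:
  shows "card (link E v) = card {e\<in>E. v \<in> e}"
proof (rule bij_betw_same_card)
  show "bij_betw (insert v) (link E v) {e\<in>E. v \<in> e}"
    unfolding bij_betw_def
  proof
    show "inj_on (insert v) (link E v)" by (rule inj_onI) (auto simp: link_def)
    show "insert v ` link E v = {e\<in>E. v \<in> e}"
    proof
      show "{e\<in>E. v \<in> e} \<subseteq> insert v ` link E v"
      proof
        fix e assume "e \<in> {e\<in>E. v \<in> e}"
        then show "e \<in> insert v ` link E v"
          by (intro image_eqI[of _ _ "e - {v}"]) (auto simp: link_def insert_absorb)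
      qed
    qed (auto simp: link_def)
  qed
qed

lemma card_clone:
  assumes tg: "three_graph (V, E)" and nc: "\<not> covered E u v"
  shows "card (clone E u v) + card (link E v) = card E + card (link E u)"
proof -
  have finE: "finite E" using three_graphD[OF tg] by simp
  have inj: "inj_on (insert v) (link E u)"
    by (rule inj_onI) (use link_uncovered(2)[OF nc] in \<open>metis insert_ident\<close>)
  have finl: "finite (insert v ` link E u)"
  proof (rule finite_imageI, rule finite_subset)
    show "link E u \<subseteq> (\<lambda>e. e - {u}) ` E"
    proof
      fix f assume "f \<in> link E u"
      then have "insert u f \<in> E" "f = insert u f - {u}" by (auto simp: link_def)
      then show "f \<in> (\<lambda>e. e - {u}) ` E" by (rule image_eqI[rotated])
    qed
  qed (use finE in simp)
  have "card (clone E u v) = card {e\<in>E. v \<notin> e} + card (insert v ` link E u)"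
    unfolding clone_def by (rule card_Un_disjoint) (use finE finl in auto)
  moreover have "card (insert v ` link E u) = card (link E u)" using inj by (rule card_image)
  moreover have "card E = card {e\<in>E. v \<notin> e} + card {e\<in>E. v \<in> e}"
    using finE by (subst card_Un_disjoint[symmetric]) (auto intro: arg_cong[where f=card])
  ultimately show ?thesis by (simp add: card_link)
qed

lemma link_clone:
  assumes nc: "\<not> covered E u v" and uv: "u \<noteq> v"
  shows "link (clone E u v) v = link E u" "link (clone E u v) u = link E u"
proof -
  show "link (clone E u v) v = link E u"
  proof
    show "link (clone E u v) v \<subseteq> link E u"
    proof
      fix f assume "f \<in> link (clone E u v) v"
      then have f: "v \<notin> f" "insert v f \<in> clone E u v" by (auto simp: link_def)
      from nc f(2) show "f \<in> link E u"
      proof (cases rule: clone_cases)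
        case (2 g)
        then have "f = g" using f(1) by (metis insert_ident)
        then show ?thesis using 2 by simp
      qed simp
    qed
    show "link E u \<subseteq> link (clone E u v) v"
    proof
      fix f assume f: "f \<in> link E u"
      then have "insert v f \<in> clone E u v" by (simp add: clone_def)
      then show "f \<in> link (clone E u v) v" using link_uncovered(2)[OF nc f] by (simp add: link_def)
    qed
  qed
  show "link (clone E u v) u = link E u"
  proof
    show "link (clone E u v) u \<subseteq> link E u"
    proof
      fix f assume "f \<in> link (clone E u v) u"
      then have f: "u \<notin> f" "insert u f \<in> clone E u v" by (auto simp: link_def)
      from nc f(2) show "f \<in> link E u"
      proof (cases rule: clone_cases)
        case 1
        then show ?thesis using f by (simp add: link_def)
      next
        case (2 g)
        then show ?thesis using uv by blast
      qed
    qed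
    show "link E u \<subseteq> link (clone E u v) u"
    proof
      fix f assume f: "f \<in> link E u"
      show "f \<in> link (clone E u v) u"
        using link_uncovered[OF nc f] uv by (simp add: link_def clone_away)
    qed
  qed
qed

text \<open>Only edges at \<open>v\<close> are new. Such an edge through \<open>a\<close> comes from
  an edge at \<open>u\<close>, where \<open>a\<close> is exchanged for \<open>b\<close> before the
  result is copied to \<open>v\<close> again.\<close>

lemma twin_clone:
  assumes nc: "\<not> covered E u v" and tw: "twin E a b" and v: "a \<noteq> v" "b \<noteq> v"
  shows "twin (clone E u v) a b"
proof -
  have sub: "link (clone E u v) a \<subseteq> link (clone E u v) b"
    if tw: "twin E a b" and v: "a \<noteq> v" "b \<noteq> v" for a b
  proof
    fix f assume "f \<in> link (clone E u v) a"
    then have f: "a \<notin> f" "insert a f \<in> clone E u v" by (auto simp: link_def)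
    from nc f(2) show "f \<in> link (clone E u v) b"
    proof (cases rule: clone_cases)
      case 1
      then have "f \<in> link E a" using f by (simp add: link_def)
      then have "f \<in> link E b" using tw by (simp add: twin_def)
      then show ?thesis using 1 v by (simp add: link_def clone_away)
    next
      case (2 g)
      define h where "h = f - {v}"
      have "v \<in> insert a f" unfolding 2(1) by simp
      then have vf: "v \<in> f" using v by simp
      have "g = insert v g - {v}" using 2(4) by simp
      also have "\<dots> = insert a h" unfolding 2(1)[symmetric] h_def using v by auto
      finally have g: "g = insert a h" .
      have "a \<noteq> u" using 2(3) unfolding g by auto
      then have "insert u h \<in> link E a"
        using f(1) 2 by (auto simp: link_def h_def g insert_commute)
      then have "insert u h \<in> link E b" using tw by (simp add: twin_def)
      then have b: "b \<noteq> u" "b \<notin> h" "insert b (insert u h) \<in> E" by (auto simp: link_def)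
      have "u \<notin> insert b h" using 2(3) b(1) unfolding g by simp
      then have "insert b h \<in> link E u" using b(3) by (simp add: link_def insert_commute)
      then have "insert v (insert b h) \<in> clone E u v" by (simp add: clone_def)
      moreover have "insert v (insert b h) = insert b f" using vf by (auto simp: h_def)
      moreover have "b \<notin> f" using b v by (auto simp: h_def)
      ultimately show ?thesis by (simp add: link_def)
    qed
  qed
  show ?thesis unfolding twin_def
    using sub[OF tw v] sub[of b a] tw v by (auto simp: twin_def)
qed

section \<open>Twin pairs and the potential that grows under symmetrization\<close>

definition twins :: "'a set \<Rightarrow> 'a set set \<Rightarrow> ('a \<times> 'a) set" where
  "twins V E = {(a, b). a \<in> V \<and> b \<in> V \<and> twin E a b}"

lemma card_twins_split:
  assumes "finite V" "v \<in> V"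
  shows "card (twins V E) = card (twins (V - {v}) E) + 2 * card {b \<in> V - {v}. twin E v b} + 1"
proof -
  let ?K = "{b \<in> V - {v}. twin E v b}"
  have eq: "twins V E = twins (V - {v}) E \<union> (Pair v ` ?K \<union> ((\<lambda>b. (b, v)) ` ?K \<union> {(v, v)}))"
    using assms(2) by (auto simp: twins_def twin_def)
  have fin: "finite (twins (V - {v}) E)"
    by (rule finite_subset[of _ "V \<times> V"]) (use assms in \<open>auto simp: twins_def\<close>)
  have finK: "finite ?K" using assms by simp
  have "card (twins V E) = card (twins (V - {v}) E) + card (Pair v ` ?K \<union> ((\<lambda>b. (b, v)) ` ?K \<union> {(v, v)}))"
    unfolding eq by (rule card_Un_disjoint) (use fin finK in \<open>auto simp: twins_def\<close>)
  also have "card (Pair v ` ?K \<union> ((\<lambda>b. (b, v)) ` ?K \<union> {(v, v)})) = card (Pair v ` ?K) + card ((\<lambda>b. (b, v)) ` ?K \<union> {(v, v)})"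
    by (rule card_Un_disjoint) (use finK in auto)
  also have "card ((\<lambda>b. (b, v)) ` ?K \<union> {(v, v)}) = card ((\<lambda>b. (b, v)) ` ?K) + card {(v, v)}"
    by (rule card_Un_disjoint) (use finK in auto)
  also have "card (Pair v ` ?K) = card ?K" by (rule card_image) (auto simp: inj_on_def)
  also have "card ((\<lambda>b. (b, v)) ` ?K) = card ?K" by (rule card_image) (auto simp: inj_on_def)
  finally show ?thesis by simp
qed

text \<open>Lexicographic order of edge number and number of ordered twin pairs, packed into one
  natural: the second is at most \<open>card V ^ 2\<close>, so a single edge outweighs it.\<close>

definition potential :: "'a set \<Rightarrow> 'a set set \<Rightarrow> nat" where
  "potential V E = card E * (card V ^ 2 + 1) + card (twins V E)"

lemma card_twins_le: "finite V \<Longrightarrow> card (twins V E) \<le> card V ^ 2"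
proof -
  assume f: "finite V"
  have "card (twins V E) \<le> card (V \<times> V)"
    by (rule card_mono) (use f in \<open>auto simp: twins_def\<close>)
  then show ?thesis by (simp add: power2_eq_square card_cartesian_product)
qed

text \<open>If \<open>u\<close> has the larger degree, edges are gained. On a tie, \<open>v\<close>
  leaves its own twin class and joins that of \<open>u\<close>, which is at least as large before
  \<open>v\<close> arrives; twin pairs among the other vertices survive, so the number of twin pairs
  grows.\<close>

lemma clone_potential:
  assumes tg: "three_graph (V, E)" and nc: "\<not> covered E u v" and nt: "\<not> twin E u v"
    and V: "u \<in> V" "v \<in> V"
    and le: "card (link E v) < card (link E u) \<or> card (link E v) = card (link E u) \<and>
      card {b\<in>V. twin E v b} \<le> card {b\<in>V. twin E u b}"
  shows "potential V E < potential V (clone E u v)" "card E \<le> card (clone E u v)"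
proof -
  have fin: "finite V" using three_graphD[OF tg] by simp
  have uv: "u \<noteq> v" using nt by (auto simp: twin_def)
  note cc = card_clone[OF tg nc]
  show "card E \<le> card (clone E u v)" using cc le by linarith
  show "potential V E < potential V (clone E u v)"
    using le
  proof
    assume "card (link E v) < card (link E u)"
    then have "card E + 1 \<le> card (clone E u v)" using cc by linarith
    then have "(card E + 1) * (card V ^ 2 + 1) \<le> card (clone E u v) * (card V ^ 2 + 1)"
      by (rule mult_le_mono1)
    then show ?thesis unfolding potential_def using card_twins_le[OF fin, of E] by (simp add: algebra_simps)
  next
    let ?C = "clone E u v"
    assume eq: "card (link E v) = card (link E u) \<and> card {b\<in>V. twin E v b} \<le> card {b\<in>V. twin E u b}"
    then have "card E = card ?C" using cc by linarith
    moreover have "card (twins (V - {v}) E) \<le> card (twins (V - {v}) ?C)"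
    proof (rule card_mono)
      show "finite (twins (V - {v}) ?C)"
        by (rule finite_subset[of _ "V \<times> V"]) (use fin in \<open>auto simp: twins_def\<close>)
      show "twins (V - {v}) E \<subseteq> twins (V - {v}) ?C" using twin_clone[OF nc] by (auto simp: twins_def)
    qed
    moreover have "card {b \<in> V - {v}. twin E v b} < card {b \<in> V - {v}. twin ?C v b}"
    proof -
      have "{b\<in>V. twin E v b} = insert v {b \<in> V - {v}. twin E v b}" using V by (auto simp: twin_def)
      then have "card {b\<in>V. twin E v b} = card {b \<in> V - {v}. twin E v b} + 1" using fin by simp
      moreover have "card {b\<in>V. twin E u b} \<le> card {b \<in> V - {v}. twin ?C v b}"
      proof (rule card_mono)
        show "{b\<in>V. twin E u b} \<subseteq> {b \<in> V - {v}. twin ?C v b}"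
        proof
          fix b assume b: "b \<in> {b\<in>V. twin E u b}"
          then have bv: "b \<noteq> v" using nt by auto
          then have "twin ?C u b" using twin_clone[OF nc _ uv bv] b by auto
          then show "b \<in> {b \<in> V - {v}. twin ?C v b}"
            using b bv link_clone[OF nc uv] by (simp add: twin_def)
        qed
      qed (use fin in auto)
      ultimately show ?thesis using eq by linarith
    qed
    ultimately have "card (twins V E) < card (twins V ?C)"
      using card_twins_split[OF fin V(2), of E] card_twins_split[OF fin V(2), of ?C] by linarith
    then show ?thesis unfolding potential_def using \<open>card E = card ?C\<close> by simp
  qed
qed

lemma symmetrize_step:
  assumes tg: "three_graph (V, E)" and g: "good E" and ns: "\<not> symmetrized V E"
  obtains v E' where "v \<in> V" "three_graph (V, E')" "good E'" "card E \<le> card E'"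
    "potential V E < potential V E'" "\<forall>e. v \<notin> e \<longrightarrow> (e \<in> E' \<longleftrightarrow> e \<in> E)"
proof -
  obtain u v where uv: "u \<in> V" "v \<in> V" "\<not> covered E u v" "\<not> twin E u v"
    using ns by (auto simp: symmetrized_def)
  have vu: "\<not> covered E v u" "\<not> twin E v u" using uv covered_sym[of E] by (auto simp: twin_def)
  have neq: "u \<noteq> v" using uv by (auto simp: twin_def)
  have "card (link E v) < card (link E u) \<or> card (link E v) = card (link E u) \<and>
      card {b\<in>V. twin E v b} \<le> card {b\<in>V. twin E u b} \<or>
     card (link E u) < card (link E v) \<or> card (link E u) = card (link E v) \<and>
      card {b\<in>V. twin E u b} \<le> card {b\<in>V. twin E v b}" by linarith
  then consider "card (link E v) < card (link E u) \<or> card (link E v) = card (link E u) \<and>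
      card {b\<in>V. twin E v b} \<le> card {b\<in>V. twin E u b}"
    | "card (link E u) < card (link E v) \<or> card (link E u) = card (link E v) \<and>
      card {b\<in>V. twin E u b} \<le> card {b\<in>V. twin E v b}" by blast
  then show ?thesis
  proof cases
    case 1
    show ?thesis
      by (rule that[of v "clone E u v"])
        (use uv(2) clone_three_graph[OF tg uv(2,3)] clone_good[OF tg g uv(3) neq]
          clone_potential[OF tg uv(3,4,1,2) 1] in \<open>auto simp: clone_away\<close>)
  next
    case 2
    show ?thesis
      by (rule that[of u "clone E v u"])
        (use uv(1) clone_three_graph[OF tg uv(1) vu(1)] clone_good[OF tg g vu(1) neq[symmetric]]
          clone_potential[OF tg vu uv(2,1) 2] in \<open>auto simp: clone_away\<close>)
  qed
qed

lemma potential_le: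
  assumes "three_graph (V, E)"
  shows "potential V E \<le> 2 ^ card V * (card V ^ 2 + 1) + card V ^ 2"
proof -
  note tgD = three_graphD[OF assms]
  have "card E \<le> card (Pow V)" by (rule card_mono) (use tgD in auto)
  then have "card E \<le> 2 ^ card V" using tgD(1) by (simp add: card_Pow)
  then have "card E * (card V ^ 2 + 1) \<le> 2 ^ card V * (card V ^ 2 + 1)" by (rule mult_le_mono1)
  then show ?thesis unfolding potential_def using card_twins_le[OF tgD(1), of E] by linarith
qed

text \<open>The induction runs against the symmetrization: \<open>P\<close> holds at the symmetrized
  end and is carried from \<open>E'\<close> back to \<open>E\<close>. The step forgets cloning and
  keeps what the transfer uses: edge numbers do not drop, and only edges through \<open>v\<close>
  change.\<close>

lemma symmetrize_induct [consumes 2, case_names symmetrized step]: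
  assumes tg: "three_graph (V, E)" and g: "good E"
    and base: "\<And>E. three_graph (V, E) \<Longrightarrow> good E \<Longrightarrow> symmetrized V E \<Longrightarrow> P E"
    and step: "\<And>E v E'. three_graph (V, E) \<Longrightarrow> good E \<Longrightarrow> v \<in> V \<Longrightarrow> three_graph (V, E') \<Longrightarrow> good E' \<Longrightarrow>
      card E \<le> card E' \<Longrightarrow> (\<And>e. v \<notin> e \<Longrightarrow> e \<in> E' \<longleftrightarrow> e \<in> E) \<Longrightarrow> P E' \<Longrightarrow> P E"
  shows "P E"
  using tg g
proof (induction "2 ^ card V * (card V ^ 2 + 1) + card V ^ 2 - potential V E" arbitrary: E rule: less_induct)
  case less
  show ?case
  proof (cases "symmetrized V E")
    case True
    then show ?thesis using base less.prems by blast
  next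
    case False
    obtain v E' where E': "v \<in> V" "three_graph (V, E')" "good E'" "card E \<le> card E'"
      "potential V E < potential V E'" "\<forall>e. v \<notin> e \<longrightarrow> (e \<in> E' \<longleftrightarrow> e \<in> E)"
      using symmetrize_step[OF less.prems False] .
    have "P E'"
      by (rule less.hyps) (use E' potential_le[OF E'(2)] in auto)
    then show ?thesis using step[OF less.prems E'(1-4)] E'(6) by blast
  qed
qed

section \<open>Edge counts\<close>

definition okc :: "nat \<Rightarrow> nat \<Rightarrow> nat \<Rightarrow> bool" where
  "okc i j k \<longleftrightarrow> {i,j,k} \<in> snd G26"

lemma triple_eq_iff:
  assumes "i \<noteq> j" "i \<noteq> k" "j \<noteq> k"
  shows "{i,j,k} = {a,b,c} \<longleftrightarrow> i \<in> {a,b,c} \<and> j \<in> {a,b,c} \<and> k \<in> {a,b,c}"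
proof
  assume sub: "i \<in> {a,b,c} \<and> j \<in> {a,b,c} \<and> k \<in> {a,b,c}"
  show "{i,j,k} = {a,b,c}"
  proof (rule card_seteq)
    have "card {a,b,c} \<le> 3" by (simp add: card_insert_if)
    then show "card {a,b,c} \<le> card {i,j,k}" using assms by simp
  qed (use sub in auto)
qed auto

lemma set16: "{1..6} = {1,2,3,4,5,6::nat}" by auto

text \<open>Equalities of triples become membership tests, which \<open>simp\<close> decides for
  concrete colours.\<close>

lemma okc_iff:
  "okc i j k \<longleftrightarrow> i \<in> {1,2,3,4,5,6} \<and> j \<in> {1,2,3,4,5,6} \<and> k \<in> {1,2,3,4,5,6} \<and> i \<noteq> j \<and> i \<noteq> k \<and> j \<noteq> k \<and>
    \<not> (i \<in> {1,2,3} \<and> j \<in> {1,2,3} \<and> k \<in> {1,2,3}) \<and> \<not> (i \<in> {1,2,6} \<and> j \<in> {1,2,6} \<and> k \<in> {1,2,6}) \<and>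
    \<not> (i \<in> {3,4,5} \<and> j \<in> {3,4,5} \<and> k \<in> {3,4,5}) \<and> \<not> (i \<in> {4,5,6} \<and> j \<in> {4,5,6} \<and> k \<in> {4,5,6})"
proof (cases "i \<noteq> j \<and> i \<noteq> k \<and> j \<noteq> k")
  case True
  have "okc i j k \<longleftrightarrow> ({i,j,k} \<subseteq> {1..6} \<and> card {i,j,k} = 3) \<and> {i,j,k} \<notin> {{1,2,3},{1,2,6},{3,4,5},{4,5,6}}"
    unfolding okc_def G26_def by (simp only: snd_conv Diff_iff mem_Collect_eq)
  also have "{i,j,k} \<notin> {{1,2,3},{1,2,6},{3,4,5},{4,5,6}} \<longleftrightarrow>
      {i,j,k} \<noteq> {1,2,3} \<and> {i,j,k} \<noteq> {1,2,6} \<and> {i,j,k} \<noteq> {3,4,5} \<and> {i,j,k} \<noteq> {4,5,6}"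
    by blast
  also have "{i,j,k} \<subseteq> {1..6} \<longleftrightarrow> i \<in> {1,2,3,4,5,6} \<and> j \<in> {1,2,3,4,5,6} \<and> k \<in> {1,2,3,4,5,6}"
    unfolding set16 by (simp only: insert_subset empty_subsetI simp_thms)
  also have "card {i,j,k} = 3 \<longleftrightarrow> True" using True card_3_distinct[of i j k] by simp
  finally have *: "okc i j k \<longleftrightarrow> ((i \<in> {1,2,3,4,5,6} \<and> j \<in> {1,2,3,4,5,6} \<and> k \<in> {1,2,3,4,5,6}) \<and> True) \<and>
      {i,j,k} \<noteq> {1,2,3} \<and> {i,j,k} \<noteq> {1,2,6} \<and> {i,j,k} \<noteq> {3,4,5} \<and> {i,j,k} \<noteq> {4,5,6}" .
  have d: "i \<noteq> j" "i \<noteq> k" "j \<noteq> k" using True by auto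
  show ?thesis
    unfolding * triple_eq_iff[OF d] by (simp only: d simp_thms conj_assoc not_False_eq_True)
next
  case False
  then have "card {i,j,k} \<noteq> 3" by (simp add: card_3_distinct)
  then have "\<not> okc i j k" using snd_G26[of "{i,j,k}"] unfolding okc_def by blast
  then show ?thesis using False by metis
qed

lemma okc_sym: "okc i j k \<Longrightarrow> okc j i k" "okc i j k \<Longrightarrow> okc i k j"
  by (simp_all add: okc_def insert_commute)

section \<open>Counting edges through ordered pairs in links\<close>

lemma two_degree_le:
  assumes tg: "three_graph (V, E)"
  shows "2 * card {e\<in>E. w \<in> e} \<le> card {(u, v) \<in> V \<times> V. {w,u,v} \<in> E}"
proof -
  note tgD = three_graphD[OF tg]
  define P where "P e = {(u, v) \<in> V \<times> V. {w,u,v} = e}" for e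
  have "2 * card {e\<in>E. w \<in> e} = (\<Sum>e\<in>{e\<in>E. w \<in> e}. 2)" by simp
  also have "\<dots> \<le> (\<Sum>e\<in>{e\<in>E. w \<in> e}. card (P e))"
  proof (rule sum_mono)
    fix e assume "e \<in> {e\<in>E. w \<in> e}"
    then have e: "e \<in> E" "w \<in> e" by auto
    then have "card (e - {w}) = 2" using tgD(3,4) by simp
    then obtain u v where uv: "e - {w} = {u,v}" "u \<noteq> v" by (auto simp: card_2_iff)
    then have ee: "e = {w,u,v}" using e(2) by auto
    then have "{(u,v),(v,u)} \<subseteq> P e" using tgD(2)[OF e(1)] by (auto simp: P_def)
    then have "card {(u,v),(v,u)} \<le> card (P e)"
      by (rule card_mono[rotated]) (use tgD(1) in \<open>auto simp: P_def intro: finite_subset[of _ "V \<times> V"]\<close>)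
    then show "2 \<le> card (P e)" using uv(2) by simp
  qed
  also have "\<dots> = card (\<Union>e\<in>{e\<in>E. w \<in> e}. P e)"
    by (rule card_UN_disjoint[symmetric])
      (use tgD in \<open>auto simp: P_def intro: finite_subset[of _ "V \<times> V"]\<close>)
  also have "(\<Union>e\<in>{e\<in>E. w \<in> e}. P e) = {(u, v) \<in> V \<times> V. {w,u,v} \<in> E}"
    by (auto simp: P_def)
  finally show ?thesis .
qed

lemma six_card_le:
  assumes tg: "three_graph (V, E)"
  shows "6 * card E \<le> (\<Sum>w\<in>V. card {(u, v) \<in> V \<times> V. {w,u,v} \<in> E})"
proof -
  note tgD = three_graphD[OF tg]
  have "(\<Sum>w\<in>V. card {e\<in>E. w \<in> e}) = 3 * card E"
  proof (rule sum_multicount)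
    show "\<forall>e\<in>E. card {w\<in>V. w \<in> e} = 3"
    proof
      fix e assume e: "e \<in> E"
      then have "{w\<in>V. w \<in> e} = e" using tgD(2) by auto
      then show "card {w\<in>V. w \<in> e} = 3" using tgD(3)[OF e] by simp
    qed
  qed (use tgD in auto)
  then have "6 * card E = (\<Sum>w\<in>V. 2 * card {e\<in>E. w \<in> e})" by (simp add: sum_distrib_left[symmetric])
  also have "\<dots> \<le> (\<Sum>w\<in>V. card {(u, v) \<in> V \<times> V. {w,u,v} \<in> E})"
    by (rule sum_mono) (rule two_degree_le[OF tg])
  finally show ?thesis .
qed

definition csize :: "'a set \<Rightarrow> ('a \<Rightarrow> nat) \<Rightarrow> nat \<Rightarrow> real" where
  "csize W c j = real (card {w\<in>W. c w = j})"

lemma csize_nonneg [simp]: "0 \<le> csize W c j"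
  by (simp add: csize_def)

lemma sum_by_colour:
  assumes "finite W" "finite K" "c ` W \<subseteq> K"
  shows "(\<Sum>w\<in>W. f (c w)) = (\<Sum>j\<in>K. csize W c j * f j)"
proof -
  have "(\<Sum>w\<in>W. f (c w)) = (\<Sum>j\<in>K. \<Sum>w\<in>{w\<in>W. c w = j}. f (c w))"
    by (rule sum.group[OF assms, symmetric])
  also have "\<dots> = (\<Sum>j\<in>K. csize W c j * f j)"
    by (rule sum.cong) (auto simp: csize_def)
  finally show ?thesis .
qed

lemma card_pairs_by_colour:
  assumes "finite W" "finite K" "c ` W \<subseteq> K"
  shows "real (card {(u, v) \<in> W \<times> W. Q (c u) (c v)}) =
    (\<Sum>j\<in>K. csize W c j * (\<Sum>k\<in>K. csize W c k * of_bool (Q j k)))"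
proof -
  have "{(u, v) \<in> W \<times> W. Q (c u) (c v)} = (SIGMA u:W. {v\<in>W. Q (c u) (c v)})" by auto
  then have "real (card {(u, v) \<in> W \<times> W. Q (c u) (c v)}) = (\<Sum>u\<in>W. real (card {v\<in>W. Q (c u) (c v)}))"
    using assms(1) by simp
  also have "\<dots> = (\<Sum>u\<in>W. \<Sum>v\<in>W. of_bool (Q (c u) (c v)))"
    using assms(1) by (intro sum.cong) (auto simp: of_bool_def sum.If_cases Int_def)
  also have "\<dots> = (\<Sum>u\<in>W. \<Sum>k\<in>K. csize W c k * of_bool (Q (c u) k))"
    by (intro sum.cong refl sum_by_colour[OF assms])
  also have "\<dots> = (\<Sum>j\<in>K. csize W c j * (\<Sum>k\<in>K. csize W c k * of_bool (Q j k)))"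
    by (rule sum_by_colour[OF assms])
  finally show ?thesis .
qed

lemma sum_csize:
  assumes "finite W" "finite K" "c ` W \<subseteq> K"
  shows "(\<Sum>j\<in>K. csize W c j) = real (card W)"
  using sum_by_colour[OF assms, of "\<lambda>_. 1"] by simp

text \<open>Twice the partial derivative in \<open>y i\<close> of the edge polynomial of
  \<open>G26\<close>; for part sizes \<open>y\<close> it counts ordered pairs in the link of a
  vertex of colour \<open>i\<close> in the complete blowup. By Euler's identity the sum of
  \<open>y i * g26_deg y i\<close> is six times that polynomial.\<close>

definition g26_deg :: "(nat \<Rightarrow> real) \<Rightarrow> nat \<Rightarrow> real" where
  "g26_deg y i = (\<Sum>j\<in>{1..6}. y j * (\<Sum>k\<in>{1..6}. y k * of_bool (okc i j k)))"

lemma g26_deg_eqs: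
  "g26_deg y 1 = 2 * (y 2 * (y 4 + y 5) + (y 3 + y 6) * (y 4 + y 5) + y 4 * y 5 + y 3 * y 6)"
  "g26_deg y 2 = 2 * (y 1 * (y 4 + y 5) + (y 3 + y 6) * (y 4 + y 5) + y 4 * y 5 + y 3 * y 6)"
  "g26_deg y 4 = 2 * (y 5 * (y 1 + y 2) + (y 3 + y 6) * (y 1 + y 2) + y 1 * y 2 + y 3 * y 6)"
  "g26_deg y 5 = 2 * (y 4 * (y 1 + y 2) + (y 3 + y 6) * (y 1 + y 2) + y 1 * y 2 + y 3 * y 6)"
  "g26_deg y 3 = 2 * ((y 1 + y 2) * (y 4 + y 5) + y 6 * (y 1 + y 2 + y 4 + y 5))"
  "g26_deg y 6 = 2 * ((y 1 + y 2) * (y 4 + y 5) + y 3 * (y 1 + y 2 + y 4 + y 5))"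
  unfolding g26_deg_def set16
  by (simp_all add: okc_iff algebra_simps del: sum_mult_of_bool_eq sum_of_bool_mult_eq)

text \<open>The deficit of the Lagrangian polynomial of \<open>\<G>\<^sup>2\<^sub>6\<close> from its maximum is a sum of nonnegative
  terms; \<open>P, Q, R\<close> are the total weights of the vertex pairs \<open>{1,2}, {4,5}, {3,6}\<close>.\<close>
lemma g26_poly_identity:
  fixes P Q R a b d :: real
  defines "s \<equiv> P + Q + R"
  shows "2 * s ^ 3 / 27 - ((P\<^sup>2 - a\<^sup>2) / 4 * Q + (Q\<^sup>2 - b\<^sup>2) / 4 * P + P * Q * R + (R\<^sup>2 - d\<^sup>2) / 4 * (P + Q)) =
    a\<^sup>2 / 4 * Q + b\<^sup>2 / 4 * P + d\<^sup>2 / 4 * (P + Q) + (P - Q)\<^sup>2 / 4 * (R + (P + Q) / 4)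
    + ((P + Q) / 2 - s / 3)\<^sup>2 * (4 * s / 3 - (P + Q) / 2) / 2"
  unfolding s_def by (simp add: field_simps power2_eq_square power3_eq_cube)

lemma g26_poly:
  fixes y :: "nat \<Rightarrow> real"
  defines "P \<equiv> y 1 + y 2" and "Q \<equiv> y 4 + y 5" and "R \<equiv> y 3 + y 6"
  defines "s \<equiv> P + Q + R"
  shows "2 * s ^ 3 / 27 - (\<Sum>i\<in>{1..6}. y i * g26_deg y i) / 6 =
    (y 1 - y 2)\<^sup>2 / 4 * Q + (y 4 - y 5)\<^sup>2 / 4 * P + (y 3 - y 6)\<^sup>2 / 4 * (P + Q) + (P - Q)\<^sup>2 / 4 * (R + (P + Q) / 4)
    + ((P + Q) / 2 - s / 3)\<^sup>2 * (4 * s / 3 - (P + Q) / 2) / 2"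
proof -
  have prod: "y i * y j = ((y i + y j)\<^sup>2 - (y i - y j)\<^sup>2) / 4" for i j
    by (simp add: power2_eq_square algebra_simps)
  have "(\<Sum>i\<in>{1..6}. y i * g26_deg y i) / 6 =
      y 1 * y 2 * Q + y 4 * y 5 * P + P * Q * R + y 3 * y 6 * (P + Q)"
    unfolding set16 by (simp add: g26_deg_eqs g26_deg_eqs[unfolded One_nat_def] P_def Q_def R_def algebra_simps)
  then show ?thesis
    unfolding s_def
    using g26_poly_identity[of P Q R "y 1 - y 2" "y 4 - y 5" "y 3 - y 6"]
    by (simp only: prod P_def Q_def R_def)
qed

lemma g26_deg_bound:
  assumes tg: "three_graph (V, E)" and W: "W \<subseteq> V" "w \<in> W"
    and c: "c ` W \<subseteq> {1..6}" "\<And>e. e \<in> E \<Longrightarrow> e \<subseteq> W \<Longrightarrow> c ` e \<in> snd G26"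
  shows "real (card {(u, v) \<in> W \<times> W. {w,u,v} \<in> E}) \<le> g26_deg (csize W c) (c w)"
proof -
  have fin: "finite W" using three_graphD(1)[OF tg] W finite_subset by blast
  have "card {(u, v) \<in> W \<times> W. {w,u,v} \<in> E} \<le> card {(u, v) \<in> W \<times> W. okc (c w) (c u) (c v)}"
  proof (rule card_mono)
    show "finite {(u, v) \<in> W \<times> W. okc (c w) (c u) (c v)}"
      by (rule finite_subset[of _ "W \<times> W"]) (use fin in auto)
    have "okc (c w) (c u) (c v)" if "u \<in> W" "v \<in> W" "{w,u,v} \<in> E" for u v
      using c(2)[OF that(3)] that W(2) by (simp add: okc_def)
    then show "{(u, v) \<in> W \<times> W. {w,u,v} \<in> E} \<subseteq> {(u, v) \<in> W \<times> W. okc (c w) (c u) (c v)}" by auto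
  qed
  also have "real \<dots> = g26_deg (csize W c) (c w)"
    unfolding g26_deg_def by (rule card_pairs_by_colour[OF fin _ c(1)]) simp
  finally show ?thesis by simp
qed

lemma G26_on_card:
  assumes tg: "three_graph (V, E)" and "G26_on E V"
  shows "real (card E) \<le> 2 / 27 * real (card V) ^ 3"
proof -
  note tgD = three_graphD[OF tg]
  obtain c where c: "c ` V \<subseteq> {1..6}" "\<And>e. e \<in> E \<Longrightarrow> e \<subseteq> V \<Longrightarrow> c ` e \<in> snd G26"
    using assms(2) unfolding G26_on_def by metis
  define y where "y = csize V c"
  have y0: "0 \<le> y j" for j by (simp add: y_def)
  have "real (6 * card E) \<le> real (\<Sum>w\<in>V. card {(u, v) \<in> V \<times> V. {w,u,v} \<in> E})"
    using six_card_le[OF tg] by (rule of_nat_mono)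
  also have "\<dots> \<le> (\<Sum>w\<in>V. g26_deg y (c w))"
    unfolding of_nat_sum y_def by (intro sum_mono g26_deg_bound[OF tg order_refl _ c])
  also have "\<dots> = (\<Sum>i\<in>{1..6}. y i * g26_deg y i)"
    unfolding y_def by (rule sum_by_colour[OF tgD(1) _ c(1)]) simp
  finally have 1: "real (card E) \<le> (\<Sum>i\<in>{1..6}. y i * g26_deg y i) / 6" by simp
  define P Q R where PQR: "P = y 1 + y 2" "Q = y 4 + y 5" "R = y 3 + y 6"
  have nn: "0 \<le> P" "0 \<le> Q" "0 \<le> R" using y0 by (auto simp: PQR)
  have "(\<Sum>j\<in>{1..6}. y j) = real (card V)"
    unfolding y_def by (rule sum_csize[OF tgD(1) _ c(1)]) simp
  then have s: "P + Q + R = real (card V)" unfolding set16 PQR by simp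
  have "2 * (P + Q + R) ^ 3 / 27 - (\<Sum>i\<in>{1..6}. y i * g26_deg y i) / 6 \<ge> 0"
    unfolding PQR g26_poly
    by (intro add_nonneg_nonneg mult_nonneg_nonneg divide_nonneg_nonneg) (use y0 in \<open>auto simp: add_nonneg_nonneg\<close>)
  then show ?thesis using 1 unfolding s by simp
qed

lemma semibip_deg_bound:
  assumes tg: "three_graph (V, E)" and W: "W \<subseteq> V" "w \<in> W"
    and A: "\<And>e. e \<in> E \<Longrightarrow> e \<subseteq> W \<Longrightarrow> card (e \<inter> A) = 1"
  defines "a \<equiv> real (card (W \<inter> A))" and "b \<equiv> real (card (W - A))"
  shows "w \<in> A \<Longrightarrow> real (card {(u, v) \<in> W \<times> W. {w,u,v} \<in> E}) \<le> b\<^sup>2"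
    "w \<notin> A \<Longrightarrow> real (card {(u, v) \<in> W \<times> W. {w,u,v} \<in> E}) \<le> 2 * a * b"
proof -
  have fin: "finite W" using three_graphD(1)[OF tg] W finite_subset by blast
  have one: "(u \<in> A \<longrightarrow> v \<notin> A \<and> w \<notin> A) \<and> (v \<in> A \<longrightarrow> u \<notin> A \<and> w \<notin> A) \<and> (w \<in> A \<longrightarrow> u \<notin> A \<and> v \<notin> A)
      \<and> (u \<in> A \<or> v \<in> A \<or> w \<in> A)"
    if e: "u \<in> W" "v \<in> W" "{w,u,v} \<in> E" for u v
  proof -
    have d: "w \<noteq> u" "w \<noteq> v" "u \<noteq> v" using three_graphD(3)[OF tg e(3)] by (auto simp: card_3_distinct)
    have "card ({w,u,v} \<inter> A) = 1" using A[OF e(3)] e W(2) by auto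
    then obtain x where "{w,u,v} \<inter> A = {x}" by (auto simp: card_1_singleton_iff)
    then have "x \<in> {w,u,v}" "z \<in> A \<longleftrightarrow> z = x" if "z \<in> {w,u,v}" for z using that by blast+
    then show ?thesis using d by auto
  qed
  show "real (card {(u, v) \<in> W \<times> W. {w,u,v} \<in> E}) \<le> b\<^sup>2" if "w \<in> A"
  proof -
    have "card {(u, v) \<in> W \<times> W. {w,u,v} \<in> E} \<le> card ((W - A) \<times> (W - A))"
    proof (rule card_mono)
      show "{(u, v) \<in> W \<times> W. {w,u,v} \<in> E} \<subseteq> (W - A) \<times> (W - A)"
      proof
        fix p assume "p \<in> {(u, v) \<in> W \<times> W. {w,u,v} \<in> E}"
        then obtain u v where p: "p = (u, v)" "u \<in> W" "v \<in> W" "{w,u,v} \<in> E" by auto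
        with one[OF p(2-4)] \<open>w \<in> A\<close> show "p \<in> (W - A) \<times> (W - A)" by simp
      qed
    qed (use fin in simp)
    also have "real \<dots> = b\<^sup>2" unfolding b_def by (simp add: power2_eq_square card_cartesian_product)
    finally show ?thesis by simp
  qed
  show "real (card {(u, v) \<in> W \<times> W. {w,u,v} \<in> E}) \<le> 2 * a * b" if "w \<notin> A"
  proof -
    have "card {(u, v) \<in> W \<times> W. {w,u,v} \<in> E} \<le> card ((W \<inter> A) \<times> (W - A) \<union> (W - A) \<times> (W \<inter> A))"
    proof (rule card_mono)
      show "{(u, v) \<in> W \<times> W. {w,u,v} \<in> E} \<subseteq> (W \<inter> A) \<times> (W - A) \<union> (W - A) \<times> (W \<inter> A)"
      proof
        fix p assume "p \<in> {(u, v) \<in> W \<times> W. {w,u,v} \<in> E}"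
        then obtain u v where p: "p = (u, v)" "u \<in> W" "v \<in> W" "{w,u,v} \<in> E" by auto
        with one[OF p(2-4)] \<open>w \<notin> A\<close> show "p \<in> (W \<inter> A) \<times> (W - A) \<union> (W - A) \<times> (W \<inter> A)"
          by (cases "u \<in> A") simp_all
      qed
    qed (use fin in simp)
    also have "\<dots> \<le> card ((W \<inter> A) \<times> (W - A)) + card ((W - A) \<times> (W \<inter> A))" by (rule card_Un_le)
    also have "real \<dots> = 2 * a * b" unfolding a_def b_def card_cartesian_product by simp
    finally show ?thesis by simp
  qed
qed

lemma semibip_on_card:
  assumes tg: "three_graph (V, E)" and "semibip_on E V"
  shows "real (card E) \<le> 2 / 27 * real (card V) ^ 3"
proof -
  note tgD = three_graphD[OF tg]
  obtain A where A: "\<And>e. e \<in> E \<Longrightarrow> e \<subseteq> V \<Longrightarrow> card (e \<inter> A) = 1"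
    using assms(2) unfolding semibip_on_def by metis
  define a b where ab: "a = real (card (V \<inter> A))" "b = real (card (V - A))"
  have "real (6 * card E) \<le> real (\<Sum>w\<in>V. card {(u, v) \<in> V \<times> V. {w,u,v} \<in> E})"
    using six_card_le[OF tg] by (rule of_nat_mono)
  also have "\<dots> \<le> (\<Sum>w\<in>V. if w \<in> A then b\<^sup>2 else 2 * a * b)"
    unfolding of_nat_sum ab using semibip_deg_bound[OF tg order_refl _ A] by (intro sum_mono) auto
  also have "\<dots> = a * b\<^sup>2 + b * (2 * a * b)"
    using tgD(1) by (simp add: sum.If_cases ab Int_def Diff_eq Collect_neg_eq)
  finally have 1: "real (card E) \<le> a * b\<^sup>2 / 2" by (simp add: power2_eq_square)
  have "card V = card (V \<inter> A) + card (V - A)" using tgD(1)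
    by (subst card_Un_disjoint[symmetric]) (auto intro: arg_cong[where f=card])
  then have s: "real (card V) = a + b" by (simp add: ab)
  have nn: "0 \<le> a" "0 \<le> b" by (auto simp: ab)
  \<comment> \<open>For fixed \<open>a + b\<close> the maximum of \<open>a * b^2 / 2\<close> is at
    \<open>a = (a + b) / 3\<close>, so the deficit contains the square of the deviation from this
    point.\<close>
  have "2 / 27 * (a + b) ^ 3 - a * b\<^sup>2 / 2 = (a - (a + b) / 3)\<^sup>2 * (a / 3 + 4 * b / 3) / 2"
    by (simp add: field_simps power2_eq_square power3_eq_cube)
  also have "\<dots> \<ge> 0" using nn by simp
  finally show ?thesis using 1 unfolding s by linarith
qed

lemma good_card:
  assumes "three_graph (V, E)" "good E"
  shows "real (card E) \<le> 2 / 27 * real (card V) ^ 3"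
  using assms
proof (induction rule: symmetrize_induct)
  case (symmetrized E)
  then have "tame E V" using symmetrized_tame by blast
  then show ?case using semibip_on_card G26_on_card symmetrized(1) unfolding tame_def by blast
next
  case (step E v E')
  then show ?case by linarith
qed

section \<open>Greedy construction of cliques\<close>

text \<open>\<open>R\<close> is the set of triples that an ideal structure would have. Every vertex misses few of them, so
  cliques containing prescribed vertices can be built greedily.\<close>
locale near_complete =
  fixes W :: "'a set" and E :: "'a set set" and R :: "'a \<Rightarrow> 'a \<Rightarrow> 'a \<Rightarrow> bool" and t :: real
  assumes finW: "finite W"
    and R_sym1: "R u v w \<Longrightarrow> R v u w" and R_sym2: "R u v w \<Longrightarrow> R u w v"
    and R_irr: "\<not> R u u w"
    and t6: "6 \<le> t"
    and missing: "w \<in> W \<Longrightarrow> real (card {(u, v) \<in> W \<times> W. R w u v \<and> {w,u,v} \<notin> E}) \<le> t\<^sup>2"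
begin

text \<open>A pair on which the ideal structure has no triple at all, such as two vertices of one
  colour, is nice vacuously; hence the size condition in \<open>nice_covered\<close>.\<close>

definition nice :: "'a \<Rightarrow> 'a \<Rightarrow> bool" where
  "nice u v \<longleftrightarrow> real (card {w\<in>W. R u v w \<and> {u,v,w} \<notin> E}) \<le> t"

lemma nice_sym: "nice u v \<longleftrightarrow> nice v u"
proof -
  have "{w\<in>W. R u v w \<and> {u,v,w} \<notin> E} = {w\<in>W. R v u w \<and> {v,u,w} \<notin> E}"
    using R_sym1 by (auto simp: insert_commute)
  then show ?thesis by (simp add: nice_def)
qed

lemma nice_refl: "nice u u"
  using t6 R_irr by (simp add: nice_def)

text \<open>Each \<open>v\<close> that is not nice with \<open>u\<close> accounts for more than
  \<open>t\<close> of the at most \<open>t^2\<close> missing ordered pairs at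
  \<open>u\<close>.\<close>

lemma card_not_nice:
  assumes "u \<in> W" shows "real (card {v\<in>W. \<not> nice u v}) \<le> t"
proof -
  let ?M = "\<lambda>v. {w\<in>W. R u v w \<and> {u,v,w} \<notin> E}"
  have "{(v, w) \<in> W \<times> W. R u v w \<and> {u,v,w} \<notin> E} = (SIGMA v:W. ?M v)" by auto
  then have "(\<Sum>v\<in>W. real (card (?M v))) \<le> t\<^sup>2"
    using missing[OF assms] finW by (simp add: of_nat_sum)
  moreover have "(\<Sum>v\<in>{v\<in>W. \<not> nice u v}. t) \<le> (\<Sum>v\<in>{v\<in>W. \<not> nice u v}. real (card (?M v)))"
    by (rule sum_mono) (auto simp: nice_def)
  moreover have "(\<Sum>v\<in>{v\<in>W. \<not> nice u v}. real (card (?M v))) \<le> (\<Sum>v\<in>W. real (card (?M v)))"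
    by (rule sum_mono2) (use finW in auto)
  ultimately have "real (card {v\<in>W. \<not> nice u v}) * t \<le> t * t" by (simp add: power2_eq_square)
  then show ?thesis using t6 by simp
qed

lemma nice_covered:
  assumes "nice u v" "t < real (card {w\<in>W. R u v w})"
  shows "covered E u v"
proof (rule ccontr)
  assume "\<not> covered E u v"
  then have "{w\<in>W. R u v w \<and> {u,v,w} \<notin> E} = {w\<in>W. R u v w}" by (auto simp: covered_def)
  then show False using assms by (simp add: nice_def)
qed

text \<open>At most \<open>6 + 6 * t + 36 * t\<close> vertices are excluded: those in
  \<open>S\<close>, those not nice with a member of \<open>S\<close>, and those that spoil an ideal
  triple on one of the at most 36 nice ordered pairs from \<open>S\<close>. As
  \<open>6 <= t\<close>, this is less than \<open>49 * t\<close>.\<close>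

lemma extend:
  assumes S: "S \<subseteq> W" "card S \<le> 6" and X: "X \<subseteq> W" "49 * t < real (card X)"
  shows "\<exists>u\<in>X. u \<notin> S \<and> (\<forall>s\<in>S. nice u s) \<and> (\<forall>s\<in>S. \<forall>r\<in>S. nice s r \<longrightarrow> R s r u \<longrightarrow> {s,r,u} \<in> E)"
proof -
  have finS: "finite S" using S finW finite_subset by blast
  define B1 where "B1 s = {v\<in>W. \<not> nice s v}" for s
  define B2 where "B2 p = (if nice (fst p) (snd p) then {u\<in>W. R (fst p) (snd p) u \<and> {fst p,snd p,u} \<notin> E} else {})" for p
  define Bad where "Bad = S \<union> (\<Union>s\<in>S. B1 s) \<union> (\<Union>p\<in>S \<times> S. B2 p)"
  have b1: "real (card (\<Union>s\<in>S. B1 s)) \<le> 6 * t"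
  proof -
    have "real (card (\<Union>s\<in>S. B1 s)) \<le> (\<Sum>s\<in>S. real (card (B1 s)))"
      using card_UN_le[OF finS, of B1] by (metis of_nat_le_iff of_nat_sum)
    also have "\<dots> \<le> (\<Sum>s\<in>S. t)"
      by (rule sum_mono) (use card_not_nice S in \<open>auto simp: B1_def\<close>)
    also have "\<dots> \<le> 6 * t" using S(2) t6 by simp
    finally show ?thesis .
  qed
  have b2: "real (card (\<Union>p\<in>S \<times> S. B2 p)) \<le> 36 * t"
  proof -
    have "real (card (\<Union>p\<in>S \<times> S. B2 p)) \<le> (\<Sum>p\<in>S \<times> S. real (card (B2 p)))"
      using card_UN_le[of "S \<times> S" B2] finS by (metis finite_SigmaI of_nat_le_iff of_nat_sum)
    also have "\<dots> \<le> (\<Sum>p\<in>S \<times> S. t)"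
      by (rule sum_mono) (use t6 in \<open>auto simp: B2_def nice_def\<close>)
    also have "\<dots> = real (card S * card S) * t" by (simp add: card_cartesian_product)
    also have "\<dots> \<le> 36 * t"
    proof (rule mult_right_mono)
      have "card S * card S \<le> 6 * 6" using S(2) by (rule mult_le_mono) (rule S(2))
      then show "real (card S * card S) \<le> 36" by linarith
    qed (use t6 in simp)
    finally show ?thesis .
  qed
  have "card Bad \<le> card S + card (\<Union>s\<in>S. B1 s) + card (\<Union>p\<in>S \<times> S. B2 p)"
    unfolding Bad_def using card_Un_le[of "S \<union> (\<Union>s\<in>S. B1 s)" "\<Union>p\<in>S \<times> S. B2 p"]
      card_Un_le[of S "\<Union>s\<in>S. B1 s"] by linarith
  then have "real (card Bad) \<le> 6 + 6 * t + 36 * t" using b1 b2 S(2) by linarith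
  then have lt: "card Bad < card X" using X(2) t6 by linarith
  have "finite Bad" unfolding Bad_def B1_def B2_def using finS finW by auto
  then have "\<not> X \<subseteq> Bad" using lt card_mono[of Bad X] by linarith
  then obtain u where u: "u \<in> X" "u \<notin> Bad" by blast
  have uW: "u \<in> W" using u X by blast
  have "u \<notin> S" using u by (auto simp: Bad_def)
  moreover have "nice u s" if "s \<in> S" for s
    using u(2) that uW nice_sym[of u s] by (auto simp: Bad_def B1_def)
  moreover have "{s,r,u} \<in> E" if "s \<in> S" "r \<in> S" "nice s r" "R s r u" for s r
  proof (rule ccontr)
    assume "{s,r,u} \<notin> E"
    then have "u \<in> B2 (s, r)" using that uW by (simp add: B2_def)
    then show False using u(2) that by (auto simp: Bad_def)
  qed
  ultimately show ?thesis using u(1) by blast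
qed

text \<open>The last clause assumes \<open>nice q r\<close> because \<open>q\<close> and
  \<open>r\<close> may both lie in the prescribed set \<open>S\<close>, where nothing is controlled;
  every pair with a chosen vertex is nice by the clause before.\<close>

definition is_transversal :: "'i set \<Rightarrow> 'a set \<Rightarrow> ('i \<Rightarrow> 'a set) \<Rightarrow> ('i \<Rightarrow> 'a) \<Rightarrow> bool" where
  "is_transversal I S X v \<longleftrightarrow> (\<forall>i\<in>I. v i \<in> X i) \<and> inj_on v I \<and> v ` I \<inter> S = {} \<and>
    (\<forall>i\<in>I. \<forall>q\<in>S \<union> v ` I. nice (v i) q) \<and>
    (\<forall>i\<in>I. \<forall>q\<in>S \<union> v ` I. \<forall>r\<in>S \<union> v ` I. nice q r \<longrightarrow> R (v i) q r \<longrightarrow> {v i,q,r} \<in> E)"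

text \<open>Vertices are added one at a time by \<open>extend\<close>, which copes with at most six
  earlier ones; a final size of at most seven guarantees this at each choice.\<close>

lemma transversal_exists:
  assumes "finite I" "S \<subseteq> W" "card S + card I \<le> 7"
    "\<And>i. i \<in> I \<Longrightarrow> X i \<subseteq> W" "\<And>i. i \<in> I \<Longrightarrow> 49 * t < real (card (X i))"
  shows "\<exists>v. is_transversal I S X v"
  unfolding is_transversal_def
  using assms
proof (induction I rule: finite_induct)
  case empty
  then show ?case by simp
next
  case (insert j I)
  obtain v where v: "\<And>i. i \<in> I \<Longrightarrow> v i \<in> X i" "inj_on v I" "v ` I \<inter> S = {}"
    "\<And>i q. i \<in> I \<Longrightarrow> q \<in> S \<union> v ` I \<Longrightarrow> nice (v i) q"
    "\<And>i q r. i \<in> I \<Longrightarrow> q \<in> S \<union> v ` I \<Longrightarrow> r \<in> S \<union> v ` I \<Longrightarrow> nice q r \<Longrightarrow> R (v i) q r \<Longrightarrow> {v i,q,r} \<in> E"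
  proof -
    have "card S + card I \<le> 7" using insert.prems(2) insert.hyps by simp
    then have "\<exists>v. (\<forall>i\<in>I. v i \<in> X i) \<and> inj_on v I \<and> v ` I \<inter> S = {} \<and>
    (\<forall>i\<in>I. \<forall>q\<in>S \<union> v ` I. nice (v i) q) \<and>
    (\<forall>i\<in>I. \<forall>q\<in>S \<union> v ` I. \<forall>r\<in>S \<union> v ` I. nice q r \<longrightarrow> R (v i) q r \<longrightarrow> {v i,q,r} \<in> E)"
      using insert.IH insert.prems by simp
    then show thesis using that by metis
  qed
  let ?S = "S \<union> v ` I"
  have sub: "?S \<subseteq> W" using insert.prems v(1) by blast
  have "card ?S \<le> card S + card I"
    using card_Un_le[of S "v ` I"] card_image_le[OF insert.hyps(1), of v] by linarith
  then have c6: "card ?S \<le> 6" using insert.prems(2) insert.hyps by simp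
  obtain u where u: "u \<in> X j" "u \<notin> ?S" "\<And>s. s \<in> ?S \<Longrightarrow> nice u s"
    "\<And>s r. s \<in> ?S \<Longrightarrow> r \<in> ?S \<Longrightarrow> nice s r \<Longrightarrow> R s r u \<Longrightarrow> {s,r,u} \<in> E"
    using extend[OF sub c6, of "X j"] insert.prems(3,4) by (metis insertI1)
  define v' where "v' = v(j := u)"
  have v'I: "v' i = v i" if "i \<in> I" for i using that insert.hyps by (auto simp: v'_def)
  have v'j: "v' j = u" by (simp add: v'_def)
  have im: "v' ` I = v ` I" using v'I by simp
  have im': "S \<union> v' ` insert j I = insert u ?S" using im v'j by simp
  have nice': "nice p q" if "p \<in> v' ` insert j I" "q \<in> insert u ?S" for p q
  proof -
    have "p = u \<or> (\<exists>i\<in>I. p = v i)" using that(1) im v'j by auto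
    then show ?thesis using that(2) u(3) v(4) nice_sym[of p q] nice_refl by auto
  qed
  have edge': "{p,q,r} \<in> E"
    if p: "p \<in> v' ` insert j I" and q: "q \<in> insert u ?S" and r: "r \<in> insert u ?S" and n: "nice q r" and R: "R p q r" for p q r
  proof -
    have "p \<noteq> q" "p \<noteq> r" "q \<noteq> r" using R R_irr R_sym1 R_sym2 by metis+
    have pq: "p = u \<or> (\<exists>i\<in>I. p = v i)" using p im v'j by auto
    then have pS: "p = u \<or> p \<in> ?S" by auto
    have np: "nice p q" "nice p r" using nice'[OF p] q r by auto
    have R': "R q r p" "R p r q" using R R_sym1 R_sym2 by metis+
    \<comment> \<open>\<open>R\<close> holds only for distinct vertices, so at most one of the three
      is the new \<open>u\<close>; its symmetry moves \<open>u\<close> to the last place, where the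
      choice of \<open>u\<close> applies.\<close>
    consider "p = u" "q \<in> ?S" "r \<in> ?S" | "q = u" "p \<in> ?S" "r \<in> ?S" | "r = u" "p \<in> ?S" "q \<in> ?S"
      | i where "i \<in> I" "p = v i" "q \<in> ?S" "r \<in> ?S"
      using pq pS q r \<open>p \<noteq> q\<close> \<open>p \<noteq> r\<close> \<open>q \<noteq> r\<close> by blast
    then show ?thesis
    proof cases
      case 1
      then have "{q,r,p} \<in> E" using u(4)[of q r] n R'(1) by simp
      then show ?thesis by (simp add: insert_commute)
    next
      case 2
      then have "{p,r,q} \<in> E" using u(4)[of p r] np R' by simp
      then show ?thesis by (simp add: insert_commute)
    next
      case 3
      then show ?thesis using u(4)[of p q] np R by simp
    next
      case 4
      then show ?thesis using v(5) n R by simp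
    qed
  qed
  show ?case
  proof (intro exI[of _ v'] conjI ballI impI)
    show "v' i \<in> X i" if "i \<in> insert j I" for i using that v(1) v'I v'j u(1) by auto
    show "inj_on v' (insert j I)"
    proof -
      have "inj_on v' I" using v(2) v'I by (simp add: inj_on_def)
      moreover have "v' j \<notin> v' ` (I - {j})" using u(2) v'j im insert.hyps by auto
      ultimately show ?thesis by (simp add: inj_on_insert)
    qed
    show "v' ` insert j I \<inter> S = {}" using v(3) u(2) im v'j by auto
    fix i assume i: "i \<in> insert j I"
    fix q assume q: "q \<in> S \<union> v' ` insert j I"
    show "nice (v' i) q" using nice'[of "v' i" q] i q im' by blast
    fix r assume r: "r \<in> S \<union> v' ` insert j I" and "nice q r" "R (v' i) q r"
    then show "{v' i,q,r} \<in> E" using edge'[of "v' i" q r] i q im' by blast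
  qed
qed

lemma is_transversalD:
  assumes "is_transversal I S X v"
  shows "\<And>i. i \<in> I \<Longrightarrow> v i \<in> X i" "inj_on v I" "v ` I \<inter> S = {}"
    "\<And>i q. i \<in> I \<Longrightarrow> q \<in> S \<union> v ` I \<Longrightarrow> nice (v i) q"
    "\<And>i q r. i \<in> I \<Longrightarrow> q \<in> S \<union> v ` I \<Longrightarrow> r \<in> S \<union> v ` I \<Longrightarrow> nice q r \<Longrightarrow> R (v i) q r \<Longrightarrow> {v i,q,r} \<in> E"
  using assms unfolding is_transversal_def by metis+

end

section \<open>Seven-vertex cliques and minimum degree\<close>

lemma clique_insertI:
  assumes "clique E T" "\<And>p. p \<in> T \<Longrightarrow> covered E x p"
  shows "clique E (insert x T)"
  using assms covered_sym[of E] unfolding clique_def by auto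

lemma clique_unionI:
  assumes "clique E S" "\<And>i q. i \<in> I \<Longrightarrow> q \<in> S \<union> v ` I \<Longrightarrow> v i \<noteq> q \<Longrightarrow> covered E (v i) q"
  shows "clique E (S \<union> v ` I)"
  using assms covered_sym[of E] unfolding clique_def by (metis UnE image_iff)

lemma card_7_split:
  assumes "finite S" "finite I" "inj_on v I" "v ` I \<inter> S = {}" "x \<notin> S \<union> v ` I"
  shows "card (insert x (S \<union> v ` I)) = Suc (card S + card I)"
proof -
  have "card (S \<union> v ` I) = card S + card (v ` I)" by (rule card_Un_disjoint) (use assms in auto)
  then show ?thesis using assms by (simp add: card_image)
qed

text \<open>The source of most contradictions below. Passing one edge twice gives the form for two
  disjoint edges.\<close>

lemma good_7_clique:
  assumes "good E" "card S = 7" "clique E S" "e \<in> E" "f \<in> E" "g \<in> E" "e \<subseteq> S" "f \<subseteq> S" "g \<subseteq> S"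
  shows "e \<inter> f \<inter> g \<noteq> {}"
proof -
  have "star_on E S" using assms unfolding good_def by blast
  then obtain v where "\<And>e. e \<in> E \<Longrightarrow> e \<subseteq> S \<Longrightarrow> v \<in> e" unfolding star_on_def by metis
  then have "v \<in> e" "v \<in> f" "v \<in> g" using assms by auto
  then show ?thesis by blast
qed

text \<open>Doubling the degree doubles its deficit to \<open>2 / 10^33\<close>; pairs through
  \<open>x\<close> cost at most \<open>2 * m\<close>, which is at most another
  \<open>2 / 10^33 * m^2\<close>. Together this is below \<open>1 / 10^32 * m^2\<close>.\<close>

lemma min_degree_pairs:
  assumes tg: "three_graph (U, E)" and m: "m = real (card U)" "10 ^ 33 \<le> m"
    and deg: "(2 / 9 - 1 / 10 ^ 33) * m\<^sup>2 \<le> real (card {e\<in>E. w \<in> e})"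
  shows "(4 / 9 - 1 / 10 ^ 32) * m\<^sup>2 \<le> real (card {(u, v) \<in> (U - {x}) \<times> (U - {x}). {w,u,v} \<in> E})"
proof -
  note tgD = three_graphD[OF tg]
  let ?P = "{(u, v) \<in> (U - {x}) \<times> (U - {x}). {w,u,v} \<in> E}"
  have finP: "finite ?P" by (rule finite_subset[of _ "U \<times> U"]) (use tgD(1) in auto)
  have "card {(u, v) \<in> U \<times> U. {w,u,v} \<in> E} \<le> card (?P \<union> ({x} \<times> U \<union> U \<times> {x}))"
    by (rule card_mono) (use finP tgD(1) in auto)
  also have "\<dots> \<le> card ?P + card ({x} \<times> U \<union> U \<times> {x})" by (rule card_Un_le)
  also have "\<dots> \<le> card ?P + (card ({x} \<times> U) + card (U \<times> {x}))" using card_Un_le by (rule add_left_mono)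
  also have "\<dots> = card ?P + 2 * card U" by (simp add: card_cartesian_product)
  finally have "2 * card {e\<in>E. w \<in> e} \<le> card ?P + 2 * card U" using two_degree_le[OF tg, of w] by linarith
  then have "2 * real (card {e\<in>E. w \<in> e}) \<le> real (card ?P) + 2 * m" unfolding m by linarith
  then have "2 * ((2 / 9 - 1 / 10 ^ 33) * m\<^sup>2) - 2 * m \<le> real (card ?P)" using deg by linarith
  moreover have "10 ^ 33 * m \<le> m\<^sup>2" using m(2) by (simp add: power2_eq_square)
  ultimately show ?thesis by (simp add: field_simps)
qed

section \<open>Adding a vertex to a semibipartite system\<close>

definition one_of :: "'a set \<Rightarrow> 'a \<Rightarrow> 'a \<Rightarrow> 'a \<Rightarrow> bool" where
  "one_of A u v w \<longleftrightarrow> u \<noteq> v \<and> u \<noteq> w \<and> v \<noteq> w \<and>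
    (u \<in> A \<and> v \<notin> A \<and> w \<notin> A \<or> u \<notin> A \<and> v \<in> A \<and> w \<notin> A \<or> u \<notin> A \<and> v \<notin> A \<and> w \<in> A)"

lemma one_of_iff:
  assumes "card {u,v,w} = 3"
  shows "card ({u,v,w} \<inter> A) = 1 \<longleftrightarrow> one_of A u v w"
proof -
  have d: "u \<noteq> v" "u \<noteq> w" "v \<noteq> w" using assms by (auto simp: card_3_distinct)
  show ?thesis
    by (cases "u \<in> A"; cases "v \<in> A"; cases "w \<in> A") (use d in \<open>auto simp: one_of_def Int_insert_left\<close>)
qed

text \<open>The hypothesis on \<open>b^2\<close> bounds \<open>b\<close> from below near
  \<open>2 / 3\<close>. Since \<open>2 * (1 - b) * b\<close> has slope \<open>-2 / 3\<close> there,
  the hypothesis on \<open>2 * a * b\<close> bounds \<open>b\<close> from above. Hence ideal links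
  exceed the guaranteed ones by at most \<open>4 * h\<close>.\<close>

lemma semibip_sizes_unit:
  fixes a b h :: real
  assumes nn: "0 \<le> a" "0 \<le> b" and ab: "a + b \<le> 1" and h: "0 \<le> h" "h \<le> 1 / 100"
    and b2: "4 / 9 - h \<le> b\<^sup>2" and ab2: "4 / 9 - h \<le> 2 * a * b"
  shows "b\<^sup>2 \<le> 4 / 9 + 3 * h" "2 * a * b \<le> 4 / 9 + 3 * h" "a \<le> 2 / 5" "1 / 10 \<le> a" "3 / 5 \<le> b"
proof -
  have hh: "h * h \<le> h / 100" using h by (intro order_trans[OF mult_left_mono[OF h(2) h(1)]]) simp
  have lo: "2 / 3 - h \<le> b"
  proof (rule ccontr)
    assume "\<not> ?thesis"
    then have "b\<^sup>2 < (2 / 3 - h)\<^sup>2" using nn by (intro power_strict_mono) auto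
    also have "\<dots> = 4 / 9 - 4 / 3 * h + h * h" by (simp add: power2_eq_square algebra_simps)
    finally show False using b2 hh h by linarith
  qed
  have "2 * a * b \<le> 2 * (1 - b) * b" using ab nn by (intro mult_right_mono) auto
  also have "\<dots> = 4 / 9 - 2 / 3 * (b - 2 / 3) - 2 * (b - 2 / 3)\<^sup>2"
    by (simp add: power2_eq_square algebra_simps)
  also have "\<dots> \<le> 4 / 9 - 2 / 3 * (b - 2 / 3)" by simp
  finally have *: "2 * a * b \<le> 4 / 9 - 2 / 3 * (b - 2 / 3)" .
  then have "4 / 9 - h \<le> 4 / 9 - 2 / 3 * (b - 2 / 3)" using ab2 by (rule order_trans[rotated])
  then have hi: "b \<le> 2 / 3 + 2 * h" using h by argo
  have "4 / 9 - 2 / 3 * (b - 2 / 3) \<le> 4 / 9 + 3 * h" using lo h by argo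
  then show "2 * a * b \<le> 4 / 9 + 3 * h" using * by (rule order_trans[rotated])
  have "b\<^sup>2 \<le> (2 / 3 + 2 * h)\<^sup>2" using hi nn by (intro power_mono) auto
  also have "\<dots> = 4 / 9 + 8 / 3 * h + 4 * (h * h)" by (simp add: power2_eq_square algebra_simps)
  finally show "b\<^sup>2 \<le> 4 / 9 + 3 * h" using hh h by linarith
  show "a \<le> 2 / 5" "3 / 5 \<le> b" using lo ab h by linarith+
  have "2 * a * b \<le> 2 * a * 1" using nn ab by (intro mult_left_mono) auto
  then show "1 / 10 \<le> a" using ab2 h by linarith
qed

lemma semibip_sizes:
  fixes a b m h :: real
  assumes m: "0 < m" and nn: "0 \<le> a" "0 \<le> b" and ab: "a + b \<le> m" and h: "0 \<le> h" "h \<le> 1 / 100"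
    and b2: "(4 / 9 - h) * m\<^sup>2 \<le> b\<^sup>2" and ab2: "(4 / 9 - h) * m\<^sup>2 \<le> 2 * a * b"
  shows "b\<^sup>2 \<le> (4 / 9 + 3 * h) * m\<^sup>2" "2 * a * b \<le> (4 / 9 + 3 * h) * m\<^sup>2" "a \<le> 2 / 5 * m" "1 / 10 * m \<le> a" "3 / 5 * m \<le> b"
proof -
  define a' b' where "a' = a / m" and "b' = b / m"
  have ab': "a = a' * m" "b = b' * m" using m by (auto simp: a'_def b'_def)
  have sq: "b\<^sup>2 = b'\<^sup>2 * m\<^sup>2" "2 * a * b = (2 * a' * b') * m\<^sup>2" by (auto simp: ab' power2_eq_square)
  have m2: "0 < m\<^sup>2" using m by simp
  have n': "0 \<le> a'" "0 \<le> b'" using nn m by (auto simp: a'_def b'_def)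
  have "(a' + b') * m \<le> 1 * m" using ab by (simp add: ab' algebra_simps)
  then have s': "a' + b' \<le> 1" using m by simp
  note u = semibip_sizes_unit[OF n' s' h b2[unfolded sq, THEN mult_right_le_imp_le, OF m2] ab2[unfolded sq, THEN mult_right_le_imp_le, OF m2]]
  show "b\<^sup>2 \<le> (4 / 9 + 3 * h) * m\<^sup>2" "2 * a * b \<le> (4 / 9 + 3 * h) * m\<^sup>2"
    unfolding sq using u m2 by (auto intro: mult_right_mono)
  show "a \<le> 2 / 5 * m" "1 / 10 * m \<le> a" "3 / 5 * m \<le> b"
    unfolding ab' using u m by (auto intro!: mult_right_mono simp del: mult_le_cancel_right)
qed

text \<open>The link of \<open>x\<close> has no pair inside \<open>A\<close>. Nor can it have a pair
  outside \<open>A\<close> when \<open>x\<close> is covered with a vertex of \<open>A\<close> that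
  is nice with both ends. So either the link consists of mixed pairs, and \<open>x\<close> is placed
  outside \<open>A\<close>, or it avoids \<open>A\<close>, and \<open>x\<close> joins
  \<open>A\<close>.\<close>

lemma semibip_extend:
  fixes m :: real
  assumes tg: "three_graph (U, E)" and g: "good E" and x: "x \<in> U"
    and m: "m = real (card U)" "10 ^ 33 \<le> m"
    and deg: "\<And>w. w \<in> U \<Longrightarrow> (2 / 9 - 1 / 10 ^ 33) * m\<^sup>2 \<le> real (card {e\<in>E. w \<in> e})"
    and sb: "semibip_on E (U - {x})"
  shows "semibip_on E U"
proof -
  note tgD = three_graphD[OF tg]
  define W where "W = U - {x}"
  define h :: real where "h = 1 / 10 ^ 32"
  define t where "t = m / 10 ^ 7"
  have h: "0 \<le> h" "h \<le> 1 / 100" by (auto simp: h_def)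
  have m0: "0 < m" "0 < m\<^sup>2" using m(2) by auto
  have finW: "finite W" using tgD(1) by (simp add: W_def)
  have cardW: "real (card W) = m - 1" using x tgD(1) m by (simp add: W_def of_nat_diff card_gt_0_iff Suc_leI)
  obtain A0 where A0: "\<And>e. e \<in> E \<Longrightarrow> e \<subseteq> W \<Longrightarrow> card (e \<inter> A0) = 1"
    using sb unfolding semibip_on_def W_def by metis
  define A where "A = W \<inter> A0"
  have A: "card (e \<inter> A) = 1" if "e \<in> E" "e \<subseteq> W" for e
  proof -
    have "e \<inter> A = e \<inter> A0" using that by (auto simp: A_def)
    then show ?thesis using A0[OF that] by simp
  qed
  have AW: "A \<subseteq> W" by (simp add: A_def)
  let ?B = "W - A"
  have dist3: "card {u,v,w} = 3" if "{u,v,w} \<in> E" for u v w using tgD(3)[OF that] .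
  have edge_R: "one_of A u v w" if "{u,v,w} \<in> E" "u \<in> W" "v \<in> W" "w \<in> W" for u v w
    using A[OF that(1)] one_of_iff[OF dist3[OF that(1)]] that by simp
  have pairs: "(4 / 9 - h) * m\<^sup>2 \<le> real (card {(u, v) \<in> W \<times> W. {w,u,v} \<in> E})" if "w \<in> U" for w
    unfolding W_def h_def by (rule min_degree_pairs[OF tg m deg[OF that]])
  have pos: "0 < (4 / 9 - h) * m\<^sup>2" using h m0 by simp
  define a b where ab: "a = real (card A)" "b = real (card ?B)"
  have "card W = card A + card ?B"
    using finW AW by (metis card_Un_disjoint Diff_disjoint Un_Diff_cancel finite_Diff finite_subset sup.absorb2)
  then have sum: "a + b = m - 1" using cardW ab by simp
  obtain w0 where w0: "w0 \<in> W"
  proof -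
    have "W \<noteq> {}" using cardW m(2) by auto
    then show thesis using that by blast
  qed
  have "{(u, v) \<in> W \<times> W. {w0,u,v} \<in> E} \<noteq> {}"
  proof
    assume eq: "{(u, v) \<in> W \<times> W. {w0,u,v} \<in> E} = {}"
    have "w0 \<in> U" using w0 by (simp add: W_def)
    from pairs[OF this] pos show False unfolding eq by simp
  qed
  then obtain u0 v0 where uv0: "u0 \<in> W" "v0 \<in> W" "{w0,u0,v0} \<in> E" by auto
  then have "one_of A w0 u0 v0" using edge_R w0 by blast
  then obtain p q where p: "p \<in> A" and q: "q \<in> ?B" using w0 uv0 by (auto simp: one_of_def)
  have IWA: "W \<inter> A = A" using AW by blast
  have pU: "p \<in> W" "p \<in> U" "q \<in> W" "q \<in> U" using p q AW by (auto simp: W_def)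
  have WU: "W \<subseteq> U" by (auto simp: W_def)
  have b2: "(4 / 9 - h) * m\<^sup>2 \<le> b\<^sup>2"
    using pairs[OF pU(2)] semibip_deg_bound(1)[OF tg WU pU(1) A p] unfolding ab by linarith
  have ab2: "(4 / 9 - h) * m\<^sup>2 \<le> 2 * a * b"
    using pairs[OF pU(4)] semibip_deg_bound(2)[OF tg WU pU(3) A] q unfolding ab IWA by auto
  have nn: "0 \<le> a" "0 \<le> b" by (auto simp: ab)
  have "a + b \<le> m" using sum by simp
  note sizes = semibip_sizes[OF m0(1) nn this h b2 ab2]
  interpret near_complete W E "one_of A" t
  proof
    show "finite W" by (rule finW)
    show "6 \<le> t" using m(2) by (simp add: t_def)
    fix u v w
    show "one_of A u v w \<Longrightarrow> one_of A v u w" "one_of A u v w \<Longrightarrow> one_of A u w v" "\<not> one_of A u u w"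
      by (auto simp: one_of_def)
    assume w: "w \<in> W"
    let ?M = "{(u, v) \<in> W \<times> W. one_of A w u v \<and> {w,u,v} \<notin> E}"
    let ?P = "{(u, v) \<in> W \<times> W. {w,u,v} \<in> E}"
    let ?Q = "{(u, v) \<in> W \<times> W. one_of A w u v}"
    have fin: "finite ?M" "finite ?P" by (rule finite_subset[of _ "W \<times> W"]; use finW in auto)+
    have "real (card ?Q) \<le> (4 / 9 + 3 * h) * m\<^sup>2"
    proof (cases "w \<in> A")
      case True
      have "card ?Q \<le> card (?B \<times> ?B)"
        by (rule card_mono) (use finW True in \<open>auto simp: one_of_def\<close>)
      also have "real \<dots> = b\<^sup>2" by (simp add: ab power2_eq_square card_cartesian_product)
      finally show ?thesis using sizes(1) by simp
    next
      case False
      have "card ?Q \<le> card (A \<times> ?B \<union> ?B \<times> A)"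
        by (rule card_mono) (use finW AW False in \<open>auto simp: one_of_def intro: finite_subset\<close>)
      also have "\<dots> \<le> card (A \<times> ?B) + card (?B \<times> A)" by (rule card_Un_le)
      also have "real \<dots> = 2 * a * b" by (simp add: ab card_cartesian_product)
      finally show ?thesis using sizes(2) by simp
    qed
    moreover have "card ?M + card ?P = card (?M \<union> ?P)"
      by (rule card_Un_disjoint[symmetric]) (use fin in auto)
    moreover have "card (?M \<union> ?P) \<le> card ?Q"
      by (rule card_mono) (use finW edge_R w in \<open>auto intro: finite_subset[of _ "W \<times> W"]\<close>)
    moreover have "(4 / 9 - h) * m\<^sup>2 \<le> real (card ?P)" using pairs w WU by blast
    ultimately have "real (card ?M) \<le> (4 / 9 + 3 * h) * m\<^sup>2 - (4 / 9 - h) * m\<^sup>2" by linarith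
    also have "\<dots> = 4 * h * m\<^sup>2" by (simp add: algebra_simps)
    also have "\<dots> \<le> t\<^sup>2" using m0 by (simp add: h_def t_def power_divide)
    finally show "real (card ?M) \<le> t\<^sup>2" .
  qed
  have tm: "t < 1 / 100 * m - 1" using m(2) by (simp add: t_def)
  have cov: "covered E u v" if uv: "nice u v" "u \<in> W" "v \<in> W" "u \<noteq> v" "\<not> (u \<in> A \<and> v \<in> A)" for u v
  proof (rule nice_covered[OF uv(1)])
    show "t < real (card {w\<in>W. one_of A u v w})"
    proof (cases "u \<in> A \<or> v \<in> A")
      case True
      have "card (?B - {u,v}) \<le> card {w\<in>W. one_of A u v w}"
        by (rule card_mono) (use finW True uv in \<open>auto simp: one_of_def\<close>)
      moreover have "card ?B \<le> card (?B - {u,v}) + 2"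
      proof -
        have "card ?B - card {u,v} \<le> card (?B - {u,v})" by (rule diff_card_le_card_Diff) simp
        then show ?thesis using uv(4) by simp
      qed
      ultimately have "b \<le> real (card {w\<in>W. one_of A u v w}) + 2" by (simp add: ab)
      then show ?thesis using sizes(5) tm m(2) by linarith
    next
      case False
      have "card A \<le> card {w\<in>W. one_of A u v w}"
        by (rule card_mono) (use finW False uv AW in \<open>auto simp: one_of_def\<close>)
      then show ?thesis using sizes(4) tm m(2) by (simp add: ab)
    qed
  qed
  have xW: "x \<notin> W" by (simp add: W_def)
  have in_W: "u \<in> W" "v \<in> W" if "{x,u,v} \<in> E" for u v
    using tgD(2)[OF that] dist3[OF that] by (auto simp: W_def card_3_distinct)
  define NB where "NB = {u\<in>?B. covered E x u}"
  define NA where "NA = {u\<in>A. covered E x u}"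
  have NW: "NB \<subseteq> W" "NA \<subseteq> W" using AW by (auto simp: NB_def NA_def)
  have finN: "finite NB" "finite NA" using NW finW finite_subset by auto
  have covx: "covered E x u" "covered E x v" if "{x,u,v} \<in> E" for u v
    using that by (auto intro: coveredI)
  have px: "(4 / 9 - h) * m\<^sup>2 \<le> real (card {(u, v) \<in> W \<times> W. {x,u,v} \<in> E})" using pairs[OF x] .
  \<comment> \<open>Otherwise nearly all link pairs of \<open>x\<close> lie inside \<open>A\<close>,
    which has at most \<open>2 / 5 * m\<close> vertices and thus gives only
    \<open>4 / 25 < 4 / 9\<close>.\<close>
  have NBbig: "49 * t < real (card NB)"
  proof -
    have "card {(u, v) \<in> W \<times> W. {x,u,v} \<in> E} \<le> card (A \<times> A \<union> (NB \<times> W \<union> W \<times> NB))"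
      by (rule card_mono) (use finW finN AW finite_subset covx in \<open>auto simp: NB_def\<close>)
    also have "\<dots> \<le> card (A \<times> A) + (card (NB \<times> W) + card (W \<times> NB))"
      by (rule order_trans[OF card_Un_le]) (intro add_left_mono card_Un_le)
    also have "real \<dots> = a\<^sup>2 + 2 * (real (card NB) * real (card W))"
      by (simp add: ab card_cartesian_product power2_eq_square)
    finally have "(4 / 9 - h) * m\<^sup>2 \<le> a\<^sup>2 + 2 * (real (card NB) * real (card W))" using px by simp
    moreover have "a\<^sup>2 \<le> (2 / 5 * m)\<^sup>2" using sizes(3) nn by (intro power_mono) auto
    moreover have "real (card NB) * real (card W) \<le> real (card NB) * m" using cardW by (intro mult_left_mono) auto
    ultimately have "(4 / 9 - h) * m\<^sup>2 \<le> 4 / 25 * m\<^sup>2 + 2 * (real (card NB) * m)"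
      by (simp add: power_mult_distrib power_divide)
    then have "(1 / 10 * m) * m \<le> real (card NB) * m" using h m0 by (simp add: algebra_simps power2_eq_square h_def)
    then have "1 / 10 * m \<le> real (card NB)" using m0 by simp
    then show ?thesis using m0 by (simp add: t_def)
  qed
  \<comment> \<open>Four vertices of \<open>NB\<close> complete \<open>x,a1,a2\<close> to a
    7-clique, and the edges \<open>{x,a1,a2}\<close>, \<open>{v 1,a1,v 2}\<close>,
    \<open>{v 3,a2,v 4}\<close> have no common vertex.\<close>
  have AA: False if e: "{x,a1,a2} \<in> E" "a1 \<in> A" "a2 \<in> A" for a1 a2
  proof -
    have d: "a1 \<noteq> a2" "a1 \<noteq> x" "a2 \<noteq> x" using dist3[OF e(1)] by (auto simp: card_3_distinct)
    have S: "{a1,a2} \<subseteq> W" "card {a1,a2} + card {1,2,3,4::nat} \<le> 7" using e AW d by auto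
    have "\<exists>v. is_transversal {1,2,3,4::nat} {a1,a2} (\<lambda>_. NB) v"
      by (rule transversal_exists) (use S NW NBbig in auto)
    then obtain v where tv: "is_transversal {1,2,3,4::nat} {a1,a2} (\<lambda>_. NB) v" ..
    note v = is_transversalD[OF tv]
    let ?I = "{1,2,3,4::nat}"
    have vW: "v i \<in> W" "v i \<notin> A" "covered E x (v i)" if "i \<in> ?I" for i using v(1)[OF that] NW by (auto simp: NB_def)
    have vd: "v i \<noteq> v j" if "i \<in> ?I" "j \<in> ?I" "i \<noteq> j" for i j using v(2) that by (meson inj_onD)
    have vS: "v i \<notin> {a1,a2}" if "i \<in> ?I" for i using v(3) imageI[OF that, of v] by (metis disjoint_iff)
    have TW: "{a1,a2} \<union> v ` ?I \<subseteq> W" using S(1) vW(1) by (metis Un_least image_subsetI)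
    have cl: "clique E ({a1,a2} \<union> v ` ?I)"
    proof (rule clique_unionI)
      have "covered E a1 a2" by (rule coveredI[OF e(1)]) simp_all
      then show "clique E {a1,a2}" using covered_sym[of E a1 a2] by (simp add: clique_def)
      fix i q assume i: "i \<in> ?I" and q: "q \<in> {a1,a2} \<union> v ` ?I" and ne: "v i \<noteq> q"
      show "covered E (v i) q"
        by (rule cov[OF v(4)[OF i q] vW(1)[OF i] subsetD[OF TW q] ne]) (use vW(2)[OF i] in simp)
    qed
    have cl7: "clique E (insert x ({a1,a2} \<union> v ` ?I))"
      by (rule clique_insertI[OF cl]) (use vW(3) covx[OF e(1)] in \<open>elim UnE insertE imageE; simp\<close>)
    have "x \<notin> {a1,a2} \<union> v ` ?I" using TW xW by (meson subsetD)
    then have c7: "card (insert x ({a1,a2} \<union> v ` ?I)) = 7"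
      using card_7_split[OF _ _ v(2,3), of x] d by simp
    have e1: "{v 1,a1,v 2} \<in> E"
    proof (rule v(5))
      show "nice a1 (v 2)" using v(4)[of 2 a1] nice_sym by simp
      show "one_of A (v 1) a1 (v 2)" using vW(2)[of 1] vW(2)[of 2] e(2) vd[of 1 2] by (auto simp: one_of_def)
    qed simp_all
    have e2: "{v 3,a2,v 4} \<in> E"
    proof (rule v(5))
      show "nice a2 (v 4)" using v(4)[of 4 a2] nice_sym by simp
      show "one_of A (v 3) a2 (v 4)" using vW(2)[of 3] vW(2)[of 4] e(3) vd[of 3 4] by (auto simp: one_of_def)
    qed simp_all
    have "{x,a1,a2} \<inter> {v 1,a1,v 2} \<inter> {v 3,a2,v 4} \<noteq> {}"
      by (rule good_7_clique[OF g c7 cl7 e(1) e1 e2]) simp_all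
    moreover have "{v 1,a1,v 2} \<inter> {v 3,a2,v 4} = {}"
      using vS[of 1] vS[of 2] vS[of 3] vS[of 4] vd[of 1 3] vd[of 1 4] vd[of 2 3] vd[of 2 4] d by auto
    ultimately show False by (simp only: Int_assoc Int_empty_right)
  qed
  \<comment> \<open>Niceness makes \<open>y\<close> covered with \<open>b1\<close> and
    \<open>b2\<close>. Three vertices of \<open>NB\<close> complete \<open>x,y,b1,b2\<close> to a
    7-clique, in which \<open>{v 1,y,v 2}\<close> is disjoint from \<open>{x,b1,b2}\<close>.\<close>
  have ABB: False if e: "{x,b1,b2} \<in> E" "b1 \<in> ?B" "b2 \<in> ?B" and y: "y \<in> NA" "nice y b1" "nice y b2" for b1 b2 y
  proof -
    have yA: "y \<in> A" "y \<in> W" "covered E x y" using y AW by (auto simp: NA_def)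
    have d: "b1 \<noteq> b2" "b1 \<noteq> x" "b2 \<noteq> x" "y \<noteq> b1" "y \<noteq> b2" "y \<noteq> x"
      using dist3[OF e(1)] e yA xW by (auto simp: card_3_distinct)
    have S: "{y,b1,b2} \<subseteq> W" "card {y,b1,b2} + card {1,2,3::nat} \<le> 7" using e yA d by auto
    have "\<exists>v. is_transversal {1,2,3::nat} {y,b1,b2} (\<lambda>_. NB) v"
      by (rule transversal_exists) (use S NW NBbig in auto)
    then obtain v where tv: "is_transversal {1,2,3::nat} {y,b1,b2} (\<lambda>_. NB) v" ..
    note v = is_transversalD[OF tv]
    let ?I = "{1,2,3::nat}"
    have vW: "v i \<in> W" "v i \<notin> A" "covered E x (v i)" if "i \<in> ?I" for i using v(1)[OF that] NW by (auto simp: NB_def)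
    have vd: "v i \<noteq> v j" if "i \<in> ?I" "j \<in> ?I" "i \<noteq> j" for i j using v(2) that by (meson inj_onD)
    have vS: "v i \<notin> {y,b1,b2}" if "i \<in> ?I" for i using v(3) imageI[OF that, of v] by (metis disjoint_iff)
    have TW: "{y,b1,b2} \<union> v ` ?I \<subseteq> W" using S(1) vW(1) by (metis Un_least image_subsetI)
    have cyb: "covered E y b1" "covered E y b2"
      by (rule cov; use y e yA d in simp)+
    have cl: "clique E ({y,b1,b2} \<union> v ` ?I)"
    proof (rule clique_unionI)
      have "covered E b1 b2" by (rule coveredI[OF e(1)]) simp_all
      then show "clique E {y,b1,b2}"
        using cyb covered_sym[of E b1 b2] covered_sym[of E y b1] covered_sym[of E y b2] by (simp add: clique_def)
      fix i q assume i: "i \<in> ?I" and q: "q \<in> {y,b1,b2} \<union> v ` ?I" and ne: "v i \<noteq> q"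
      show "covered E (v i) q"
        by (rule cov[OF v(4)[OF i q] vW(1)[OF i] subsetD[OF TW q] ne]) (use vW(2)[OF i] in simp)
    qed
    have cl7: "clique E (insert x ({y,b1,b2} \<union> v ` ?I))"
      by (rule clique_insertI[OF cl]) (use vW(3) covx[OF e(1)] yA in \<open>elim UnE insertE imageE; simp\<close>)
    have xT: "x \<notin> {y,b1,b2} \<union> v ` ?I" using TW xW by (meson subsetD)
    then have c7: "card (insert x ({y,b1,b2} \<union> v ` ?I)) = 7"
      using card_7_split[OF _ _ v(2,3), of x] d by simp
    have e1: "{v 1,y,v 2} \<in> E"
    proof (rule v(5))
      show "nice y (v 2)" using v(4)[of 2 y] nice_sym by simp
      show "one_of A (v 1) y (v 2)" using vW(2)[of 1] vW(2)[of 2] yA(1) vd[of 1 2] by (auto simp: one_of_def)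
    qed simp_all
    have "{x,b1,b2} \<inter> {v 1,y,v 2} \<inter> {v 1,y,v 2} \<noteq> {}"
      by (rule good_7_clique[OF g c7 cl7 e(1) e1 e1]) simp_all
    moreover have "{x,b1,b2} \<inter> {v 1,y,v 2} = {}" using vS[of 1] vS[of 2] d xT by auto
    ultimately show False by simp
  qed
  have split_edge: "card (e \<inter> A') = 1"
    if e: "e \<in> E" and A': "A' \<inter> W = A" and at_x: "\<And>u v. {x,u,v} \<in> E \<Longrightarrow> one_of A' x u v" for e A'
  proof (cases "x \<in> e")
    case True
    obtain u v where uv: "e = {x,u,v}"
    proof -
      have "card (e - {x}) = 2" using True tgD(3,4)[OF e] by simp
      then obtain u v where "e - {x} = {u,v}" by (auto simp: card_2_iff)
      then show thesis using True that[of u v] by auto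
    qed
    then show ?thesis using at_x[of u v] one_of_iff[of x u v A'] dist3[of x u v] e by simp
  next
    case False
    then have eW: "e \<subseteq> W" using tgD(2)[OF e] by (auto simp: W_def)
    then have "e \<inter> A' = e \<inter> A" using A' by blast
    then show ?thesis using A[OF e eW] by simp
  qed
  have "\<exists>A'. A' \<inter> W = A \<and> (\<forall>u v. {x,u,v} \<in> E \<longrightarrow> one_of A' x u v)"
  proof (cases "49 * t < real (card NA)")
    case True
    have "one_of A x u v" if uv: "{x,u,v} \<in> E" for u v
    proof -
      have "\<not> (u \<in> ?B \<and> v \<in> ?B)"
      proof
        assume B: "u \<in> ?B \<and> v \<in> ?B"
        have S: "{u,v} \<subseteq> W" "card {u,v} \<le> 6" using B by (auto simp: card_insert_if)
        obtain y where "y \<in> NA" "nice y u" "nice y v" using extend[OF S NW(2) True] by auto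
        then show False using ABB[OF uv] B by blast
      qed
      moreover have "\<not> (u \<in> A \<and> v \<in> A)" using AA[OF uv] by blast
      moreover have "x \<notin> A" using xW AW by blast
      ultimately show ?thesis using in_W[OF uv] dist3[OF uv] by (auto simp: one_of_def card_3_distinct)
    qed
    then show ?thesis using AW by blast
  next
    case small: False
    \<comment> \<open>By \<open>ABB\<close> a single \<open>y\<close> in \<open>NA\<close> forces
      every link pair of \<open>x\<close> to meet the small set \<open>N\<close>, which is too few
      pairs for the degree of \<open>x\<close>.\<close>
    have "NA = {}"
    proof (rule ccontr)
      assume "NA \<noteq> {}"
      then obtain y where y: "y \<in> NA" by blast
      define N where "N = NA \<union> {v\<in>W. \<not> nice y v}"
      have finNN: "finite N" using finN finW by (simp add: N_def)
      have "real (card {v\<in>W. \<not> nice y v}) \<le> t" using card_not_nice y NW by blast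
      then have cN: "real (card N) \<le> 50 * t"
        using small card_Un_le[of NA "{v\<in>W. \<not> nice y v}"] by (simp add: N_def)
      have "{(u, v) \<in> W \<times> W. {x,u,v} \<in> E} \<subseteq> N \<times> W \<union> W \<times> N"
      proof
        fix p assume "p \<in> {(u, v) \<in> W \<times> W. {x,u,v} \<in> E}"
        then obtain u v where uv: "p = (u, v)" "u \<in> W" "v \<in> W" "{x,u,v} \<in> E" by auto
        have "u \<in> N \<or> v \<in> N"
        proof (rule ccontr)
          assume no: "\<not> (u \<in> N \<or> v \<in> N)"
          then have "u \<in> ?B" "v \<in> ?B" "nice y u" "nice y v"
            using uv covx[OF uv(4)] by (auto simp: N_def NA_def)
          then show False using ABB[OF uv(4)] y by blast
        qed
        then show "p \<in> N \<times> W \<union> W \<times> N" using uv by auto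
      qed
      then have "card {(u, v) \<in> W \<times> W. {x,u,v} \<in> E} \<le> card (N \<times> W \<union> W \<times> N)"
        by (rule card_mono[rotated]) (use finW finNN in auto)
      also have "\<dots> \<le> card (N \<times> W) + card (W \<times> N)" by (rule card_Un_le)
      also have "real \<dots> = 2 * (real (card N) * real (card W))" by (simp add: card_cartesian_product)
      also have "\<dots> \<le> 2 * (50 * t * m)" using cN cardW m(2) by (intro mult_left_mono mult_mono) (auto simp: t_def)
      also have "\<dots> = 1 / 10 ^ 5 * m\<^sup>2" by (simp add: t_def power2_eq_square)
      finally show False using px m0 h by (simp add: h_def)
    qed
    then have nA: "u \<notin> A" "v \<notin> A" if "{x,u,v} \<in> E" for u v using covx[OF that] by (auto simp: NA_def)
    have "one_of (insert x A) x u v" if uv: "{x,u,v} \<in> E" for u v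
      using nA[OF uv] in_W[OF uv] dist3[OF uv] xW by (auto simp: one_of_def card_3_distinct)
    moreover have "insert x A \<inter> W = A" using xW AW by blast
    ultimately show ?thesis by blast
  qed
  then show ?thesis unfolding semibip_on_def using split_edge by blast
qed

section \<open>Weights and colourings of the six-vertex pattern\<close>

text \<open>Extracts the deviation \<open>d\<close> from a small term of the deficit identity, once
  its cofactor \<open>c\<close> is bounded below.\<close>

lemma sq_small:
  fixes d c h k :: real
  assumes "d\<^sup>2 / 4 * c \<le> h" "1 / 5 \<le> c" "25 * h \<le> k\<^sup>2" "0 \<le> h" "0 \<le> k"
  shows "\<bar>d\<bar> \<le> k"
proof -
  have "d\<^sup>2 / 4 * (1 / 5) \<le> d\<^sup>2 / 4 * c" using assms(2) by (intro mult_left_mono) auto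
  then have "d\<^sup>2 \<le> k\<^sup>2" using assms(1,3,4) by linarith
  then show ?thesis using assms(5) by (metis abs_le_square_iff abs_of_nonneg)
qed

lemma summand_le:
  fixes a b c d e h :: real
  assumes "0 \<le> a" "0 \<le> b" "0 \<le> c" "0 \<le> d" "0 \<le> e" "a + b + c + d + e \<le> h"
  shows "a \<le> h" "b \<le> h" "c \<le> h" "d \<le> h" "e \<le> h"
  using assms by linarith+

text \<open>A nearly maximal average degree makes the deficit of the edge polynomial at most
  \<open>h\<close>, and hence each of its five nonnegative terms. The need for lower bounds on the
  cofactors dictates the order: the last term fixes the share of \<open>R\<close>, the fourth then
  balances \<open>P\<close> and \<open>Q\<close>, and the first three balance each pair of
  colours.\<close>

lemma g26_sizes_unit:
  fixes y :: "nat \<Rightarrow> real"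
  assumes y0: "\<And>j. 0 \<le> y j" and h: "0 \<le> h" and k: "25 * h \<le> k\<^sup>2" "0 \<le> k" "k \<le> 1 / 100"
    and s: "(\<Sum>j\<in>{1..6}. y j) \<le> 1" "1 - h \<le> (\<Sum>j\<in>{1..6}. y j)"
    and p: "(4 / 9 - h) * (\<Sum>j\<in>{1..6}. y j) \<le> (\<Sum>j\<in>{1..6}. y j * g26_deg y j)"
    and i: "i \<in> {1..6}"
  shows "\<bar>y i - 1 / 6\<bar> \<le> 2 * k"
proof -
  define P Q R where PQR: "P = y 1 + y 2" "Q = y 4 + y 5" "R = y 3 + y 6"
  define s where "s = P + Q + R"
  have sum: "(\<Sum>j\<in>{1..6}. y j) = s" unfolding set16 s_def PQR by simp
  have s1: "s \<le> 1" "1 - h \<le> s" using s unfolding sum by auto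
  have "k\<^sup>2 \<le> 1 / 100 * k" using k(2,3) unfolding power2_eq_square by (intro mult_right_mono) auto
  then have hk: "h \<le> k / 2500" using k(1) by linarith
  have nn: "0 \<le> P" "0 \<le> Q" "0 \<le> R" using y0 by (auto simp: PQR)
  let ?L1 = "(y 1 - y 2)\<^sup>2 / 4 * Q" and ?L2 = "(y 4 - y 5)\<^sup>2 / 4 * P" and ?L3 = "(y 3 - y 6)\<^sup>2 / 4 * (P + Q)"
    and ?L4 = "(P - Q)\<^sup>2 / 4 * (R + (P + Q) / 4)" and ?L5 = "((P + Q) / 2 - s / 3)\<^sup>2 * (4 * s / 3 - (P + Q) / 2) / 2"
  have id: "2 * s ^ 3 / 27 - (\<Sum>j\<in>{1..6}. y j * g26_deg y j) / 6 = ?L1 + ?L2 + ?L3 + ?L4 + ?L5"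
    unfolding s_def PQR by (rule g26_poly)
  have L0: "0 \<le> ?L1" "0 \<le> ?L2" "0 \<le> ?L3" "0 \<le> ?L4" "0 \<le> ?L5"
    using nn by (auto simp: s_def)
  have "s ^ 3 \<le> 1 ^ 3" using s1 nn by (intro power_mono) (auto simp: s_def)
  then have s3: "s ^ 3 \<le> 1" by simp
  have "(4 / 9 - h) * (1 - h) \<le> (4 / 9 - h) * s" using s1 hk k by (intro mult_left_mono) auto
  moreover have "(4 / 9 - h) * (1 - h) = 4 / 9 - 13 / 9 * h + h * h" by (simp add: field_simps)
  moreover have "0 \<le> h * h" by simp
  ultimately have "4 / 9 - 13 / 9 * h \<le> (\<Sum>j\<in>{1..6}. y j * g26_deg y j)" using p unfolding sum by linarith
  then have tot: "?L1 + ?L2 + ?L3 + ?L4 + ?L5 \<le> h" using id s3 h by linarith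
  note L = summand_le[OF L0 tot]
  have b5: "\<bar>(P + Q) / 2 - s / 3\<bar> \<le> k"
  proof (rule sq_small[of _ "2 * (4 * s / 3 - (P + Q) / 2)" h])
    have "((P + Q) / 2 - s / 3)\<^sup>2 / 4 * (2 * (4 * s / 3 - (P + Q) / 2)) = ?L5" by simp
    also have "\<dots> \<le> h" by (rule L(5))
    finally show "((P + Q) / 2 - s / 3)\<^sup>2 / 4 * (2 * (4 * s / 3 - (P + Q) / 2)) \<le> h" .
    have "0 \<le> R" "1 - h \<le> P + Q + R" using nn s1 by (auto simp: s_def)
    then show "1 / 5 \<le> 2 * (4 * s / 3 - (P + Q) / 2)" using hk k nn unfolding s_def by argo
  qed (use k h in auto)
  have PQ: "3 / 5 \<le> P + Q" "1 / 4 \<le> R"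
    using abs_le_D1[OF b5] abs_le_D2[OF b5] s1 hk k(2,3) unfolding s_def by argo+
  have "1 / 5 \<le> R + (P + Q) / 4" using PQ by argo
  then have b4: "\<bar>P - Q\<bar> \<le> k"
    using sq_small[OF L(4)] k h by blast
  have PQ': "1 / 5 \<le> P" "1 / 5 \<le> Q" using abs_le_D1[OF b4] abs_le_D2[OF b4] PQ k(2,3) by argo+
  have b1: "\<bar>y 1 - y 2\<bar> \<le> k" by (rule sq_small[of _ Q h]) (use L(1) PQ' k h in auto)
  have b2: "\<bar>y 4 - y 5\<bar> \<le> k" by (rule sq_small[of _ P h]) (use L(2) PQ' k h in auto)
  have b3: "\<bar>y 3 - y 6\<bar> \<le> k" by (rule sq_small[of _ "P + Q" h]) (use L(3) PQ k h in auto)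
  have "y 1 + y 2 = P" "y 4 + y 5 = Q" "y 3 + y 6 = R" "P + Q + R = s" by (auto simp: PQR s_def)
  then have "\<bar>y 1 - 1 / 6\<bar> \<le> 2 * k \<and> \<bar>y 2 - 1 / 6\<bar> \<le> 2 * k \<and> \<bar>y 3 - 1 / 6\<bar> \<le> 2 * k \<and>
    \<bar>y 4 - 1 / 6\<bar> \<le> 2 * k \<and> \<bar>y 5 - 1 / 6\<bar> \<le> 2 * k \<and> \<bar>y 6 - 1 / 6\<bar> \<le> 2 * k"
    using abs_le_D1[OF b1] abs_le_D2[OF b1] abs_le_D1[OF b2] abs_le_D2[OF b2] abs_le_D1[OF b3] abs_le_D2[OF b3]
      abs_le_D1[OF b4] abs_le_D2[OF b4] abs_le_D1[OF b5] abs_le_D2[OF b5] s1 hk k(2,3)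
    by (intro conjI abs_leI; argo)
  then show ?thesis using i unfolding set16 by auto
qed

text \<open>\<open>G26\<close> is regular: each vertex lies in 8 edges, that is 16 ordered
  pairs.\<close>

lemma g26_deg_mono:
  assumes "\<And>j. j \<in> {1..6} \<Longrightarrow> 0 \<le> y j \<and> y j \<le> u" "i \<in> {1..6}"
  shows "g26_deg y i \<le> 16 * u\<^sup>2"
proof -
  have u: "0 \<le> u" using assms(1)[of 1] by simp
  have "g26_deg y i \<le> g26_deg (\<lambda>_. u) i"
    unfolding g26_deg_def
    by (intro sum_mono mult_mono sum_nonneg mult_nonneg_nonneg) (use assms(1) u in auto)
  also have "\<dots> = 16 * u\<^sup>2"
  proof -
    have "i = 1 \<or> i = 2 \<or> i = 3 \<or> i = 4 \<or> i = 5 \<or> i = 6" using assms(2) by auto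
    moreover have "g26_deg (\<lambda>_. u) 1 = 16 * u\<^sup>2" "g26_deg (\<lambda>_. u) 2 = 16 * u\<^sup>2" "g26_deg (\<lambda>_. u) 3 = 16 * u\<^sup>2"
      "g26_deg (\<lambda>_. u) 4 = 16 * u\<^sup>2" "g26_deg (\<lambda>_. u) 5 = 16 * u\<^sup>2" "g26_deg (\<lambda>_. u) 6 = 16 * u\<^sup>2"
      unfolding g26_deg_eqs by (simp_all add: power2_eq_square)
    ultimately show ?thesis by metis
  qed
  finally show ?thesis .
qed

definition one3 :: "bool \<Rightarrow> bool \<Rightarrow> bool \<Rightarrow> bool" where
  "one3 p q r \<longleftrightarrow> (p \<and> \<not> q \<and> \<not> r) \<or> (\<not> p \<and> q \<and> \<not> r) \<or> (\<not> p \<and> \<not> q \<and> r)"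

section \<open>Finite facts about the six-vertex pattern\<close>

lemma cases16: "i \<in> {1..6::nat} \<Longrightarrow> i = 1 \<or> i = 2 \<or> i = 3 \<or> i = 4 \<or> i = 5 \<or> i = 6"
  by auto

lemma okc_range: "okc i j k \<Longrightarrow> i \<in> {1..6} \<and> j \<in> {1..6} \<and> k \<in> {1..6} \<and> i \<noteq> j \<and> i \<noteq> k \<and> j \<noteq> k"
  using snd_G26[of "{i,j,k}"] card_3_distinct[of i j k] unfolding okc_def by simp

lemma okc_third:
  assumes "i \<in> {1..6}" "j \<in> {1..6}" "i \<noteq> j"
  shows "\<exists>l. okc i j l"
proof -
  have "okc i j 1 \<or> okc i j 2 \<or> okc i j 3 \<or> okc i j 4 \<or> okc i j 5 \<or> okc i j 6"
    using cases16[OF assms(1)] cases16[OF assms(2)] assms(3) by (elim disjE) (simp_all add: okc_iff)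
  then show ?thesis by blast
qed

text \<open>Each colour lies in an edge whose complement is an edge. In \<open>N_empty\<close> this
  gives two disjoint edges inside a 7-clique.\<close>

lemma okc_split:
  assumes "i \<in> {1..6}"
  shows "\<exists>l1 l2 l3 l4 l5. okc i l1 l2 \<and> okc l3 l4 l5 \<and> distinct [i,l1,l2,l3,l4,l5]"
proof -
  have "okc 1 2 4" "okc 2 1 4" "okc 4 1 2" "okc 3 5 6" "okc 5 3 6" "okc 6 3 5" by (simp_all add: okc_iff)
  then have ?thesis if "i = 1 \<or> i = 2 \<or> i = 3 \<or> i = 4 \<or> i = 5 \<or> i = 6"
    using that
    apply (elim disjE)
    subgoal by (intro exI[of _ 2] exI[of _ 4] exI[of _ 3] exI[of _ 5] exI[of _ 6]) simp
    subgoal by (intro exI[of _ 1] exI[of _ 4] exI[of _ 3] exI[of _ 5] exI[of _ 6]) simp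
    subgoal by (intro exI[of _ 5] exI[of _ 6] exI[of _ 1] exI[of _ 2] exI[of _ 4]) simp
    subgoal by (intro exI[of _ 1] exI[of _ 2] exI[of _ 3] exI[of _ 5] exI[of _ 6]) simp
    subgoal by (intro exI[of _ 3] exI[of _ 6] exI[of _ 1] exI[of _ 2] exI[of _ 4]) simp
    subgoal by (intro exI[of _ 3] exI[of _ 5] exI[of _ 1] exI[of _ 2] exI[of _ 4]) simp
    done
  then show ?thesis using cases16[OF assms] by blast
qed

text \<open>Meant for \<open>i\<close> the colour of \<open>x\<close> and \<open>j\<close> the
  colour shared by two vertices of its link: the edge found is disjoint from all three.\<close>

lemma okc_avoid2:
  assumes "i \<in> {1..6}" "j \<in> {1..6}"
  shows "\<exists>l1 l2 l3. okc l1 l2 l3 \<and> {l1,l2,l3} \<inter> {i,j} = {}"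
proof -
  have ok: "okc 1 2 4" "okc 3 5 6" "okc 1 4 5" "okc 2 3 6" "okc 1 3 6" "okc 2 4 5" "okc 1 2 5" "okc 3 4 6" by (simp_all add: okc_iff)
  have "{1,2,4} \<inter> {i,j} = {} \<or> {3,5,6} \<inter> {i,j} = {} \<or> {1,4,5} \<inter> {i,j} = {} \<or> {2,3,6} \<inter> {i,j} = {}
    \<or> {1,3,6} \<inter> {i,j} = {} \<or> {2,4,5} \<inter> {i,j} = {} \<or> {1,2,5} \<inter> {i,j} = {} \<or> {3,4,6} \<inter> {i,j} = {}"
    using cases16[OF assms(1)] cases16[OF assms(2)] by (elim disjE) simp_all
  then show ?thesis using ok by metis
qed

lemma okc_avoid2_rest:
  assumes "i \<in> {1..6}" "j \<in> {1..6}" "i \<noteq> j"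
  shows "\<exists>l1 l2 l3 l4. okc l1 l2 l3 \<and> {l1,l2,l3,l4} = {1..6} - {i,j} \<and> l4 \<notin> {l1,l2,l3}"
proof -
  obtain l1 l2 l3 where l: "okc l1 l2 l3" "{l1,l2,l3} \<inter> {i,j} = {}" using okc_avoid2[OF assms(1,2)] by metis
  note r = okc_range[OF l(1)]
  have "{1..6} - {i,j} - {l1,l2,l3} = {1..6} - {i,j,l1,l2,l3}" by auto
  moreover have "card ({1..6} - {i,j,l1,l2,l3}) = card {1..6::nat} - card {i,j,l1,l2,l3}"
    by (rule card_Diff_subset) (use assms r in auto)
  moreover have "card {i,j,l1,l2,l3} = 5" using r l(2) assms(3) by auto
  ultimately have "card ({1..6} - {i,j} - {l1,l2,l3}) = 1" by simp
  then obtain l4 where l4: "{1..6} - {i,j} - {l1,l2,l3} = {l4}" by (auto simp: card_1_singleton_iff)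
  have "{l1,l2,l3} \<subseteq> {1..6} - {i,j}" using r l(2) by auto
  then have "{l1,l2,l3,l4} = {1..6} - {i,j}" "l4 \<notin> {l1,l2,l3}" using l4 by blast+
  then show ?thesis using l(1) by metis
qed


text \<open>A colour's type is its pair among \<open>{1,2}, {4,5}, {3,6}\<close>, written \<open>P, Q, R\<close>; three distinct colours fail
  to be an edge of \<open>\<G>\<^sup>2\<^sub>6\<close> iff their types are \<open>P, P, R\<close> or \<open>Q, Q, R\<close>.\<close>
definition compat :: "(nat \<Rightarrow> bool) \<Rightarrow> (nat \<Rightarrow> bool) \<Rightarrow> (nat \<Rightarrow> bool) \<Rightarrow> nat \<Rightarrow> nat \<Rightarrow> nat \<Rightarrow> bool" where
  "compat P Q R a b c \<longleftrightarrow> \<not> (P a \<and> P b \<and> R c) \<and> \<not> (P a \<and> R b \<and> P c) \<and> \<not> (R a \<and> P b \<and> P c) \<and>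
    \<not> (Q a \<and> Q b \<and> R c) \<and> \<not> (Q a \<and> R b \<and> Q c) \<and> \<not> (R a \<and> Q b \<and> Q c)"

definition no_three :: "(nat \<Rightarrow> bool) \<Rightarrow> bool" where
  "no_three X \<longleftrightarrow>
    \<not> (X 1 \<and> X 2 \<and> X 3) \<and> \<not> (X 1 \<and> X 2 \<and> X 4) \<and> \<not> (X 1 \<and> X 2 \<and> X 5) \<and> \<not> (X 1 \<and> X 2 \<and> X 6) \<and>
    \<not> (X 1 \<and> X 3 \<and> X 4) \<and> \<not> (X 1 \<and> X 3 \<and> X 5) \<and> \<not> (X 1 \<and> X 3 \<and> X 6) \<and> \<not> (X 1 \<and> X 4 \<and> X 5) \<and>
    \<not> (X 1 \<and> X 4 \<and> X 6) \<and> \<not> (X 1 \<and> X 5 \<and> X 6) \<and> \<not> (X 2 \<and> X 3 \<and> X 4) \<and> \<not> (X 2 \<and> X 3 \<and> X 5) \<and>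
    \<not> (X 2 \<and> X 3 \<and> X 6) \<and> \<not> (X 2 \<and> X 4 \<and> X 5) \<and> \<not> (X 2 \<and> X 4 \<and> X 6) \<and> \<not> (X 2 \<and> X 5 \<and> X 6) \<and>
    \<not> (X 3 \<and> X 4 \<and> X 5) \<and> \<not> (X 3 \<and> X 4 \<and> X 6) \<and> \<not> (X 3 \<and> X 5 \<and> X 6) \<and> \<not> (X 4 \<and> X 5 \<and> X 6)"

text \<open>Six labels, each with a type and no type used three times, are necessarily split into
  three pairs. Only these propositional consequences of a bijection are kept, so that
  \<open>argo\<close> can finish the rigidity lemmas.\<close>

definition balanced :: "(nat \<Rightarrow> bool) \<Rightarrow> (nat \<Rightarrow> bool) \<Rightarrow> (nat \<Rightarrow> bool) \<Rightarrow> bool" where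
  "balanced P Q R \<longleftrightarrow> (P 1 \<or> Q 1 \<or> R 1) \<and> (P 2 \<or> Q 2 \<or> R 2) \<and> (P 3 \<or> Q 3 \<or> R 3) \<and> 
    (P 4 \<or> Q 4 \<or> R 4) \<and> (P 5 \<or> Q 5 \<or> R 5) \<and> (P 6 \<or> Q 6 \<or> R 6) \<and>
    no_three P \<and> no_three Q \<and> no_three R"

lemma balanced_colours:
  fixes f :: "nat \<Rightarrow> nat"
  assumes "inj_on f {1..6}" "f ` {1..6} \<subseteq> {1..6}"
  shows "balanced (\<lambda>l. f l \<in> {1,2}) (\<lambda>l. f l \<in> {4,5}) (\<lambda>l. f l \<in> {3,6})"
proof -
  have part: "f l \<in> {1,2} \<or> f l \<in> {4,5} \<or> f l \<in> {3,6}" if "l \<in> {1..6}" for l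
  proof -
    have "f l \<in> {1..6}" using assms(2) that by blast
    from cases16[OF this] show ?thesis by auto
  qed
  have three: "\<not> (f a \<in> {p,q} \<and> f b \<in> {p,q} \<and> f c \<in> {p,q})"
    if "a \<in> {1..6}" "b \<in> {1..6}" "c \<in> {1..6}" "a \<noteq> b" "a \<noteq> c" "b \<noteq> c" for a b c p q
  proof -
    have "f a \<noteq> f b" "f a \<noteq> f c" "f b \<noteq> f c" using assms(1) that by (meson inj_onD)+
    then show ?thesis by auto
  qed
  show ?thesis unfolding balanced_def no_three_def
    by (intro conjI; (rule part | rule three); simp)
qed

lemma okc_compat:
  assumes "okc (f a) (f b) (f c)"
  shows "compat (\<lambda>l. f l \<in> {1,2}) (\<lambda>l. f l \<in> {4,5}) (\<lambda>l. f l \<in> {3,6}) a b c"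
  using assms unfolding compat_def okc_iff by auto

lemma nonedge_cases:
  assumes "i \<in> {1..6}" "j \<in> {1..6}" "k \<in> {1..6}" "i \<noteq> j" "i \<noteq> k" "j \<noteq> k" "\<not> okc i j k"
  shows "{i,j,k} = {1,2,3} \<or> {i,j,k} = {1,2,6} \<or> {i,j,k} = {3,4,5} \<or> {i,j,k} = {4,5,6}"
proof -
  have "card {i,j,k} = 3" "{i,j,k} \<subseteq> {1..6}" using assms by simp_all
  then show ?thesis using assms(7) G26I[of "{i,j,k}"] unfolding okc_def by argo
qed

text \<open>\<open>\<G>\<^sup>2\<^sub>6\<close> minus a vertex \<open>i\<close>, plus an edge that turns a nonedge through \<open>i\<close> into an edge.\<close>
lemma no_G26_one_link:
  assumes inj: "inj_on f {1..6}" and rng: "f ` {1..6} \<subseteq> {1..6}"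
    and T: "T = {1,2,3} \<or> T = {1,2,6} \<or> T = {3,4,5} \<or> T = {4,5,6}" "i \<in> T" "f ` T \<in> snd G26"
    and H: "\<And>a b c. okc a b c \<Longrightarrow> i \<notin> {a,b,c} \<Longrightarrow> okc (f a) (f b) (f c)"
  shows False
proof -
  define P Q R where "P = (\<lambda>l. f l \<in> {1,2})" and "Q = (\<lambda>l. f l \<in> {4,5})" and "R = (\<lambda>l. f l \<in> {3,6})"
  have "balanced P Q R" unfolding P_def Q_def R_def by (rule balanced_colours[OF inj rng])
  note bal = this[unfolded balanced_def no_three_def]
  let ?K = "compat P Q R"
  have K: "?K a b c" if "okc (f a) (f b) (f c)" for a b c
    using okc_compat[of f a b c] that unfolding P_def Q_def R_def by blast
  have E: "?K a b c" if "i = l" "okc a b c \<and> l \<notin> {a,b,c}" for a b c l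
    using K H that by blast
  have TK: "T = {a,b,c} \<Longrightarrow> ?K a b c" for a b c using T(3) K by (auto simp: okc_def)
  \<comment> \<open>A nonedge \<open>T\<close> and a vertex \<open>i\<close> of it leave twelve
    cases. As \<open>i\<close> lies in 8 of the 16 edges, each case lists the 8 edges that avoid
    \<open>i\<close>; with \<open>T\<close> added they admit no balanced assignment of
    types.\<close>
  have "(?K 1 2 3 \<and> (i = 1 \<or> i = 2 \<or> i = 3)) \<or> (?K 1 2 6 \<and> (i = 1 \<or> i = 2 \<or> i = 6)) \<or>
    (?K 3 4 5 \<and> (i = 3 \<or> i = 4 \<or> i = 5)) \<or> (?K 4 5 6 \<and> (i = 4 \<or> i = 5 \<or> i = 6))"
    using T(1,2) TK[of 1 2 3] TK[of 1 2 6] TK[of 3 4 5] TK[of 4 5 6] by (elim disjE) simp_all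
  then show False
  proof (elim disjE conjE)
    assume i: "?K 1 2 3" "i = 1"
    have "?K 2 3 4" "?K 2 3 5" "?K 2 3 6" "?K 2 4 5" "?K 2 4 6" "?K 2 5 6" "?K 3 4 6" "?K 3 5 6"
      by (rule E[OF i(2)]; simp add: okc_iff)+
    then show False using i(1) bal unfolding compat_def by argo
  next
    assume i: "?K 1 2 3" "i = 2"
    have "?K 1 3 4" "?K 1 3 5" "?K 1 3 6" "?K 1 4 5" "?K 1 4 6" "?K 1 5 6" "?K 3 4 6" "?K 3 5 6"
      by (rule E[OF i(2)]; simp add: okc_iff)+
    then show False using i(1) bal unfolding compat_def by argo
  next
    assume i: "?K 1 2 3" "i = 3"
    have "?K 1 2 4" "?K 1 2 5" "?K 1 4 5" "?K 1 4 6" "?K 1 5 6" "?K 2 4 5" "?K 2 4 6" "?K 2 5 6"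
      by (rule E[OF i(2)]; simp add: okc_iff)+
    then show False using i(1) bal unfolding compat_def by argo
  next
    assume i: "?K 1 2 6" "i = 1"
    have "?K 2 3 4" "?K 2 3 5" "?K 2 3 6" "?K 2 4 5" "?K 2 4 6" "?K 2 5 6" "?K 3 4 6" "?K 3 5 6"
      by (rule E[OF i(2)]; simp add: okc_iff)+
    then show False using i(1) bal unfolding compat_def by argo
  next
    assume i: "?K 1 2 6" "i = 2"
    have "?K 1 3 4" "?K 1 3 5" "?K 1 3 6" "?K 1 4 5" "?K 1 4 6" "?K 1 5 6" "?K 3 4 6" "?K 3 5 6"
      by (rule E[OF i(2)]; simp add: okc_iff)+
    then show False using i(1) bal unfolding compat_def by argo
  next
    assume i: "?K 1 2 6" "i = 6"
    have "?K 1 2 4" "?K 1 2 5" "?K 1 3 4" "?K 1 3 5" "?K 1 4 5" "?K 2 3 4" "?K 2 3 5" "?K 2 4 5"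
      by (rule E[OF i(2)]; simp add: okc_iff)+
    then show False using i(1) bal unfolding compat_def by argo
  next
    assume i: "?K 3 4 5" "i = 3"
    have "?K 1 2 4" "?K 1 2 5" "?K 1 4 5" "?K 1 4 6" "?K 1 5 6" "?K 2 4 5" "?K 2 4 6" "?K 2 5 6"
      by (rule E[OF i(2)]; simp add: okc_iff)+
    then show False using i(1) bal unfolding compat_def by argo
  next
    assume i: "?K 3 4 5" "i = 4"
    have "?K 1 2 5" "?K 1 3 5" "?K 1 3 6" "?K 1 5 6" "?K 2 3 5" "?K 2 3 6" "?K 2 5 6" "?K 3 5 6"
      by (rule E[OF i(2)]; simp add: okc_iff)+
    then show False using i(1) bal unfolding compat_def by argo
  next
    assume i: "?K 3 4 5" "i = 5"
    have "?K 1 2 4" "?K 1 3 4" "?K 1 3 6" "?K 1 4 6" "?K 2 3 4" "?K 2 3 6" "?K 2 4 6" "?K 3 4 6"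
      by (rule E[OF i(2)]; simp add: okc_iff)+
    then show False using i(1) bal unfolding compat_def by argo
  next
    assume i: "?K 4 5 6" "i = 4"
    have "?K 1 2 5" "?K 1 3 5" "?K 1 3 6" "?K 1 5 6" "?K 2 3 5" "?K 2 3 6" "?K 2 5 6" "?K 3 5 6"
      by (rule E[OF i(2)]; simp add: okc_iff)+
    then show False using i(1) bal unfolding compat_def by argo
  next
    assume i: "?K 4 5 6" "i = 5"
    have "?K 1 2 4" "?K 1 3 4" "?K 1 3 6" "?K 1 4 6" "?K 2 3 4" "?K 2 3 6" "?K 2 4 6" "?K 3 4 6"
      by (rule E[OF i(2)]; simp add: okc_iff)+
    then show False using i(1) bal unfolding compat_def by argo
  next
    assume i: "?K 4 5 6" "i = 6"
    have "?K 1 2 4" "?K 1 2 5" "?K 1 3 4" "?K 1 3 5" "?K 1 4 5" "?K 2 3 4" "?K 2 3 5" "?K 2 4 5"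
      by (rule E[OF i(2)]; simp add: okc_iff)+
    then show False using i(1) bal unfolding compat_def by argo
  qed
qed

text \<open>A nonedge \<open>T\<close> of \<open>\<G>\<^sup>2\<^sub>6\<close> together with the edges of \<open>\<G>\<^sup>2\<^sub>6\<close> that meet \<open>T\<close> in at most one vertex.\<close>
lemma no_G26_nonedge:
  assumes inj: "inj_on f {1..6}" and rng: "f ` {1..6} \<subseteq> {1..6}"
    and T: "T = {1,2,3} \<or> T = {1,2,6} \<or> T = {3,4,5} \<or> T = {4,5,6}" "f ` T \<in> snd G26"
    and H: "\<And>a b c. okc a b c \<Longrightarrow> b \<notin> T \<Longrightarrow> c \<notin> T \<Longrightarrow> okc (f a) (f b) (f c)"
  shows False
proof -
  define P Q R where "P = (\<lambda>l. f l \<in> {1,2})" and "Q = (\<lambda>l. f l \<in> {4,5})" and "R = (\<lambda>l. f l \<in> {3,6})"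
  have "balanced P Q R" unfolding P_def Q_def R_def by (rule balanced_colours[OF inj rng])
  note bal = this[unfolded balanced_def no_three_def]
  let ?K = "compat P Q R"
  have K: "?K a b c" if "okc (f a) (f b) (f c)" for a b c
    using okc_compat[of f a b c] that unfolding P_def Q_def R_def by blast
  have TK: "T = {a,b,c} \<Longrightarrow> ?K a b c" for a b c using T(2) K by (auto simp: okc_def)
  have E: "?K a b c" if "T = T'" "okc a b c \<and> b \<notin> T' \<and> c \<notin> T'" for a b c T'
    using K H that by blast
  from T(1) show False
  proof (elim disjE)
    assume T: "T = {1,2,3}"
    have "?K 1 4 5" "?K 1 4 6" "?K 1 5 6" "?K 2 4 5" "?K 2 4 6" "?K 2 5 6" "?K 3 4 6" "?K 3 5 6"
      by (rule E[OF T]; simp add: okc_iff)+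
    then show False using TK[OF T] bal unfolding compat_def by argo
  next
    assume T: "T = {1,2,6}"
    \<comment> \<open>Only the first entry may lie in \<open>T\<close>, hence the order in
      \<open>?K 6 3 4\<close>.\<close>
    have "?K 1 3 4" "?K 1 3 5" "?K 1 4 5" "?K 2 3 4" "?K 2 3 5" "?K 2 4 5" "?K 6 3 4" "?K 6 3 5"
      by (rule E[OF T]; simp add: okc_iff)+
    then show False using TK[OF T] bal unfolding compat_def by argo
  next
    assume T: "T = {3,4,5}"
    have "?K 3 1 6" "?K 3 2 6" "?K 4 1 2" "?K 4 1 6" "?K 4 2 6" "?K 5 1 2" "?K 5 1 6" "?K 5 2 6"
      by (rule E[OF T]; simp add: okc_iff)+
    then show False using TK[OF T] bal unfolding compat_def by argo
  next
    assume T: "T = {4,5,6}"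
    have "?K 4 1 2" "?K 4 1 3" "?K 4 2 3" "?K 5 1 2" "?K 5 1 3" "?K 5 2 3" "?K 6 1 3" "?K 6 2 3"
      by (rule E[OF T]; simp add: okc_iff)+
    then show False using TK[OF T] bal unfolding compat_def by argo
  qed
qed

text \<open>\<open>G26\<close> without a vertex still has four vertices all of whose triples are
  edges. These cannot be split: each vertex of the class lies in three of the four triples, and 4 is
  not a multiple of 3.\<close>

lemma no_semibip_one_link:
  assumes i: "i \<in> {1..6}" and H: "\<And>a b c. okc a b c \<Longrightarrow> i \<notin> {a,b,c} \<Longrightarrow> one3 (p a) (p b) (p c)"
  shows False
proof -
  have K4: False if "one3 (p a) (p b) (p c)" "one3 (p a) (p b) (p d)" "one3 (p a) (p c) (p d)" "one3 (p b) (p c) (p d)" for a b c d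
    using that unfolding one3_def by argo
  have E: "one3 (p a) (p b) (p c)" if "i = l" "okc a b c \<and> l \<notin> {a,b,c}" for a b c l
    using H that by blast
  from cases16[OF i] show False
  proof (elim disjE)
    assume "i = 1" then show False by (intro K4[of 2 3 4 6]) (erule E; simp add: okc_iff)+
  next
    assume "i = 2" then show False by (intro K4[of 1 3 4 6]) (erule E; simp add: okc_iff)+
  next
    assume "i = 3" then show False by (intro K4[of 1 2 4 5]) (erule E; simp add: okc_iff)+
  next
    assume "i = 4" then show False by (intro K4[of 1 3 5 6]) (erule E; simp add: okc_iff)+
  next
    assume "i = 5" then show False by (intro K4[of 1 3 4 6]) (erule E; simp add: okc_iff)+
  next
    assume "i = 6" then show False by (intro K4[of 1 2 4 5]) (erule E; simp add: okc_iff)+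
  qed
qed

text \<open>Two vertices of \<open>T\<close> have all three pairs of the complement of
  \<open>T\<close> in their links, and at least one of the two is outside the class. Then exactly
  one vertex of each of these three pairs would be in the class, which is impossible on a
  3-set.\<close>

lemma no_semibip_nonedge:
  assumes T: "T = {1,2,3} \<or> T = {1,2,6} \<or> T = {3,4,5} \<or> T = {4,5,6}"
    and TH: "\<And>a b c. T = {a,b,c} \<Longrightarrow> one3 (p a) (p b) (p c)"
    and H: "\<And>a b c. okc a b c \<Longrightarrow> b \<notin> T \<Longrightarrow> c \<notin> T \<Longrightarrow> one3 (p a) (p b) (p c)"
  shows False
proof -
  have E: "one3 (p a) (p b) (p c)" if "T = T'" "okc a b c \<and> b \<notin> T' \<and> c \<notin> T'" for a b c T'
    using H that by blast
  from T show False
  proof (elim disjE)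
    assume T: "T = {1,2,3}"
    have "one3 (p 1) (p 4) (p 5)" "one3 (p 1) (p 4) (p 6)" "one3 (p 1) (p 5) (p 6)" "one3 (p 2) (p 4) (p 5)" "one3 (p 2) (p 4) (p 6)" "one3 (p 2) (p 5) (p 6)" "one3 (p 3) (p 4) (p 6)" "one3 (p 3) (p 5) (p 6)"
      by (rule E[OF T]; simp add: okc_iff)+
    then show False using TH[OF T] unfolding one3_def by argo
  next
    assume T: "T = {1,2,6}"
    have "one3 (p 1) (p 3) (p 4)" "one3 (p 1) (p 3) (p 5)" "one3 (p 1) (p 4) (p 5)" "one3 (p 2) (p 3) (p 4)" "one3 (p 2) (p 3) (p 5)" "one3 (p 2) (p 4) (p 5)" "one3 (p 6) (p 3) (p 4)" "one3 (p 6) (p 3) (p 5)"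
      by (rule E[OF T]; simp add: okc_iff)+
    then show False using TH[OF T] unfolding one3_def by argo
  next
    assume T: "T = {3,4,5}"
    have "one3 (p 3) (p 1) (p 6)" "one3 (p 3) (p 2) (p 6)" "one3 (p 4) (p 1) (p 2)" "one3 (p 4) (p 1) (p 6)" "one3 (p 4) (p 2) (p 6)" "one3 (p 5) (p 1) (p 2)" "one3 (p 5) (p 1) (p 6)" "one3 (p 5) (p 2) (p 6)"
      by (rule E[OF T]; simp add: okc_iff)+
    then show False using TH[OF T] unfolding one3_def by argo
  next
    assume T: "T = {4,5,6}"
    have "one3 (p 4) (p 1) (p 2)" "one3 (p 4) (p 1) (p 3)" "one3 (p 4) (p 2) (p 3)" "one3 (p 5) (p 1) (p 2)" "one3 (p 5) (p 1) (p 3)" "one3 (p 5) (p 2) (p 3)" "one3 (p 6) (p 1) (p 3)" "one3 (p 6) (p 2) (p 3)"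
      by (rule E[OF T]; simp add: okc_iff)+
    then show False using TH[OF T] unfolding one3_def by argo
  qed
qed

text \<open>Moves the two alternatives for a 6-clique to the index set \<open>{1..6}\<close>; the
  indices will be the intended colours of the vertices.\<close>

lemma good_6_clique:
  assumes g: "good E" and E3: "\<And>e. e \<in> E \<Longrightarrow> card e = 3"
    and S: "inj_on s {1..6}" "clique E (s ` {1..6::nat})"
  obtains p where "\<And>a b c. {a,b,c} \<subseteq> {1..6} \<Longrightarrow> s ` {a,b,c} \<in> E \<Longrightarrow> one3 (p a) (p b) (p c)"
    | f where "inj_on f {1..6}" "f ` {1..6} \<subseteq> {1..6}" "\<And>T. T \<subseteq> {1..6} \<Longrightarrow> s ` T \<in> E \<Longrightarrow> f ` T \<in> snd G26"
proof -
  have "card (s ` {1..6}) = 6" using S(1) by (simp add: card_image)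
  then have "semibip_on E (s ` {1..6}) \<or> G26_inj E (s ` {1..6})" using g S(2) unfolding good_def by blast
  then show ?thesis
  proof
    assume "semibip_on E (s ` {1..6})"
    then obtain A where A: "\<And>e. e \<in> E \<Longrightarrow> e \<subseteq> s ` {1..6} \<Longrightarrow> card (e \<inter> A) = 1" unfolding semibip_on_def by metis
    show ?thesis
    proof (rule that(1)[of "\<lambda>l. s l \<in> A"])
      fix a b c assume abc: "{a,b,c} \<subseteq> {1..6::nat}" "s ` {a,b,c} \<in> E"
      then have "{s a, s b, s c} \<in> E" by simp
      moreover have "card (s ` {a,b,c} \<inter> A) = 1" using A[OF abc(2) image_mono[OF abc(1)]] .
      ultimately have "one_of A (s a) (s b) (s c)" using one_of_iff[of "s a" "s b" "s c" A] E3 by simp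
      then show "one3 (s a \<in> A) (s b \<in> A) (s c \<in> A)" unfolding one_of_def one3_def by argo
    qed
  next
    assume "G26_inj E (s ` {1..6})"
    then obtain c where c: "inj_on c (s ` {1..6})" "c ` s ` {1..6} \<subseteq> {1..6}"
      "\<And>e. e \<in> E \<Longrightarrow> e \<subseteq> s ` {1..6} \<Longrightarrow> c ` e \<in> snd G26" unfolding G26_inj_def by metis
    show ?thesis
    proof (rule that(2)[of "c \<circ> s"])
      show "inj_on (c \<circ> s) {1..6}" using S(1) c(1) by (rule comp_inj_on)
      show "(c \<circ> s) ` {1..6} \<subseteq> {1..6}" using c(2) by (simp only: image_comp)
      fix T assume "T \<subseteq> {1..6::nat}" "s ` T \<in> E"
      then show "(c \<circ> s) ` T \<in> snd G26" using c(3)[OF _ image_mono] by (simp only: image_comp[symmetric])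
    qed
  qed
qed

section \<open>Adding a vertex to a coloured system\<close>

text \<open>Used twice: on the vertices other than \<open>x\<close>, and then, with a coarser error,
  on all vertices with \<open>x\<close> coloured.\<close>

locale g26_frame = near_complete W E "\<lambda>u v w. okc (c u) (c v) (c w)" t
  for W :: "'a set" and E and c :: "'a \<Rightarrow> nat" and t +
  assumes cW: "w \<in> W \<Longrightarrow> c w \<in> {1..6}"
    and big: "l \<in> {1..6} \<Longrightarrow> 49 * t < real (card {w\<in>W. c w = l})"
begin

text \<open>Two distinct colours lie in a common edge of \<open>G26\<close>, so the pair has a whole
  colour class of ideal third vertices.\<close>

lemma cov:
  assumes "nice u v" "u \<in> W" "v \<in> W" "c u \<noteq> c v"
  shows "covered E u v"
proof (rule nice_covered[OF assms(1)])
  obtain l where l: "okc (c u) (c v) l" using okc_third[OF cW[OF assms(2)] cW[OF assms(3)] assms(4)] ..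
  have "card {w\<in>W. c w = l} \<le> card {w\<in>W. okc (c u) (c v) (c w)}"
    by (rule card_mono) (use finW l in auto)
  then show "t < real (card {w\<in>W. okc (c u) (c v) (c w)})"
    using big[of l] okc_range[OF l] t6 by simp
qed

text \<open>Chosen vertices are indexed by their colours, and \<open>S\<close> has none of these
  colours, so each pair with a chosen vertex has two distinct colours and is covered.\<close>

lemma transversal_facts:
  assumes tv: "is_transversal I S X v" and I: "I \<subseteq> {1..6}" and X: "\<And>l. l \<in> I \<Longrightarrow> X l \<subseteq> {w\<in>W. c w = l}"
    and S: "S \<subseteq> W" "clique E S" "\<forall>q\<in>S. c q \<notin> I"
  shows "clique E (S \<union> v ` I)" "S \<union> v ` I \<subseteq> W" "\<And>l. l \<in> I \<Longrightarrow> c (v l) = l" "\<And>l. l \<in> I \<Longrightarrow> v l \<in> X l" "finite I"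
    "\<And>l q r. l \<in> I \<Longrightarrow> q \<in> S \<union> v ` I \<Longrightarrow> r \<in> S \<union> v ` I \<Longrightarrow> nice q r \<Longrightarrow> okc l (c q) (c r) \<Longrightarrow> {v l,q,r} \<in> E"
    "\<And>l q. l \<in> I \<Longrightarrow> q \<in> S \<union> v ` I \<Longrightarrow> nice q (v l)"
proof -
  note v = is_transversalD[OF tv]
  show vX: "v l \<in> X l" if "l \<in> I" for l using v(1)[OF that] .
  have vW: "v l \<in> W" and vc: "c (v l) = l" if "l \<in> I" for l using subsetD[OF X[OF that] vX[OF that]] by simp_all
  show "c (v l) = l" if "l \<in> I" for l using vc[OF that] .
  show TW: "S \<union> v ` I \<subseteq> W" using S(1) vW by (metis Un_least image_subsetI)
  show "finite I" using I finite_subset by blast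
  show "nice q (v l)" if "l \<in> I" "q \<in> S \<union> v ` I" for l q using v(4)[OF that] nice_sym by simp
  show "{v l,q,r} \<in> E" if "l \<in> I" "q \<in> S \<union> v ` I" "r \<in> S \<union> v ` I" "nice q r" "okc l (c q) (c r)" for l q r
    using v(5)[OF that(1-4)] that(5) vc[OF that(1)] by simp
  show "clique E (S \<union> v ` I)"
  proof (rule clique_unionI[OF S(2)])
    fix l q assume l: "l \<in> I" and q: "q \<in> S \<union> v ` I" and ne: "v l \<noteq> q"
    have "c (v l) \<noteq> c q"
    proof (cases "q \<in> S")
      case True
      then show ?thesis using S(3) vc[OF l] l by metis
    next
      case False
      then obtain l' where "l' \<in> I" "q = v l'" using q by blast
      then show ?thesis using vc l ne by metis
    qed
    then show "covered E (v l) q" using cov[OF v(4)[OF l q] vW[OF l] subsetD[OF TW q]] by blast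
  qed
qed

end

lemma g26_deg_scale: "g26_deg (\<lambda>l. y l * a) i = g26_deg y i * a\<^sup>2"
proof -
  have "(\<Sum>k\<in>{1..6}. y k * a * of_bool (okc i j k)) = a * (\<Sum>k\<in>{1..6}. y k * of_bool (okc i j k))" for j
    unfolding sum_distrib_left by (intro sum.cong refl) (simp only: mult_ac)
  then show ?thesis unfolding g26_deg_def sum_distrib_right
    by (intro sum.cong refl) (simp only: power2_eq_square mult_ac)
qed

lemma covered_of_edge: "{x,u,v} \<in> E \<Longrightarrow> covered E x u" "{x,u,v} \<in> E \<Longrightarrow> covered E x v" "{x,u,v} \<in> E \<Longrightarrow> covered E u v"
  by (erule coveredI, simp, simp)+

lemma clique_pair: "covered E p q \<Longrightarrow> clique E {p,q}"
  using covered_sym[of E p q] by (simp add: clique_def)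

text \<open>The error scales: the degree condition gives \<open>h\<close>; class sizes then deviate
  from \<open>m / 6\<close> by at most \<open>m / 10^15\<close>; so a coloured vertex misses at most
  \<open>(h + 6 / 10^15) * m^2\<close> ideal pairs, which is below
  \<open>t^2 = m^2 / 10^14\<close>.\<close>

context
  fixes U :: "'a set" and E :: "'a set set" and m :: real and x :: 'a and c :: "'a \<Rightarrow> nat"
  assumes tg: "three_graph (U, E)" and g: "good E" and x: "x \<in> U"
    and m: "m = real (card U)" "10 ^ 33 \<le> m"
    and deg: "\<And>w. w \<in> U \<Longrightarrow> (2 / 9 - 1 / 10 ^ 33) * m\<^sup>2 \<le> real (card {e\<in>E. w \<in> e})"
    and cimg: "c ` (U - {x}) \<subseteq> {1..6}"
    and cedge: "\<And>e. e \<in> E \<Longrightarrow> e \<subseteq> U - {x} \<Longrightarrow> c ` e \<in> snd G26"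
begin

private abbreviation W where "W \<equiv> U - {x}"
private abbreviation t where "t \<equiv> m / 10 ^ 7"
private abbreviation h :: real where "h \<equiv> 1 / 10 ^ 32"
private abbreviation N where "N l \<equiv> {w\<in>W. c w = l \<and> covered E x w}"

private lemma basics:
  shows "finite W" "real (card W) = m - 1" "0 < m" "0 < m\<^sup>2" "\<And>w. w \<in> W \<Longrightarrow> c w \<in> {1..6}" "finite U"
  using three_graphD(1)[OF tg] x m cimg by (auto simp: of_nat_diff card_gt_0_iff Suc_leI)

private lemma pairs: "w \<in> U \<Longrightarrow> (4 / 9 - h) * m\<^sup>2 \<le> real (card {(u, v) \<in> W \<times> W. {w,u,v} \<in> E})"
  by (rule min_degree_pairs[OF tg m deg])

private lemma edge_distinct: "{u,v,w} \<in> E \<Longrightarrow> u \<noteq> v \<and> u \<noteq> w \<and> v \<noteq> w"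
  using three_graphD(3)[OF tg, of "{u,v,w}"] card_3_distinct[of u v w] by simp

private lemma edge_okc: "{u,v,w} \<in> E \<Longrightarrow> u \<in> W \<Longrightarrow> v \<in> W \<Longrightarrow> w \<in> W \<Longrightarrow> okc (c u) (c v) (c w)"
  using cedge[of "{u,v,w}"] by (simp add: okc_def)

private lemma in_W: "{x,u,v} \<in> E \<Longrightarrow> u \<in> W \<and> v \<in> W"
  using three_graphD(2)[OF tg, of "{x,u,v}"] edge_distinct[of x u v] by auto

private lemma sizes:
  assumes "l \<in> {1..6}"
  shows "csize W c l \<le> (1 / 6 + 1 / 10 ^ 15) * m" "(1 / 6 - 1 / 10 ^ 15) * m \<le> csize W c l"
proof -
  define y where "y l = csize W c l * (1 / m)" for l
  note b = basics
  have img: "c ` W \<subseteq> {1..6}" using cimg .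
  have sum: "(\<Sum>j\<in>{1..6}. y j) = (m - 1) / m"
    unfolding y_def sum_distrib_right[symmetric] using sum_csize[OF b(1) _ img] b(2) by simp
  have lo: "1 - h \<le> (m - 1) / m"
  proof -
    have "1 / m \<le> 1 / 10 ^ 33" using m(2) by (intro divide_left_mono) auto
    moreover have "(m - 1) / m = 1 - 1 / m" using b(3) by (simp add: diff_divide_distrib)
    ultimately show ?thesis by simp
  qed
  have "(4 / 9 - h) * m\<^sup>2 * (m - 1) = (\<Sum>w\<in>W. (4 / 9 - h) * m\<^sup>2)" using b(2) by simp
  also have "\<dots> \<le> (\<Sum>w\<in>W. g26_deg (csize W c) (c w))"
  proof (rule sum_mono)
    fix w assume w: "w \<in> W"
    have "real (card {(u, v) \<in> W \<times> W. {w,u,v} \<in> E}) \<le> g26_deg (csize W c) (c w)"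
      by (rule g26_deg_bound[OF tg _ w img cedge]) auto
    then show "(4 / 9 - h) * m\<^sup>2 \<le> g26_deg (csize W c) (c w)" using pairs[of w] w by auto
  qed
  also have "\<dots> = (\<Sum>i\<in>{1..6}. csize W c i * g26_deg (csize W c) i)"
    by (rule sum_by_colour[OF b(1) _ img]) simp
  finally have "(4 / 9 - h) * m\<^sup>2 * (m - 1) * (1 / m) ^ 3 \<le> (\<Sum>i\<in>{1..6}. csize W c i * g26_deg (csize W c) i) * (1 / m) ^ 3"
    by (rule mult_right_mono) (use b(3) in simp)
  also have "\<dots> = (\<Sum>i\<in>{1..6}. y i * g26_deg y i)"
    unfolding y_def g26_deg_scale sum_distrib_right
    by (intro sum.cong refl) (simp only: power3_eq_cube power2_eq_square mult_ac)
  also have "(4 / 9 - h) * m\<^sup>2 * (m - 1) * (1 / m) ^ 3 = (4 / 9 - h) * ((m - 1) / m)"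
    using b(3) by (simp add: power2_eq_square power3_eq_cube)
  finally have p: "(4 / 9 - h) * (\<Sum>j\<in>{1..6}. y j) \<le> (\<Sum>i\<in>{1..6}. y i * g26_deg y i)" unfolding sum .
  \<comment> \<open>\<open>k = 5 / 10^16\<close> solves \<open>25 * h = k^2\<close> exactly.\<close>
  have "\<bar>y l - 1 / 6\<bar> \<le> 2 * (5 / 10 ^ 16)"
  proof (rule g26_sizes_unit[OF _ _ _ _ _ _ _ p assms])
    show "\<And>j. 0 \<le> y j" using b(3) by (simp add: y_def)
    show "(\<Sum>j\<in>{1..6}. y j) \<le> 1" unfolding sum using b(3) by simp
    show "1 - h \<le> (\<Sum>j\<in>{1..6}. y j)" unfolding sum by (rule lo)
  qed (simp_all add: power2_eq_square)
  then have y: "y l \<le> 1 / 6 + 1 / 10 ^ 15" "1 / 6 - 1 / 10 ^ 15 \<le> y l"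
    using abs_le_D1[of "y l - 1 / 6"] abs_le_D2[of "y l - 1 / 6"] by fastforce+
  have "csize W c l = y l * m" using b(3) by (simp add: y_def)
  then show "csize W c l \<le> (1 / 6 + 1 / 10 ^ 15) * m" "(1 / 6 - 1 / 10 ^ 15) * m \<le> csize W c l"
    using mult_right_mono[OF y(1), of m] mult_right_mono[OF y(2), of m] b(3) by simp_all
qed

private lemma deg_upper:
  assumes "i \<in> {1..6}" shows "real (card {(u, v) \<in> W \<times> W. okc i (c u) (c v)}) \<le> (4 / 9 + 6 / 10 ^ 15) * m\<^sup>2"
proof -
  have "real (card {(u, v) \<in> W \<times> W. okc i (c u) (c v)}) = g26_deg (csize W c) i"
    unfolding g26_deg_def by (rule card_pairs_by_colour[OF basics(1) _ cimg]) simp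
  also have "\<dots> \<le> 16 * ((1 / 6 + 1 / 10 ^ 15) * m)\<^sup>2"
    by (rule g26_deg_mono[OF _ assms]) (use sizes(1) in simp)
  also have "\<dots> = 16 * (1 / 6 + 1 / 10 ^ 15)\<^sup>2 * m\<^sup>2" by (simp only: power_mult_distrib mult.assoc)
  also have "\<dots> \<le> (4 / 9 + 6 / 10 ^ 15) * m\<^sup>2"
    by (rule mult_right_mono) (simp_all add: power2_eq_square)
  finally show ?thesis .
qed

text \<open>The colour \<open>i\<close> is a parameter because \<open>x\<close> has none yet; the
  lemma serves the coloured vertices and, with a larger \<open>r\<close>, also
  \<open>x\<close>.\<close>

private lemma missing_upper:
  assumes w: "w \<in> U" and i: "i \<in> {1..6}"
    and lo: "(4 / 9 - r) * m\<^sup>2 \<le> real (card {(u, v) \<in> W \<times> W. okc i (c u) (c v) \<and> {w,u,v} \<in> E})"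
  shows "real (card {(u, v) \<in> W \<times> W. okc i (c u) (c v) \<and> {w,u,v} \<notin> E}) \<le> (r + 6 / 10 ^ 15) * m\<^sup>2"
proof -
  let ?M = "{(u, v) \<in> W \<times> W. okc i (c u) (c v) \<and> {w,u,v} \<notin> E}"
  let ?P = "{(u, v) \<in> W \<times> W. okc i (c u) (c v) \<and> {w,u,v} \<in> E}"
  have fin: "finite ?M" "finite ?P" by (rule finite_subset[of _ "W \<times> W"]; use basics(1) in auto)+
  have "card ?M + card ?P = card (?M \<union> ?P)" by (rule card_Un_disjoint[symmetric]) (use fin in auto)
  also have "?M \<union> ?P = {(u, v) \<in> W \<times> W. okc i (c u) (c v)}" by auto
  finally have "real (card ?M) + real (card ?P) = real (card {(u, v) \<in> W \<times> W. okc i (c u) (c v)})"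
    unfolding of_nat_add[symmetric] by (simp only: of_nat_eq_iff)
  then have "real (card ?M) \<le> (4 / 9 + 6 / 10 ^ 15) * m\<^sup>2 - (4 / 9 - r) * m\<^sup>2" using lo deg_upper[OF i] by linarith
  also have "\<dots> = (r + 6 / 10 ^ 15) * m\<^sup>2" by (simp add: algebra_simps)
  finally show ?thesis .
qed

private lemma missing_W:
  assumes w: "w \<in> W"
  shows "real (card {(u, v) \<in> W \<times> W. okc (c w) (c u) (c v) \<and> {w,u,v} \<notin> E}) \<le> t\<^sup>2"
proof -
  have "{(u, v) \<in> W \<times> W. {w,u,v} \<in> E} = {(u, v) \<in> W \<times> W. okc (c w) (c u) (c v) \<and> {w,u,v} \<in> E}"
    using edge_okc w by blast
  then have "(4 / 9 - h) * m\<^sup>2 \<le> real (card {(u, v) \<in> W \<times> W. okc (c w) (c u) (c v) \<and> {w,u,v} \<in> E})"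
    using pairs[of w] w by simp
  then have "real (card {(u, v) \<in> W \<times> W. okc (c w) (c u) (c v) \<and> {w,u,v} \<notin> E}) \<le> (h + 6 / 10 ^ 15) * m\<^sup>2"
    using missing_upper[OF _ basics(5)[OF w]] w by blast
  also have "\<dots> \<le> t\<^sup>2" unfolding power_divide using basics(4) by simp
  finally show ?thesis .
qed

private lemma frame: "g26_frame W E c t"
proof (unfold_locales)
  show "finite W" by (rule basics(1))
  show "6 \<le> t" using m(2) by simp
  fix u v w
  show "okc (c u) (c v) (c w) \<Longrightarrow> okc (c v) (c u) (c w)" "okc (c u) (c v) (c w) \<Longrightarrow> okc (c u) (c w) (c v)"
    by (rule okc_sym; assumption)+
  show "\<not> okc (c u) (c u) (c w)" using okc_range by blast
  show "w \<in> W \<Longrightarrow> real (card {(u, v) \<in> W \<times> W. okc (c w) (c u) (c v) \<and> {w,u,v} \<notin> E}) \<le> t\<^sup>2" by (rule missing_W)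
  show "w \<in> W \<Longrightarrow> c w \<in> {1..6}" by (rule basics(5))
next
  fix l :: nat assume "l \<in> {1..6}"
  from sizes(2)[OF this] show "49 * t < real (card {w\<in>W. c w = l})" using basics(3) by (simp add: csize_def)
qed

text \<open>A vertex \<open>p\<close> of \<open>N i\<close>, \<open>x\<close>, and one member of
  each other \<open>N l\<close> would form a 7-clique whose six coloured vertices contain two
  disjoint edges.\<close>

private lemma N_empty:
  assumes i: "i \<in> {1..6}" and Nbig: "\<And>l. l \<in> {1..6} \<Longrightarrow> l \<noteq> i \<Longrightarrow> 49 * t < real (card (N l))"
  shows "N i = {}"
proof (rule ccontr)
  assume "N i \<noteq> {}"
  then obtain p where p: "p \<in> W" "c p = i" "covered E x p" by blast
  interpret F: g26_frame W E c t by (rule frame)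
  define I where "I = {1..6} - {i}"
  have I: "I \<subseteq> {1..6}" "finite I" "card I = 5" using i by (auto simp: I_def)
  have S: "{p} \<subseteq> W" "clique E {p}" "\<forall>q\<in>{p}. c q \<notin> I" using p by (auto simp: clique_def I_def)
  have "\<exists>v. F.is_transversal I {p} (\<lambda>l. N l) v"
    by (rule F.transversal_exists) (use I S(1) Nbig in \<open>auto simp: I_def\<close>)
  then obtain v where tv: "F.is_transversal I {p} (\<lambda>l. N l) v" ..
  have X: "N l \<subseteq> {w\<in>W. c w = l}" for l by auto
  note f = F.transversal_facts[OF tv I(1) X S]
  note v = F.is_transversalD(2,3)[OF tv]
  have vx: "covered E x (v l)" if "l \<in> I" for l using f(4)[OF that] by simp
  have xT: "x \<notin> {p} \<union> v ` I" using f(2) by auto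
  have c7: "card (insert x ({p} \<union> v ` I)) = 7" using card_7_split[OF _ I(2) v xT] I by simp
  have cl7: "clique E (insert x ({p} \<union> v ` I))"
    by (rule clique_insertI[OF f(1)]) (use p(3) vx in \<open>elim UnE insertE imageE; simp\<close>)
  obtain l1 l2 l3 l4 l5 where l: "okc i l1 l2" "okc l3 l4 l5" "distinct [i,l1,l2,l3,l4,l5]"
    using okc_split[OF i] by metis
  have lI: "l1 \<in> I" "l2 \<in> I" "l3 \<in> I" "l4 \<in> I" "l5 \<in> I"
    using okc_range[OF l(1)] okc_range[OF l(2)] l(3) by (auto simp: I_def)
  have e1: "{v l1,p,v l2} \<in> E"
    by (rule f(6)[OF lI(1)]) (use f(7)[OF lI(2), of p] lI f(3)[OF lI(2)] p(2) okc_sym(1)[OF l(1)] in simp_all)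
  have e2: "{v l3,v l4,v l5} \<in> E"
    by (rule f(6)[OF lI(3)]) (use f(7)[OF lI(5), of "v l4"] lI f(3)[OF lI(4)] f(3)[OF lI(5)] l(2) in simp_all)
  have "{v l1,p,v l2} \<inter> {v l3,v l4,v l5} \<inter> {v l3,v l4,v l5} \<noteq> {}"
    by (rule good_7_clique[OF g c7 cl7 e1 e2 e2]) (use lI in simp_all)
  moreover have "{v l1,p,v l2} \<inter> {v l3,v l4,v l5} = {}"
  proof -
    have "c z \<in> {i,l1,l2}" if "z \<in> {v l1,p,v l2}" for z using that f(3)[OF lI(1)] f(3)[OF lI(2)] p(2) by auto
    moreover have "c z \<in> {l3,l4,l5}" if "z \<in> {v l3,v l4,v l5}" for z
      using that f(3)[OF lI(3)] f(3)[OF lI(4)] f(3)[OF lI(5)] by auto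
    moreover have "{i,l1,l2} \<inter> {l3,l4,l5} = {}" using l(3) by auto
    ultimately show ?thesis by (metis disjoint_iff)
  qed
  ultimately show False by simp
qed

text \<open>\<open>N_empty\<close> keeps the colours away from \<open>i\<close>. If both ends had
  colour \<open>j\<close>, neighbours of \<open>x\<close> in the four other classes would complete
  \<open>x,p,q\<close> to a 7-clique with an edge disjoint from \<open>{x,p,q}\<close>.\<close>

private lemma link_colours:
  assumes i: "i \<in> {1..6}" and Nbig: "\<And>l. l \<in> {1..6} \<Longrightarrow> l \<noteq> i \<Longrightarrow> 49 * t < real (card (N l))"
    and e: "{x,p,q} \<in> E"
  shows "c p \<noteq> i" "c q \<noteq> i" "c p \<noteq> c q" "c p \<in> {1..6}" "c q \<in> {1..6}"
proof -
  have pq: "p \<in> W" "q \<in> W" "p \<noteq> q" using in_W[OF e] edge_distinct[OF e] by blast+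
  show ci: "c p \<in> {1..6}" "c q \<in> {1..6}" using basics(5) pq by blast+
  have "p \<in> N (c p)" "q \<in> N (c q)" using pq covered_of_edge(1,2)[OF e] by auto
  then show ne: "c p \<noteq> i" "c q \<noteq> i" using N_empty[OF i Nbig] by auto
  show "c p \<noteq> c q"
  proof
    assume eq: "c p = c q"
    interpret F: g26_frame W E c t by (rule frame)
    define j where "j = c p"
    have j: "c p = j" "c q = j" "j \<noteq> i" "j \<in> {1..6}" using eq ne ci by (auto simp: j_def)
    define I where "I = {1..6} - {i,j}"
    have "card I = card {1..6::nat} - card {i,j}" unfolding I_def by (rule card_Diff_subset) (use i j in auto)
    then have I: "I \<subseteq> {1..6}" "finite I" "card I = 4" using j(3) by (auto simp: I_def)
    have S: "{p,q} \<subseteq> W" "clique E {p,q}" "\<forall>q'\<in>{p,q}. c q' \<notin> I"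
      using pq j clique_pair[OF covered_of_edge(3)[OF e]] by (auto simp: I_def)
    have "\<exists>v. F.is_transversal I {p,q} (\<lambda>l. N l) v"
      by (rule F.transversal_exists) (use I S(1) Nbig pq(3) in \<open>auto simp: I_def\<close>)
    then obtain v where tv: "F.is_transversal I {p,q} (\<lambda>l. N l) v" ..
    have X: "N l \<subseteq> {w\<in>W. c w = l}" for l by auto
    note f = F.transversal_facts[OF tv I(1) X S]
    note v = F.is_transversalD(2,3)[OF tv]
    have vx: "covered E x (v l)" if "l \<in> I" for l using f(4)[OF that] by simp
    have xT: "x \<notin> {p,q} \<union> v ` I" using f(2) by auto
    have c7: "card (insert x ({p,q} \<union> v ` I)) = 7" using card_7_split[OF _ I(2) v xT] I pq(3) by simp
    have cl7: "clique E (insert x ({p,q} \<union> v ` I))"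
      by (rule clique_insertI[OF f(1)]) (use covered_of_edge(1,2)[OF e] vx in \<open>elim UnE insertE imageE; simp\<close>)
    obtain l1 l2 l3 where l: "okc l1 l2 l3" "{l1,l2,l3} \<inter> {i,j} = {}" using okc_avoid2[OF i j(4)] by metis
    have lI: "l1 \<in> I" "l2 \<in> I" "l3 \<in> I" using okc_range[OF l(1)] l(2) by (auto simp: I_def)
    have e2: "{v l1,v l2,v l3} \<in> E"
      by (rule f(6)[OF lI(1)]) (use f(7)[OF lI(3), of "v l2"] lI f(3)[OF lI(2)] f(3)[OF lI(3)] l(1) in simp_all)
    have "{x,p,q} \<inter> {v l1,v l2,v l3} \<inter> {v l1,v l2,v l3} \<noteq> {}"
      by (rule good_7_clique[OF g c7 cl7 e e2 e2]) (use lI in simp_all)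
    moreover have "z \<notin> {x,p,q}" if "z \<in> {v l1,v l2,v l3}" for z
      using that lI v(2) xT by blast
    ultimately show False by (metis Int_assoc Int_absorb disjoint_iff)
  qed
qed

text \<open>First round. No edge at \<open>x\<close> other than \<open>{x,p,q}\<close> is available,
  so \<open>x\<close> is only covered with neighbours chosen from the three remaining classes. As
  \<open>p,q\<close> is nice, the resulting 6-clique carries every edge of \<open>G26\<close> that
  avoids \<open>i\<close>, and \<open>{x,p,q}\<close> realises the nonedge \<open>{i,j,k}\<close> on
  top.\<close>

private lemma nice_link:
  assumes i: "i \<in> {1..6}" and Nbig: "\<And>l. l \<in> {1..6} \<Longrightarrow> l \<noteq> i \<Longrightarrow> 49 * t < real (card (N l))"
    and e: "{x,p,q} \<in> E" and nice: "near_complete.nice W E (\<lambda>u v w. okc (c u) (c v) (c w)) t p q"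
  shows "okc i (c p) (c q)"
proof (rule ccontr)
  assume bad: "\<not> okc i (c p) (c q)"
  interpret F: g26_frame W E c t by (rule frame)
  have pq: "p \<in> W" "q \<in> W" "p \<noteq> q" using in_W[OF e] edge_distinct[OF e] by blast+
  define j k where jk: "j = c p" "k = c q"
  have d: "i \<noteq> j" "i \<noteq> k" "j \<noteq> k" "j \<in> {1..6}" "k \<in> {1..6}" using link_colours[OF i Nbig e] unfolding jk by metis+
  note T = nonedge_cases[OF i d(4,5,1,2,3) bad[folded jk]]
  define I where "I = {1..6} - {i,j,k}"
  have "card I = card {1..6::nat} - card {i,j,k}" unfolding I_def by (rule card_Diff_subset) (use i d in auto)
  then have I: "I \<subseteq> {1..6}" "finite I" "card I = 3" using d by (auto simp: I_def)
  have S: "{p,q} \<subseteq> W" "clique E {p,q}" "\<forall>q'\<in>{p,q}. c q' \<notin> I"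
    using pq clique_pair[OF covered_of_edge(3)[OF e]] by (auto simp: I_def jk)
  have "\<exists>v. F.is_transversal I {p,q} (\<lambda>l. N l) v"
    by (rule F.transversal_exists) (use I S(1) Nbig pq(3) in \<open>auto simp: I_def\<close>)
  then obtain v where tv: "F.is_transversal I {p,q} (\<lambda>l. N l) v" ..
  have X: "N l \<subseteq> {w\<in>W. c w = l}" for l by auto
  note f = F.transversal_facts[OF tv I(1) X S]
  have vx: "covered E x (v l)" if "l \<in> I" for l using f(4)[OF that] by simp
  define s where "s l = (if l = i then x else if l = j then p else if l = k then q else v l)" for l
  have sI: "s l = v l" if "l \<in> I" for l using that by (simp add: s_def I_def)
  have sijk: "s i = x" "s j = p" "s k = q" using d by (auto simp: s_def)
  have l_cases: "l \<in> I \<or> l = j \<or> l = k" if "l \<in> {1..6}" "l \<noteq> i" for l using that by (auto simp: I_def)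
  have sT: "s l \<in> {p,q} \<union> v ` I" "c (s l) = l" if "l \<in> {1..6}" "l \<noteq> i" for l
    using l_cases[OF that] sI sijk f(3) jk by auto
  have split: "{1..6} = insert i (insert j (insert k I))" using i d by (auto simp: I_def)
  have im: "s ` {1..6} = insert x ({p,q} \<union> v ` I)"
  proof -
    have "s ` I = v ` I" using sI by simp
    then show ?thesis unfolding split image_insert sijk by simp
  qed
  have cl: "clique E (s ` {1..6})"
    unfolding im by (rule clique_insertI[OF f(1)])
      (use covered_of_edge(1,2)[OF e] vx in \<open>elim UnE insertE imageE; simp\<close>)
  have xT: "x \<notin> {p,q} \<union> v ` I" using f(2) by auto
  have inj: "inj_on s {1..6}"
  proof (rule inj_on_inverseI[of _ "\<lambda>z. if z = x then i else c z"])
    fix l :: nat assume l: "l \<in> {1..6}"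
    show "(if s l = x then i else c (s l)) = l"
    proof (cases "l = i")
      case True
      then show ?thesis using sijk(1) by simp
    next
      case False
      then have "s l \<noteq> x" using sT(1)[OF l] xT by metis
      then show ?thesis using sT(2)[OF l False] by simp
    qed
  qed
  have base: "{s a, s b, s d} \<in> E" if ok: "okc a b d" and a: "a \<in> I" and ne: "b \<noteq> i" "d \<noteq> i" for a b d
  proof -
    note r = okc_range[OF ok]
    have bd: "s b \<in> {p,q} \<union> v ` I" "s d \<in> {p,q} \<union> v ` I" "c (s b) = b" "c (s d) = d" using sT r ne by blast+
    have "F.nice (s b) (s d)"
    proof (cases "d \<in> I")
      case True
      then show ?thesis using f(7)[OF True bd(1)] sI by simp
    next
      case dI: False
      show ?thesis
      proof (cases "b \<in> I")
        case True
        then show ?thesis using f(7)[OF True bd(2)] sI F.nice_sym[of "s b" "s d"] by simp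
      next
        case False
        then have "b = j \<and> d = k \<or> b = k \<and> d = j" using l_cases dI r ne by blast
        then show ?thesis using nice F.nice_sym[of p q] sijk by auto
      qed
    qed
    then show ?thesis using f(6)[OF a bd(1,2)] ok bd(3,4) sI[OF a] by simp
  qed
  have edges: "s ` {a,b,d} \<in> E" if ok: "okc a b d" and ni: "i \<notin> {a,b,d}" for a b d
  proof -
    note r = okc_range[OF ok]
    have ne: "a \<noteq> i" "b \<noteq> i" "d \<noteq> i" using ni by auto
    have ok': "okc b a d" "okc d a b" using okc_sym ok by blast+
    have "a \<in> I \<or> b \<in> I \<or> d \<in> I" using l_cases r ne by metis
    then have "{s a,s b,s d} \<in> E \<or> {s b,s a,s d} \<in> E \<or> {s d,s a,s b} \<in> E"
      using base[OF ok] base[OF ok'(1)] base[OF ok'(2)] ne by blast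
    then show ?thesis by (simp add: insert_commute)
  qed
  have eT: "s ` {i,j,k} \<in> E" using e sijk by simp
  show False
  proof (rule good_6_clique[OF g three_graphD(3)[OF tg] inj cl])
    fix P assume P: "\<And>a b c. {a,b,c} \<subseteq> {1..6} \<Longrightarrow> s ` {a,b,c} \<in> E \<Longrightarrow> one3 (P a) (P b) (P c)"
    show False
    proof (rule no_semibip_one_link[OF i, of P])
      fix a b d assume "okc a b d" "i \<notin> {a,b,d}"
      then show "one3 (P a) (P b) (P d)" using P[OF _ edges] okc_range[of a b d] by simp
    qed
  next
    fix \<phi> assume \<phi>: "inj_on \<phi> {1..6}" "\<phi> ` {1..6} \<subseteq> {1..6}" "\<And>T. T \<subseteq> {1..6} \<Longrightarrow> s ` T \<in> E \<Longrightarrow> \<phi> ` T \<in> snd G26"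
    show False
    proof (rule no_G26_one_link[OF \<phi>(1,2) T])
      show "\<phi> ` {i,j,k} \<in> snd G26" by (rule \<phi>(3)[OF _ eT]) (use i d in simp)
      fix a b d assume "okc a b d" "i \<notin> {a,b,d}"
      then show "okc (\<phi> a) (\<phi> b) (\<phi> d)" using \<phi>(3)[OF _ edges] okc_range[of a b d] by (simp add: okc_def)
    qed simp
  qed
qed

text \<open>At most \<open>m * t\<close> ordered pairs are not nice; the rest of the link of
  \<open>x\<close> conforms to colour \<open>i\<close> and is large enough to leave few expected
  pairs missing.\<close>

private lemma missing_x:
  assumes i: "i \<in> {1..6}" and Nbig: "\<And>l. l \<in> {1..6} \<Longrightarrow> l \<noteq> i \<Longrightarrow> 49 * t < real (card (N l))"
  shows "real (card {(u, v) \<in> W \<times> W. okc i (c u) (c v) \<and> {x,u,v} \<notin> E}) \<le> (m / 1000)\<^sup>2"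
proof -
  interpret F: g26_frame W E c t by (rule frame)
  let ?A = "{(u, v) \<in> W \<times> W. okc i (c u) (c v) \<and> {x,u,v} \<in> E}"
  let ?B = "SIGMA u:W. {v\<in>W. \<not> F.nice u v}"
  have fin: "finite ?A" "finite ?B" by (rule finite_subset[of _ "W \<times> W"]; use basics(1) in auto)+
  have "{(u, v) \<in> W \<times> W. {x,u,v} \<in> E} \<subseteq> ?A \<union> ?B"
  proof
    fix z assume "z \<in> {(u, v) \<in> W \<times> W. {x,u,v} \<in> E}"
    then obtain u v where z: "z = (u, v)" "u \<in> W" "v \<in> W" "{x,u,v} \<in> E" by blast
    have "okc i (c u) (c v) \<or> \<not> F.nice u v" using nice_link[OF i Nbig z(4)] by blast
    then show "z \<in> ?A \<union> ?B" using z by auto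
  qed
  then have "card {(u, v) \<in> W \<times> W. {x,u,v} \<in> E} \<le> card (?A \<union> ?B)" by (rule card_mono[rotated]) (use fin in simp)
  also have "\<dots> \<le> card ?A + card ?B" by (rule card_Un_le)
  finally have 1: "(4 / 9 - h) * m\<^sup>2 \<le> real (card ?A) + real (card ?B)" using pairs[OF x] by linarith
  have "real (card ?B) = (\<Sum>u\<in>W. real (card {v\<in>W. \<not> F.nice u v}))" using basics(1) by simp
  also have "\<dots> \<le> (\<Sum>u\<in>W. t)" by (rule sum_mono) (rule F.card_not_nice)
  also have "\<dots> = (m - 1) * t" using basics(2) by simp
  also have "\<dots> \<le> m * t" using basics(3) by (intro mult_right_mono) auto
  also have "\<dots> = 1 / 10 ^ 7 * m\<^sup>2" by (simp add: power2_eq_square)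
  finally have "(4 / 9 - (h + 1 / 10 ^ 7)) * m\<^sup>2 \<le> real (card ?A)" using 1 by (simp add: algebra_simps)
  then have "real (card {(u, v) \<in> W \<times> W. okc i (c u) (c v) \<and> {x,u,v} \<notin> E}) \<le> (h + 1 / 10 ^ 7 + 6 / 10 ^ 15) * m\<^sup>2"
    by (rule missing_upper[OF x i])
  also have "\<dots> \<le> (m / 1000)\<^sup>2" unfolding power_divide using basics(4) by simp
  finally show ?thesis .
qed

text \<open>The error rises to \<open>m / 1000\<close> because pairs that are not nice may cost
  \<open>x\<close> as much as \<open>m * t = m^2 / 10^7\<close>, which fits below
  \<open>(m / 1000)^2\<close>.\<close>

private lemma frame_x:
  assumes i: "i \<in> {1..6}" and Nbig: "\<And>l. l \<in> {1..6} \<Longrightarrow> l \<noteq> i \<Longrightarrow> 49 * t < real (card (N l))"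
  defines "c' \<equiv> c(x := i)"
  shows "g26_frame U E c' (m / 1000)"
proof (unfold_locales)
  have c'W: "c' w = c w" if "w \<in> W" for w using that by (simp add: c'_def)
  have c'x: "c' x = i" by (simp add: c'_def)
  show "finite U" by (rule basics(6))
  show "6 \<le> m / 1000" using m(2) by simp
  fix u v w
  show "okc (c' u) (c' v) (c' w) \<Longrightarrow> okc (c' v) (c' u) (c' w)" "okc (c' u) (c' v) (c' w) \<Longrightarrow> okc (c' u) (c' w) (c' v)"
    by (rule okc_sym; assumption)+
  show "\<not> okc (c' u) (c' u) (c' w)" using okc_range by blast
  show "w \<in> U \<Longrightarrow> c' w \<in> {1..6}" using basics(5)[of w] i c'W[of w] c'x by (cases "w = x") auto
  assume w: "w \<in> U"
  let ?M = "{(u, v) \<in> U \<times> U. okc (c' w) (c' u) (c' v) \<and> {w,u,v} \<notin> E}"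
  show "real (card ?M) \<le> (m / 1000)\<^sup>2"
  proof (cases "w = x")
    case True
    have "?M \<subseteq> {(u, v) \<in> W \<times> W. okc i (c u) (c v) \<and> {x,u,v} \<notin> E}"
    proof
      fix z assume "z \<in> ?M"
      then obtain u v where z: "z = (u, v)" "u \<in> U" "v \<in> U" "okc i (c' u) (c' v)" "{x,u,v} \<notin> E"
        using True c'x by auto
      have "u \<noteq> x" "v \<noteq> x" using okc_range[OF z(4)] c'x by auto
      then show "z \<in> {(u, v) \<in> W \<times> W. okc i (c u) (c v) \<and> {x,u,v} \<notin> E}" using z c'W by simp
    qed
    then have "card ?M \<le> card {(u, v) \<in> W \<times> W. okc i (c u) (c v) \<and> {x,u,v} \<notin> E}"
      by (rule card_mono[rotated]) (rule finite_subset[of _ "W \<times> W"], use basics(1) in auto)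
    then show ?thesis using missing_x[OF i Nbig] by linarith
  next
    case False
    then have wW: "w \<in> W" using w by simp
    let ?M1 = "{(u, v) \<in> W \<times> W. okc (c w) (c u) (c v) \<and> {w,u,v} \<notin> E}"
    have fin: "finite ?M1" by (rule finite_subset[of _ "W \<times> W"]) (use basics(1) in auto)
    have "?M \<subseteq> ?M1 \<union> ({x} \<times> U \<union> U \<times> {x})"
    proof
      fix z assume "z \<in> ?M"
      then obtain u v where z: "z = (u, v)" "u \<in> U" "v \<in> U" "okc (c w) (c' u) (c' v)" "{w,u,v} \<notin> E"
        using c'W[OF wW] by auto
      show "z \<in> ?M1 \<union> ({x} \<times> U \<union> U \<times> {x})"
      proof (cases "u = x \<or> v = x")
        case True
        then show ?thesis using z by auto
      next
        case False
        then show ?thesis using z c'W by simp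
      qed
    qed
    then have "card ?M \<le> card (?M1 \<union> ({x} \<times> U \<union> U \<times> {x}))"
      by (rule card_mono[rotated]) (use fin basics(6) in simp)
    also have "\<dots> \<le> card ?M1 + (card ({x} \<times> U) + card (U \<times> {x}))"
      by (rule order_trans[OF card_Un_le]) (intro add_left_mono card_Un_le)
    also have "real \<dots> = real (card ?M1) + 2 * m" by (simp add: card_cartesian_product m(1))
    also have "\<dots> \<le> t\<^sup>2 + 2 * m" using missing_W[OF wW] by simp
    also have "\<dots> \<le> (m / 1000)\<^sup>2"
    proof -
      have "10 ^ 33 * m \<le> m\<^sup>2" using m(2) by (simp add: power2_eq_square)
      then show ?thesis unfolding power_divide using basics(3) by simp
    qed
    finally show ?thesis by simp
  qed
next
  fix l :: nat assume l: "l \<in> {1..6}"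
  have "card {w\<in>W. c w = l} \<le> card {w\<in>U. c' w = l}"
    by (rule card_mono) (use basics(6) in \<open>auto simp: c'_def\<close>)
  then have "csize W c l \<le> real (card {w\<in>U. c' w = l})" by (simp add: csize_def)
  then show "49 * (m / 1000) < real (card {w\<in>U. c' w = l})" using sizes(2)[OF l] basics(3) by simp
qed

text \<open>Second round, for arbitrary \<open>p,q\<close>. With \<open>x\<close> in the frame, the
  three further vertices can be chosen nice with \<open>x\<close>, \<open>p\<close> and
  \<open>q\<close> alike. Pairs inside \<open>{x,p,q}\<close> need not be nice, so the guaranteed
  edges are those with at least two new vertices, that is, those meeting \<open>{i,j,k}\<close> at
  most once.\<close>

private lemma link_okc:
  assumes i: "i \<in> {1..6}" and Nbig: "\<And>l. l \<in> {1..6} \<Longrightarrow> l \<noteq> i \<Longrightarrow> 49 * t < real (card (N l))"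
    and e: "{x,p,q} \<in> E"
  shows "okc i (c p) (c q)"
proof (rule ccontr)
  assume bad: "\<not> okc i (c p) (c q)"
  define c' where "c' = c(x := i)"
  interpret F: g26_frame U E c' "m / 1000" unfolding c'_def by (rule frame_x[OF i Nbig])
  have pq: "p \<in> W" "q \<in> W" "p \<noteq> q" "x \<noteq> p" "x \<noteq> q" using in_W[OF e] edge_distinct[OF e] by blast+
  define j k where jk: "j = c p" "k = c q"
  have d: "i \<noteq> j" "i \<noteq> k" "j \<noteq> k" "j \<in> {1..6}" "k \<in> {1..6}" using link_colours[OF i Nbig e] unfolding jk by metis+
  have c': "c' x = i" "c' p = j" "c' q = k" using pq by (auto simp: c'_def jk)
  note T = nonedge_cases[OF i d(4,5,1,2,3) bad[folded jk]]
  define I where "I = {1..6} - {i,j,k}"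
  have "card I = card {1..6::nat} - card {i,j,k}" unfolding I_def by (rule card_Diff_subset) (use i d in auto)
  then have I: "I \<subseteq> {1..6}" "finite I" "card I = 3" using d by (auto simp: I_def)
  have "clique E {x,p,q}"
    by (rule clique_insertI[OF clique_pair]) (use covered_of_edge[OF e] in auto)
  then have S: "{x,p,q} \<subseteq> U" "clique E {x,p,q}" "\<forall>q'\<in>{x,p,q}. c' q' \<notin> I"
    using pq x c' by (auto simp: I_def)
  have card3: "card {x,p,q} = 3" using pq by simp
  have "\<exists>v. F.is_transversal I {x,p,q} (\<lambda>l. {w\<in>U. c' w = l}) v"
    by (rule F.transversal_exists) (use I S(1) F.big card3 in auto)
  then obtain v where tv: "F.is_transversal I {x,p,q} (\<lambda>l. {w\<in>U. c' w = l}) v" ..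
  note f = F.transversal_facts[OF tv I(1) order_refl S]
  define s where "s l = (if l = i then x else if l = j then p else if l = k then q else v l)" for l
  have sI: "s l = v l" if "l \<in> I" for l using that by (simp add: s_def I_def)
  have sijk: "s i = x" "s j = p" "s k = q" using d by (auto simp: s_def)
  have l_cases: "l \<in> I \<or> l = i \<or> l = j \<or> l = k" if "l \<in> {1..6}" for l using that by (auto simp: I_def)
  have sT: "s l \<in> {x,p,q} \<union> v ` I" "c' (s l) = l" if "l \<in> {1..6}" for l
    using l_cases[OF that] sI sijk f(3) c' by auto
  have split: "{1..6} = insert i (insert j (insert k I))" using i d by (auto simp: I_def)
  have im: "s ` {1..6} = {x,p,q} \<union> v ` I"
  proof -
    have "s ` I = v ` I" using sI by simp
    then show ?thesis unfolding split image_insert sijk by simp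
  qed
  have cl: "clique E (s ` {1..6})" unfolding im by (rule f(1))
  have inj: "inj_on s {1..6}" by (rule inj_on_inverseI[of _ c']) (use sT in blast)
  have edges: "s ` {a,b,d'} \<in> E" if ok: "okc a b d'" and nT: "b \<notin> {i,j,k}" "d' \<notin> {i,j,k}" for a b d'
  proof -
    note r = okc_range[OF ok]
    have bI: "b \<in> I" "d' \<in> I" using r nT by (auto simp: I_def)
    have "{v b, s a, v d'} \<in> E"
      by (rule f(6)[OF bI(1)]) (use sT[of a] r bI f(7)[OF bI(2), of "s a"] f(3)[OF bI(2)] okc_sym(1)[OF ok] in simp_all)
    then show ?thesis using sI[OF bI(1)] sI[OF bI(2)] by (simp add: insert_commute)
  qed
  have eT: "s ` {i,j,k} \<in> E" using e sijk by simp
  have sub: "{i,j,k} \<subseteq> {1..6}" using i d by simp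
  show False
  proof (rule good_6_clique[OF g three_graphD(3)[OF tg] inj cl])
    fix P assume P: "\<And>a b c. {a,b,c} \<subseteq> {1..6} \<Longrightarrow> s ` {a,b,c} \<in> E \<Longrightarrow> one3 (P a) (P b) (P c)"
    show False
    proof (rule no_semibip_nonedge[OF T, of P])
      show "one3 (P a) (P b) (P d')" if "{i,j,k} = {a,b,d'}" for a b d'
        using P[of a b d'] eT sub unfolding that by blast
      fix a b d' assume "okc a b d'" "b \<notin> {i,j,k}" "d' \<notin> {i,j,k}"
      then show "one3 (P a) (P b) (P d')" using P[OF _ edges] okc_range[of a b d'] by simp
    qed
  next
    fix \<phi> assume \<phi>: "inj_on \<phi> {1..6}" "\<phi> ` {1..6} \<subseteq> {1..6}" "\<And>T. T \<subseteq> {1..6} \<Longrightarrow> s ` T \<in> E \<Longrightarrow> \<phi> ` T \<in> snd G26"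
    show False
    proof (rule no_G26_nonedge[OF \<phi>(1,2) T])
      show "\<phi> ` {i,j,k} \<in> snd G26" by (rule \<phi>(3)[OF sub eT])
      fix a b d' assume "okc a b d'" "b \<notin> {i,j,k}" "d' \<notin> {i,j,k}"
      then show "okc (\<phi> a) (\<phi> b) (\<phi> d')" using \<phi>(3)[OF _ edges] okc_range[of a b d'] by (simp add: okc_def)
    qed
  qed
qed

text \<open>Otherwise the link of \<open>x\<close> lives almost entirely on four classes of about
  \<open>2 / 3 * m\<close> vertices in total. These have about \<open>4 / 9 * m^2\<close> ordered
  pairs, no more than the degree of \<open>x\<close> demands, so the link contains many pairs inside
  a single class. Two such pairs from different classes are the core of the 7-clique.\<close>

private lemma two_small:
  assumes i: "i1 \<in> {1..6}" "i2 \<in> {1..6}" "i1 \<noteq> i2"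
    and small: "real (card (N i1)) \<le> 49 * t" "real (card (N i2)) \<le> 49 * t"
  shows False
proof -
  interpret F: g26_frame W E c t by (rule frame)
  obtain l1 l2 l3 l4 where l: "okc l1 l2 l3" "{l1,l2,l3,l4} = {1..6} - {i1,i2}" "l4 \<notin> {l1,l2,l3}"
    using okc_avoid2_rest[OF i] by metis
  note r = okc_range[OF l(1)]
  have l4: "l4 \<in> {1..6}" using l(2) by blast
  define Y where "Y = {w\<in>W. c w \<notin> {i1,i2}}"
  define M where "M = N i1 \<union> N i2"
  define D where "D j = {(u, v) \<in> W \<times> W. c u = j \<and> c v = j \<and> {x,u,v} \<in> E}" for j
  have finY: "finite Y" "finite M" "finite (D j)" for j
    using basics(1) by (auto simp: Y_def M_def D_def intro: finite_subset[of _ "W \<times> W"])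
  have "card M \<le> card (N i1) + card (N i2)" unfolding M_def by (rule card_Un_le)
  then have cM: "real (card M) \<le> 98 * t" using small by linarith
  have cY: "real (card Y) \<le> 4 * ((1 / 6 + 1 / 10 ^ 15) * m)"
  proof -
    let ?V = "\<lambda>l. {w\<in>W. c w = l}"
    have "Y \<subseteq> ?V l1 \<union> (?V l2 \<union> (?V l3 \<union> ?V l4))"
    proof
      fix w assume "w \<in> Y"
      then have w: "w \<in> W" "c w \<in> {1..6} - {i1,i2}" using basics(5) by (auto simp: Y_def)
      then have "c w \<in> {l1,l2,l3,l4}" unfolding l(2) by simp
      then show "w \<in> ?V l1 \<union> (?V l2 \<union> (?V l3 \<union> ?V l4))" using w(1) by blast
    qed
    then have "card Y \<le> card (?V l1 \<union> (?V l2 \<union> (?V l3 \<union> ?V l4)))" by (rule card_mono[rotated]) (use basics(1) in simp)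
    also have "\<dots> \<le> card (?V l1) + (card (?V l2) + (card (?V l3) + card (?V l4)))"
      by (intro order_trans[OF card_Un_le] add_left_mono card_Un_le)
    also have "real \<dots> = csize W c l1 + csize W c l2 + csize W c l3 + csize W c l4" by (simp add: csize_def)
    also have "\<dots> \<le> 4 * ((1 / 6 + 1 / 10 ^ 15) * m)" using sizes(1)[of l1] sizes(1)[of l2] sizes(1)[of l3] sizes(1)[OF l4] r by linarith
    finally show ?thesis by simp
  qed
  \<comment> \<open>Ordered pairs inside one class make up about \<open>1 / 36 * m^2\<close>; the
    bound \<open>1 / 100\<close> leaves room for the errors.\<close>
  have dense: "1 / 100 * m\<^sup>2 \<le> real (card (D j))" if "j \<in> {l1,l2,l3,l4}" for j
  proof -
    have j: "j \<in> {1..6}" "j \<noteq> i1" "j \<noteq> i2" using that l(2) by auto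
    let ?V = "{w\<in>W. c w = j}"
    have VY: "?V \<subseteq> Y" using j by (auto simp: Y_def)
    have fV: "finite ?V" using basics(1) by simp
    have "{(u, v) \<in> W \<times> W. {x,u,v} \<in> E} \<subseteq> (M \<times> W \<union> W \<times> M) \<union> ((Y \<times> Y - ?V \<times> ?V) \<union> D j)"
    proof
      fix z assume "z \<in> {(u, v) \<in> W \<times> W. {x,u,v} \<in> E}"
      then obtain u v where z: "z = (u, v)" "u \<in> W" "v \<in> W" "{x,u,v} \<in> E" by blast
      have uv: "u \<in> Y \<or> u \<in> M" "v \<in> Y \<or> v \<in> M"
        using z covered_of_edge(1,2)[OF z(4)] by (auto simp: Y_def M_def)
      show "z \<in> (M \<times> W \<union> W \<times> M) \<union> ((Y \<times> Y - ?V \<times> ?V) \<union> D j)"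
        using uv z by (cases "u \<in> M \<or> v \<in> M"; cases "c u = j \<and> c v = j") (auto simp: D_def)
    qed
    then have "card {(u, v) \<in> W \<times> W. {x,u,v} \<in> E} \<le> card ((M \<times> W \<union> W \<times> M) \<union> ((Y \<times> Y - ?V \<times> ?V) \<union> D j))"
      by (rule card_mono[rotated]) (use finY basics(1) in simp)
    also have "\<dots> \<le> card (M \<times> W \<union> W \<times> M) + (card (Y \<times> Y - ?V \<times> ?V) + card (D j))"
      by (intro order_trans[OF card_Un_le] add_left_mono card_Un_le)
    also have "\<dots> \<le> (card (M \<times> W) + card (W \<times> M)) + (card (Y \<times> Y - ?V \<times> ?V) + card (D j))"
      by (intro add_right_mono card_Un_le)
    finally have 1: "(4 / 9 - h) * m\<^sup>2 \<le> real (card (M \<times> W)) + real (card (W \<times> M)) + real (card (Y \<times> Y - ?V \<times> ?V)) + real (card (D j))"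
      using pairs[OF x] by linarith
    have sub: "?V \<times> ?V \<subseteq> Y \<times> Y" using VY by blast
    have "card (Y \<times> Y - ?V \<times> ?V) = card (Y \<times> Y) - card (?V \<times> ?V)"
      by (rule card_Diff_subset) (use fV sub in auto)
    moreover have "card (?V \<times> ?V) \<le> card (Y \<times> Y)" by (rule card_mono[OF _ sub]) (use finY in simp)
    ultimately have 2: "real (card (Y \<times> Y - ?V \<times> ?V)) = (real (card Y))\<^sup>2 - (csize W c j)\<^sup>2"
      by (simp add: of_nat_diff card_cartesian_product power2_eq_square csize_def)
    have 3: "(real (card Y))\<^sup>2 \<le> (4 * ((1 / 6 + 1 / 10 ^ 15) * m))\<^sup>2" using cY by (intro power_mono) auto
    have 4: "((1 / 6 - 1 / 10 ^ 15) * m)\<^sup>2 \<le> (csize W c j)\<^sup>2"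
      using sizes(2)[OF j(1)] basics(3) by (intro power_mono) auto
    have "real (card M) * real (card W) \<le> (98 * t) * m" using cM basics(2,3) by (intro mult_mono) auto
    then have 5: "real (card (M \<times> W)) + real (card (W \<times> M)) \<le> 2 * ((98 * t) * m)"
      by (simp add: card_cartesian_product mult.commute)
    have "(4 / 9 - h) * m\<^sup>2 - 2 * ((98 * t) * m) - (4 * ((1 / 6 + 1 / 10 ^ 15) * m))\<^sup>2 + ((1 / 6 - 1 / 10 ^ 15) * m)\<^sup>2
        \<le> real (card (D j))" using 1 2 3 4 5 by linarith
    moreover have "(4 / 9 - h) * m\<^sup>2 - 2 * ((98 * t) * m) - (4 * ((1 / 6 + 1 / 10 ^ 15) * m))\<^sup>2 + ((1 / 6 - 1 / 10 ^ 15) * m)\<^sup>2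
        = (4 / 9 - h - 196 / 10 ^ 7 - (4 * (1 / 6 + 1 / 10 ^ 15))\<^sup>2 + (1 / 6 - 1 / 10 ^ 15)\<^sup>2) * m\<^sup>2"
      by (simp add: power_mult_distrib power2_eq_square algebra_simps)
    moreover have "1 / 100 * m\<^sup>2 \<le> (4 / 9 - h - 196 / 10 ^ 7 - (4 * (1 / 6 + 1 / 10 ^ 15))\<^sup>2 + (1 / 6 - 1 / 10 ^ 15)\<^sup>2) * m\<^sup>2"
      by (rule mult_right_mono) (simp_all add: power2_eq_square)
    ultimately show ?thesis by linarith
  qed
  have Nbig: "49 * t < real (card (N j))" if "j \<in> {l1,l2,l3,l4}" for j
  proof -
    have "D j \<subseteq> N j \<times> W" unfolding D_def using covered_of_edge(1) by fastforce
    then have "card (D j) \<le> card (N j \<times> W)" by (rule card_mono[rotated]) (use basics(1) in simp)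
    then have "real (card (D j)) \<le> real (card (N j)) * real (card W)"
      by (simp only: card_cartesian_product of_nat_mult[symmetric] of_nat_le_iff)
    also have "\<dots> \<le> real (card (N j)) * m" using basics(2) by (intro mult_left_mono) auto
    finally have "(1 / 100 * m) * m \<le> real (card (N j)) * m" using dense[OF that] by (simp add: power2_eq_square)
    then have "1 / 100 * m \<le> real (card (N j))" using basics(3) by simp
    then show ?thesis using basics(3) by simp
  qed
  have "D l1 \<noteq> {}"
  proof
    assume "D l1 = {}"
    then show False using dense[of l1] basics(4) by simp
  qed
  then obtain p1 p2 where p: "p1 \<in> W" "p2 \<in> W" "c p1 = l1" "c p2 = l1" "{x,p1,p2} \<in> E" unfolding D_def by blast
  define B where "B = {v\<in>W. \<not> F.nice p1 v} \<union> {v\<in>W. \<not> F.nice p2 v}"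
  have finB: "finite B" using basics(1) by (simp add: B_def)
  have "card B \<le> card {v\<in>W. \<not> F.nice p1 v} + card {v\<in>W. \<not> F.nice p2 v}" unfolding B_def by (rule card_Un_le)
  then have cB: "real (card B) \<le> 2 * t" using F.card_not_nice[OF p(1)] F.card_not_nice[OF p(2)] by linarith
  have "\<not> D l2 \<subseteq> B \<times> W \<union> W \<times> B"
  proof
    assume "D l2 \<subseteq> B \<times> W \<union> W \<times> B"
    then have "card (D l2) \<le> card (B \<times> W \<union> W \<times> B)" by (rule card_mono[rotated]) (use finB basics(1) in simp)
    also have "\<dots> \<le> card (B \<times> W) + card (W \<times> B)" by (rule card_Un_le)
    also have "real \<dots> = 2 * (real (card B) * real (card W))" by (simp add: card_cartesian_product)
    also have "\<dots> \<le> 2 * (2 * t * m)" using cB basics(2,3) by (intro mult_left_mono mult_mono) auto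
    finally have "1 / 100 * m\<^sup>2 \<le> 2 * (2 * t * m)" using dense[of l2] by simp
    then show False using basics(4) by (simp add: power2_eq_square)
  qed
  then obtain q1 q2 where q: "q1 \<in> W" "q2 \<in> W" "c q1 = l2" "c q2 = l2" "{x,q1,q2} \<in> E" "q1 \<notin> B" "q2 \<notin> B"
    unfolding D_def by blast
  have nice: "F.nice p1 q1" "F.nice p1 q2" "F.nice p2 q1" "F.nice p2 q2" using q by (auto simp: B_def)
  have l12: "l1 \<noteq> l2" using r by blast
  have cv: "covered E p1 q1" "covered E p1 q2" "covered E p2 q1" "covered E p2 q2"
    by (rule F.cov; use nice p q l12 in simp)+
  have pp: "p1 \<noteq> p2" "q1 \<noteq> q2" using edge_distinct[OF p(5)] edge_distinct[OF q(5)] by blast+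
  have pq: "p1 \<noteq> q1" "p1 \<noteq> q2" "p2 \<noteq> q1" "p2 \<noteq> q2" using p q l12 by auto
  define S where "S = {p1,p2,q1,q2}"
  have cS: "card S = 4" using pp pq by (simp add: S_def)
  have "clique E S"
    unfolding S_def
    by (intro clique_insertI[OF clique_insertI[OF clique_pair]])
      (use cv covered_of_edge(3)[OF p(5)] covered_of_edge(3)[OF q(5)] in auto)
  moreover have "c z \<notin> {l3,l4}" if "z \<in> S" for z using that p q r l(3) by (auto simp: S_def)
  moreover have "S \<subseteq> W" using p q by (simp add: S_def)
  ultimately have S: "S \<subseteq> W" "clique E S" "\<forall>z\<in>S. c z \<notin> {l3,l4}" by blast+
  have I: "{l3,l4} \<subseteq> {1..6}" "finite {l3,l4}" "card {l3,l4} = 2" using r l4 l(3) by auto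
  have "\<exists>v. F.is_transversal {l3,l4} S (\<lambda>l. N l) v"
    by (rule F.transversal_exists) (use I S(1) Nbig cS in auto)
  then obtain v where tv: "F.is_transversal {l3,l4} S (\<lambda>l. N l) v" ..
  have X: "N l \<subseteq> {w\<in>W. c w = l}" for l by auto
  note f = F.transversal_facts[OF tv I(1) X S]
  note v = F.is_transversalD(2,3)[OF tv]
  have vx: "covered E x (v l)" if "l \<in> {l3,l4}" for l using f(4)[OF that] by simp
  have xT: "x \<notin> S \<union> v ` {l3,l4}" using f(2) by auto
  have finS: "finite S" by (simp add: S_def)
  have c7: "card (insert x (S \<union> v ` {l3,l4})) = 7" using card_7_split[OF finS I(2) v xT] I(3) cS by simp
  have cl7: "clique E (insert x (S \<union> v ` {l3,l4}))"
  proof (rule clique_insertI[OF f(1)])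
    fix z assume "z \<in> S \<union> v ` {l3,l4}"
    then show "covered E x z"
    proof
      assume "z \<in> S"
      then show ?thesis using covered_of_edge(1,2)[OF p(5)] covered_of_edge(1,2)[OF q(5)] by (auto simp: S_def)
    next
      assume "z \<in> v ` {l3,l4}"
      then show ?thesis using vx by blast
    qed
  qed
  have ok: "okc l3 l1 l2" using okc_sym l(1) by blast
  have e3: "{v l3,p1,q1} \<in> E"
    by (rule f(6)) (use ok p q nice in \<open>simp_all add: S_def\<close>)
  \<comment> \<open>The first two edges meet only in \<open>x\<close>, and the third avoids
    \<open>x\<close>.\<close>
  have ne: "{x,p1,p2} \<inter> {x,q1,q2} \<inter> {v l3,p1,q1} \<noteq> {}"
    by (rule good_7_clique[OF g c7 cl7 p(5) q(5) e3]) (simp_all add: S_def)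
  have one: "{x,p1,p2} \<inter> {x,q1,q2} = {x}" using pq xT by (auto simp: S_def)
  have "x \<notin> {v l3,p1,q1}" using xT by (simp add: S_def)
  then show False using ne unfolding one by blast
qed

text \<open>By \<open>two_small\<close> some colour \<open>i\<close> has all other classes rich in
  neighbours of \<open>x\<close>; it becomes the colour of \<open>x\<close>.\<close>

lemma G26_extend: "G26_on E U"
proof -
  define large where "large l \<longleftrightarrow> 49 * t < real (card (N l))" for l
  have "\<exists>i\<in>{1..6}. \<forall>l\<in>{1..6}. l \<noteq> i \<longrightarrow> large l"
  proof (rule ccontr)
    assume no: "\<not> ?thesis"
    have "(1::nat) \<in> {1..6}" by simp
    then obtain i1 where i1: "i1 \<in> {1..6}" "\<not> large i1" using no by blast
    then obtain i2 where i2: "i2 \<in> {1..6}" "i2 \<noteq> i1" "\<not> large i2" using no by blast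
    show False
      by (rule two_small[OF i1(1) i2(1) i2(2)[symmetric]]) (use i1(2) i2(3) in \<open>simp_all add: large_def\<close>)
  qed
  then obtain i where i: "i \<in> {1..6}" and large: "\<And>l. l \<in> {1..6} \<Longrightarrow> l \<noteq> i \<Longrightarrow> large l" by blast
  note Nbig = large[unfolded large_def]
  have "(c(x := i)) ` e \<in> snd G26" if e: "e \<in> E" for e
  proof (cases "x \<in> e")
    case True
    have "card (e - {x}) = 2" using True three_graphD(3,4)[OF tg e] by simp
    then obtain u v where uv: "e - {x} = {u,v}" by (auto simp: card_2_iff)
    then have ee: "e = {x,u,v}" "u \<noteq> x" "v \<noteq> x" using True by auto
    then have "okc i (c u) (c v)" using link_okc[OF i Nbig] e by blast
    then show ?thesis using ee by (simp add: okc_def insert_commute)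
  next
    case False
    then have "e \<subseteq> W" using three_graphD(2)[OF tg e] by blast
    moreover have "(c(x := i)) ` e = c ` e" using False by (intro image_cong) auto
    ultimately show ?thesis using cedge[OF e] by simp
  qed
  moreover have "(c(x := i)) ` U \<subseteq> {1..6}" using basics(5) i by auto
  ultimately show ?thesis unfolding G26_on_def by metis
qed

end

section \<open>Cleaning and conclusion\<close>

lemma tame_extend:
  fixes m :: real
  assumes tg: "three_graph (U, E)" and g: "good E" and x: "x \<in> U"
    and m: "m = real (card U)" "10 ^ 33 \<le> m"
    and deg: "\<And>w. w \<in> U \<Longrightarrow> (2 / 9 - 1 / 10 ^ 33) * m\<^sup>2 \<le> real (card {e\<in>E. w \<in> e})"
    and tame: "tame E (U - {x})"
  shows "tame E U"
  using tame unfolding tame_def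
proof
  assume "semibip_on E (U - {x})"
  then show "semibip_on E U \<or> G26_on E U" using semibip_extend[OF tg g x m deg] by blast
next
  assume "G26_on E (U - {x})"
  then obtain c where "c ` (U - {x}) \<subseteq> {1..6}" "\<And>e. e \<in> E \<Longrightarrow> e \<subseteq> U - {x} \<Longrightarrow> c ` e \<in> snd G26"
    unfolding G26_on_def by metis
  then show "semibip_on E U \<or> G26_on E U" using G26_extend[OF tg g x m deg] by blast
qed

lemma three_graph_restrict:
  assumes "three_graph (V, E)" "U \<subseteq> V"
  shows "three_graph (U, {e\<in>E. e \<subseteq> U})"
  using assms finite_subset unfolding three_graph_def by auto

text \<open>With \<open>r^2 = eps\<close>, a shortage of \<open>r^2 * n^3\<close> edges leaves room
  for order \<open>r * n\<close> vertices whose degrees fall short by order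
  \<open>r * n^2\<close>.\<close>

definition high_deg :: "'a set \<Rightarrow> real \<Rightarrow> 'a set set \<Rightarrow> 'a set" where
  "high_deg V r E = {w\<in>V. (2 / 9 - 2 * r) * (real (card V))\<^sup>2 \<le> real (card {e\<in>E. w \<in> e})}"

text \<open>Deleting low-degree vertices removes so few edges that the rest would violate
  \<open>good_card\<close>. Only \<open>k\<close>, about \<open>3 * r * n\<close>, of them are
  deleted, as the term \<open>2 / 9 * n * k^2\<close> would dominate for large \<open>k\<close>.
  With \<open>3 * r * n <= k <= 4 * r * n\<close> the contradiction is \<open>6 > 1 + 32 / 9\<close>
  in units of \<open>r^2 * n^3\<close>.\<close>

lemma few_low_degree:
  assumes tg: "three_graph (V, E)" and g: "good E" and r: "0 < r" "r \<le> 1 / 9" and n: "1 \<le> r * real (card V)"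
    and E: "(2 / 27 - r\<^sup>2) * real (card V) ^ 3 \<le> real (card E)"
  shows "real (card (V - high_deg V r E)) < 3 * r * real (card V)"
proof (rule ccontr)
  note tgD = three_graphD[OF tg]
  assume "\<not> ?thesis"
  then have "3 * r * real (card V) \<le> real (card (V - high_deg V r E))" by simp
  then have "nat \<lceil>3 * r * real (card V)\<rceil> \<le> card (V - high_deg V r E)" by linarith
  then obtain Z where Z: "Z \<subseteq> V - high_deg V r E" "card Z = nat \<lceil>3 * r * real (card V)\<rceil>"
    by (metis obtain_subset_with_card_n)
  define n where "n = real (card V)"
  define k where "k = real (card Z)"
  have n0: "0 < n" using n r by (cases "card V = 0") (auto simp: n_def)
  have pos: "0 \<le> 3 * r * n" using r n0 by simp
  have k: "3 * r * n \<le> k" "k \<le> 4 * r * n"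
    using Z(2) pos n unfolding n_def k_def by linarith+
  have finZ: "finite Z" using Z(1) tgD(1) finite_subset by blast
  have ZV: "Z \<subseteq> V" using Z(1) by blast
  let ?E' = "{e\<in>E. e \<subseteq> V - Z}"
  have "E \<subseteq> ?E' \<union> (\<Union>z\<in>Z. {e\<in>E. z \<in> e})" using tgD(2) by blast
  then have "card E \<le> card (?E' \<union> (\<Union>z\<in>Z. {e\<in>E. z \<in> e}))"
    by (rule card_mono[rotated]) (use tgD(5) finZ in simp)
  also have "\<dots> \<le> card ?E' + (\<Sum>z\<in>Z. card {e\<in>E. z \<in> e})"
    by (rule order_trans[OF card_Un_le add_left_mono[OF card_UN_le[OF finZ]]])
  finally have 1: "real (card E) \<le> real (card ?E') + (\<Sum>z\<in>Z. real (card {e\<in>E. z \<in> e}))"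
    unfolding of_nat_sum[symmetric] of_nat_add[symmetric] of_nat_le_iff .
  have "(\<Sum>z\<in>Z. real (card {e\<in>E. z \<in> e})) \<le> (\<Sum>z\<in>Z. (2 / 9 - 2 * r) * n\<^sup>2)"
    by (rule sum_mono) (use Z(1) in \<open>auto simp: high_deg_def n_def\<close>)
  then have 2: "(\<Sum>z\<in>Z. real (card {e\<in>E. z \<in> e})) \<le> k * ((2 / 9 - 2 * r) * n\<^sup>2)" by (simp add: k_def)
  have "card (V - Z) = card V - card Z" by (rule card_Diff_subset[OF finZ ZV])
  then have "real (card (V - Z)) = n - k"
    using card_mono[OF tgD(1) ZV] by (simp add: n_def k_def of_nat_diff)
  moreover have "good ?E'" using g by (rule good_mono) auto
  ultimately have 3: "real (card ?E') \<le> 2 / 27 * (n - k) ^ 3"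
    using good_card[OF three_graph_restrict[OF tg Diff_subset], of Z] by simp
  have "(2 / 27 - r\<^sup>2) * n ^ 3 \<le> 2 / 27 * (n - k) ^ 3 + k * ((2 / 9 - 2 * r) * n\<^sup>2)"
    using E 1 2 3 unfolding n_def by linarith
  also have "\<dots> = 2 / 27 * n ^ 3 + 2 / 9 * (n * k\<^sup>2) - 2 / 27 * k ^ 3 - 2 * (r * k * n\<^sup>2)"
    by (simp add: power2_eq_square power3_eq_cube field_simps)
  finally have 4: "2 * (r * k * n\<^sup>2) \<le> r\<^sup>2 * n ^ 3 + 2 / 9 * (n * k\<^sup>2) - 2 / 27 * k ^ 3" by (simp add: algebra_simps)
  have k0: "0 \<le> k ^ 3" by (simp add: k_def)
  have 5: "r * (3 * r * n) * n\<^sup>2 \<le> r * k * n\<^sup>2" using k(1) r by (intro mult_right_mono mult_left_mono) auto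
  have "k\<^sup>2 \<le> (4 * r * n)\<^sup>2" using k(2) by (intro power_mono) (auto simp: k_def)
  then have 6: "n * k\<^sup>2 \<le> n * (4 * r * n)\<^sup>2" using n0 by (intro mult_left_mono) auto
  have 7: "r * (3 * r * n) * n\<^sup>2 = 3 * (r\<^sup>2 * n ^ 3)" "n * (4 * r * n)\<^sup>2 = 16 * (r\<^sup>2 * n ^ 3)"
    by (simp_all add: power2_eq_square power3_eq_cube)
  have "0 < r\<^sup>2 * n ^ 3" using r n0 by simp
  then show False using 4 5 6 k0 unfolding 7 by linarith
qed

text \<open>An edge at \<open>w\<close> that leaves \<open>U\<close> is determined by one vertex
  outside \<open>U\<close> and one more vertex.\<close>

lemma degree_restrict:
  assumes tg: "three_graph (V, E)" and U: "U \<subseteq> V" "w \<in> U"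
  shows "card {e\<in>E. w \<in> e} \<le> card {e\<in>{e\<in>E. e \<subseteq> U}. w \<in> e} + card (V - U) * card V"
proof -
  note tgD = three_graphD[OF tg]
  let ?B = "\<Union>z\<in>V - U. (\<lambda>y. {w,z,y}) ` V"
  have "{e\<in>E. w \<in> e} \<subseteq> {e\<in>{e\<in>E. e \<subseteq> U}. w \<in> e} \<union> ?B"
  proof
    fix e assume "e \<in> {e\<in>E. w \<in> e}"
    then have e: "e \<in> E" "w \<in> e" by auto
    show "e \<in> {e\<in>{e\<in>E. e \<subseteq> U}. w \<in> e} \<union> ?B"
    proof (cases "e \<subseteq> U")
      case False
      then obtain z where z: "z \<in> e" "z \<notin> U" by blast
      have "w \<noteq> z" using z U by blast
      then have "card (e - {w,z}) = 1" using tgD(3,4)[OF e(1)] e(2) z(1) by (subst card_Diff_subset) auto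
      then obtain y where y: "e - {w,z} = {y}" by (auto simp: card_1_singleton_iff)
      then have "e = {w,z,y}" using e(2) z(1) by blast
      moreover have "z \<in> V - U" "y \<in> V" using tgD(2)[OF e(1)] z y by blast+
      ultimately show ?thesis by blast
    qed (use e in simp)
  qed
  then have "card {e\<in>E. w \<in> e} \<le> card ({e\<in>{e\<in>E. e \<subseteq> U}. w \<in> e} \<union> ?B)"
    by (rule card_mono[rotated]) (use tgD(1,5) in simp)
  also have "\<dots> \<le> card {e\<in>{e\<in>E. e \<subseteq> U}. w \<in> e} + card ?B" by (rule card_Un_le)
  also have "card ?B \<le> (\<Sum>z\<in>V - U. card ((\<lambda>y. {w,z,y}) ` V))" by (rule card_UN_le) (use tgD(1) in simp)
  also have "\<dots> \<le> (\<Sum>z\<in>V - U. card V)" by (intro sum_mono card_image_le tgD(1))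
  finally show ?thesis by simp
qed

lemma tame_high_deg:
  assumes "three_graph (V, E)" "good E" and r: "0 < r" "r \<le> 1 / 10 ^ 34"
    and n: "1 \<le> r * real (card V)" "2 * 10 ^ 33 \<le> real (card V)"
    and "(2 / 27 - r\<^sup>2) * real (card V) ^ 3 \<le> real (card E)"
  shows "tame E (high_deg V r E)"
  using assms(1,2,7)
proof (induction rule: symmetrize_induct)
  case (symmetrized E)
  then have "tame E V" using symmetrized_tame by blast
  then show ?case by (rule tame_subset) (auto simp: high_deg_def)
next
  case (step E v E')
  note tgD = three_graphD[OF step(1)]
  define n where "n = real (card V)"
  let ?W = "high_deg V r E" and ?W' = "high_deg V r E'"
  have r9: "r \<le> 1 / 9" using r(2) by simp
  have E': "(2 / 27 - r\<^sup>2) * real (card V) ^ 3 \<le> real (card E')" using step(6,9) by linarith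
  have small: "real (card (V - ?W)) < 3 * r * n" "real (card (V - ?W')) < 3 * r * n"
    unfolding n_def by (rule few_low_degree[OF step(1,2) r(1) r9 n(1) step(9)], rule few_low_degree[OF step(4,5) r(1) r9 n(1) E'])
  \<comment> \<open>Inside \<open>U0\<close> the two systems have the same edges, so tameness passes
    from \<open>E'\<close> to \<open>E\<close>. All vertices of \<open>U0\<close> have high degree
    in \<open>E\<close>, as reinsertion requires.\<close>
  define U0 where "U0 = ?W \<inter> ?W' - {v}"
  have "tame E' ?W'" using step(8)[OF E'] .
  then have "tame E' U0" by (rule tame_subset) (auto simp: U0_def)
  then have U0: "tame E U0" by (subst tame_cong[of U0 E E']) (use step(7) in \<open>auto simp: U0_def\<close>)
  have "V - U0 \<subseteq> (V - ?W) \<union> ((V - ?W') \<union> {v})" by (auto simp: U0_def)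
  then have "card (V - U0) \<le> card ((V - ?W) \<union> ((V - ?W') \<union> {v}))" by (rule card_mono[rotated]) (use tgD(1) in simp)
  also have "\<dots> \<le> card (V - ?W) + (card (V - ?W') + card {v})"
    by (intro order_trans[OF card_Un_le] add_left_mono card_Un_le)
  \<comment> \<open>Each low-degree set contributes \<open>3 * r * n\<close>; the vertex
    \<open>v\<close> is paid for by \<open>1 <= r * n\<close>.\<close>
  finally have cU0: "real (card (V - U0)) \<le> 7 * r * n" using small n(1) unfolding n_def by simp
  have n0: "0 < n" using n(2) by (simp add: n_def)
  have WV: "?W \<subseteq> V" by (auto simp: high_deg_def)
  have "tame E (U0 \<union> D)" if "finite D" "D \<inter> U0 = {}" "D \<subseteq> ?W" for D
    using that
  proof (induction D rule: finite_induct)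
    case empty
    then show ?case using U0 by simp
  next
    case (insert x D)
    define U where "U = insert x (U0 \<union> D)"
    have UV: "U \<subseteq> V" "U \<subseteq> ?W" using insert.prems WV by (auto simp: U_def U0_def)
    have Ux: "U - {x} = U0 \<union> D" using insert.hyps insert.prems by (auto simp: U_def)
    have "card (V - U) \<le> card (V - U0)" by (rule card_mono) (use tgD(1) in \<open>auto simp: U_def\<close>)
    then have VU: "real (card (V - U)) \<le> 7 * r * n" using cU0 by linarith
    define m where "m = real (card U)"
    have finU: "finite U" using UV(1) tgD(1) finite_subset by blast
    have "card (V - U) = card V - card U" by (rule card_Diff_subset[OF finU UV(1)])
    then have mn: "real (card (V - U)) = n - m" "m \<le> n"
      using card_mono[OF tgD(1) UV(1)] by (simp_all add: n_def m_def of_nat_diff)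
    have "7 * r * n \<le> 1 / 2 * n" using r(2) n0 by (intro mult_right_mono) auto
    then have "1 / 2 * n \<le> m" using mn(1) VU by linarith
    then have m33: "10 ^ 33 \<le> m" using n(2) unfolding n_def[symmetric] by simp
    let ?E = "{e\<in>E. e \<subseteq> U}"
    have cong: "tame ?E Y \<longleftrightarrow> tame E Y" if "Y \<subseteq> U" for Y
      by (rule tame_cong) (use that in auto)
    \<comment> \<open>Restricting to \<open>U\<close> costs at most \<open>7 * r * n^2\<close>
      beyond the \<open>2 * r * n^2\<close> of the threshold, and
      \<open>9 * r <= 1 / 10^33\<close>.\<close>
    have deg: "(2 / 9 - 1 / 10 ^ 33) * m\<^sup>2 \<le> real (card {e\<in>?E. w \<in> e})" if w: "w \<in> U" for w
    proof -
      have "(2 / 9 - 2 * r) * n\<^sup>2 \<le> real (card {e\<in>E. w \<in> e})" using UV(2) w by (auto simp: high_deg_def n_def)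
      also have "\<dots> \<le> real (card {e\<in>?E. w \<in> e} + card (V - U) * card V)"
        using degree_restrict[OF step(1) UV(1) w] by (rule of_nat_mono)
      also have "\<dots> = real (card {e\<in>?E. w \<in> e}) + real (card (V - U)) * n" by (simp add: n_def)
      also have "\<dots> \<le> real (card {e\<in>?E. w \<in> e}) + 7 * r * n * n"
        using VU n0 by (intro add_left_mono mult_right_mono) auto
      finally have "(2 / 9 - 9 * r) * n\<^sup>2 \<le> real (card {e\<in>?E. w \<in> e})" by (simp add: algebra_simps power2_eq_square)
      moreover have "(2 / 9 - 1 / 10 ^ 33) * m\<^sup>2 \<le> (2 / 9 - 9 * r) * n\<^sup>2"
        using r(2) mn(2) by (intro mult_mono power_mono) (auto simp: m_def)
      ultimately show ?thesis by linarith
    qed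
    have "tame E (U0 \<union> D)" using insert.IH insert.prems by auto
    then have "tame ?E (U - {x})" unfolding Ux by (subst cong) (auto simp: U_def)
    moreover have "good ?E" using step(2) by (rule good_mono) auto
    moreover have "x \<in> U" by (simp add: U_def)
    ultimately have "tame ?E U"
      using tame_extend[OF three_graph_restrict[OF step(1) UV(1)] _ _ m_def m33 deg] by blast
    then have "tame E U" using cong[of U] by simp
    then show ?case by (simp add: U_def)
  qed
  from this[of "?W - U0"] have "tame E (U0 \<union> (?W - U0))" using tgD(1) WV finite_subset by blast
  then show ?case by (rule tame_subset) auto
qed

theorem theorem6p1:
  shows "\<exists>eps0::real. eps0 > 0 \<and>
    (\<forall>eps::real. 0 < eps \<and> eps < eps0 \<longrightarrow>
      (\<exists>n0::nat. \<forall>n\<ge>n0. \<forall>(V::'a set) E.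
         three_graph (V, E) \<and> card V = n \<and> M_free (V, E) \<and>
         real (card E) \<ge> 2 * real n ^ 3 / 27 - eps * real n ^ 3 \<longrightarrow>
         (\<exists>W. W \<subseteq> V \<and> real (card W) > real n - 3 * sqrt eps * real n \<and>
              (\<forall>v\<in>W. real (degree (induced (V, E) W) v) \<ge> 2 * real n ^ 2 / 9 - 20 * sqrt eps * real n ^ 2) \<and>
              (semibipartite (induced (V, E) W) \<or> G26_colorable (induced (V, E) W)))))"
proof (intro exI[of _ "1 / 10 ^ 68"] conjI allI impI)
  show "(0::real) < 1 / 10 ^ 68" by simp
  fix eps :: real assume eps: "0 < eps \<and> eps < 1 / 10 ^ 68"
  define r where "r = sqrt eps"
  have r0: "0 < r" using eps by (simp add: r_def)
  have r2: "r\<^sup>2 = eps" using eps by (simp add: r_def)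
  have "sqrt eps \<le> sqrt ((1 / 10 ^ 34)\<^sup>2)" using eps by (intro real_sqrt_le_mono) (simp add: power2_eq_square)
  then have r: "r \<le> 1 / 10 ^ 34" by (simp add: r_def)
  show "\<exists>n0::nat. \<forall>n\<ge>n0. \<forall>(V::'a set) E.
         three_graph (V, E) \<and> card V = n \<and> M_free (V, E) \<and>
         real (card E) \<ge> 2 * real n ^ 3 / 27 - eps * real n ^ 3 \<longrightarrow>
         (\<exists>W. W \<subseteq> V \<and> real (card W) > real n - 3 * sqrt eps * real n \<and>
              (\<forall>v\<in>W. real (degree (induced (V, E) W) v) \<ge> 2 * real n ^ 2 / 9 - 20 * sqrt eps * real n ^ 2) \<and>
              (semibipartite (induced (V, E) W) \<or> G26_colorable (induced (V, E) W)))"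
  \<comment> \<open>The first summand yields \<open>1 <= r * n\<close>, which absorbs rounding. The
    second leaves at least \<open>10^33\<close> vertices even in a set of half the size.\<close>
  proof (intro exI[of _ "nat \<lceil>1 / r\<rceil> + 2 * 10 ^ 33"] allI impI, elim conjE)
    fix n :: nat and V :: "'a set" and E
    assume n: "nat \<lceil>1 / r\<rceil> + 2 * 10 ^ 33 \<le> n" and tg: "three_graph (V, E)" and cV: "card V = n"
      and free: "M_free (V, E)" and cE: "2 * real n ^ 3 / 27 - eps * real n ^ 3 \<le> real (card E)"
    note tgD = three_graphD[OF tg]
    have g: "good E" using M_free_good[OF tg free] .
    have "real (nat \<lceil>1 / r\<rceil>) + 2 * 10 ^ 33 \<le> real n"
      using of_nat_mono[OF n, where 'a=real] by (simp only: of_nat_add of_nat_mult of_nat_power of_nat_numeral)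
    moreover have "1 / r \<le> real (nat \<lceil>1 / r\<rceil>)" by (rule real_nat_ceiling_ge)
    moreover have "0 < 1 / r" "(0::real) \<le> 2 * 10 ^ 33" using r0 by simp_all
    ultimately have n1: "1 / r \<le> real n" "2 * 10 ^ 33 \<le> real n" by linarith+
    have rn: "1 \<le> r * real n" using n1(1) r0 by (simp add: field_simps)
    have E: "(2 / 27 - r\<^sup>2) * real (card V) ^ 3 \<le> real (card E)" using cE unfolding cV r2 by (simp add: algebra_simps)
    define W where "W = high_deg V r E"
    have WV: "W \<subseteq> V" by (auto simp: W_def high_deg_def)
    have tame: "tame E W"
      unfolding W_def by (rule tame_high_deg[OF tg g r0 r _ _ E]) (use rn n1 cV in simp_all)
    have r9: "r \<le> 1 / 9" using r by simp
    have small: "real (card (V - W)) < 3 * r * real n"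
      unfolding W_def using few_low_degree[OF tg g r0 r9 _ E] rn unfolding cV by blast
    have "card (V - W) = card V - card W" by (rule card_Diff_subset) (use WV tgD(1) finite_subset in auto)
    then have "real (card (V - W)) = real n - real (card W)"
      using card_mono[OF tgD(1) WV] by (simp add: cV of_nat_diff)
    then have cW: "real n - 3 * r * real n < real (card W)" using small by linarith
    have deg: "2 * real n ^ 2 / 9 - 20 * r * real n ^ 2 \<le> real (degree (induced (V, E) W) w)" if w: "w \<in> W" for w
    proof -
      have "(2 / 9 - 2 * r) * real n ^ 2 \<le> real (card {e\<in>E. w \<in> e})" using w by (auto simp: W_def high_deg_def cV)
      also have "\<dots> \<le> real (card {e\<in>{e\<in>E. e \<subseteq> W}. w \<in> e} + card (V - W) * card V)"
        using degree_restrict[OF tg WV w] by (rule of_nat_mono)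
      also have "\<dots> = real (degree (induced (V, E) W) w) + real (card (V - W)) * real n"
        by (simp add: cV degree_def induced_def)
      also have "\<dots> \<le> real (degree (induced (V, E) W) w) + 3 * r * real n * real n"
        using small by (intro add_left_mono mult_right_mono) auto
      \<comment> \<open>The threshold costs \<open>2 * r\<close> and the vertices outside
        \<open>W\<close> cost \<open>3 * r\<close>, well within \<open>20 * r\<close>.\<close>
      finally have "(2 / 9 - 5 * r) * real n ^ 2 \<le> real (degree (induced (V, E) W) w)"
        by (simp add: algebra_simps power2_eq_square)
      moreover have "0 \<le> r * real n ^ 2" using r0 by simp
      ultimately show ?thesis by (simp add: algebra_simps)
    qed
    have "semibipartite (induced (V, E) W) \<or> G26_colorable (induced (V, E) W)"
      using tame semibip_on_imp[OF tg] G26_on_imp[OF tg WV] unfolding tame_def by blast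
    then show "\<exists>W\<subseteq>V. real n - 3 * sqrt eps * real n < real (card W) \<and>
              (\<forall>v\<in>W. 2 * real n ^ 2 / 9 - 20 * sqrt eps * real n ^ 2 \<le> real (degree (induced (V, E) W) v)) \<and>
              (semibipartite (induced (V, E) W) \<or> G26_colorable (induced (V, E) W))"
      using WV cW deg unfolding r_def by blast
  qed
qed

end
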